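(* Let $\Sigma$ be a finite alphabet. There is a CFM $\mathcal A_{\mathrm{type}}$ over $P$ and $\Sigma\times\mathrm{Types}$ with $2^{|\Sigma|\cdot2^{\mathcal O(|P|\log|P|)}}$ states such that $L(\mathcal A_{\mathrm{type}})=\{(M,\mathrm{type}_M)\mid M\in\mathrm{MSC}(P,\Sigma)\}$.
   Context: Fix a finite set $P$ of processes. A message sequence chart (MSC) over $P$ and $\Sigma$ is $M=((w_p)_{p\in P},\lhd)$ with $w_p\in\Sigma^*$, at least one nonempty; events $E=\bigcup_pE_p$, $E_p=\{p\}\times\{1,\dots,|w_p|\}$; process relation $(p,i)\to(p,i+1)$; labelling $\lambda(p,i)=(p,a)$ with $a$ the $i$-th letter of $w_p$; message relation $\lhd\subseteq\bigcup_{p\ne q}E_p\times E_q$ with $\to\cup\lhd$ acyclic, each event in at most one $\lhd$-pair, and FIFO: for $(e,f),(e',f')\in\lhd\cap(E_p\times E_q)$, $e\to^*e'$ iff $f\to^*f'$. $\mathrm{MSC}(P,\Sigma)$ is the set of MSCs. Let $\le=(\to\cup\lhd)^*$, $<=(\to\cup\lhd)^+$, $e\parallel f$ iff neither $e\le f$ nor $f\le e$, and $\sqsubset=\,<\setminus(\to\cup\lhd)$. An MSC over $P$ and $\Sigma\times\Gamma$ is identified with a pair $(M,\gamma)$, $M\in\mathrm{MSC}(P,\Sigma)$, $\gamma:E\to\Gamma$. Let $\mathrm{Rel}=\{=,\to,\lhd,\parallel,\to^{-1},\lhd^{-1},\sqsubset,\sqsubset^{-1}\}$; for $\bowtie\in\mathrm{Rel}$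 and $e\in E$, $\mathrm{type}^{\bowtie}_M(e)=\{\lambda(f)\mid f\in E,\ e\bowtie f\}\subseteq P\times\Sigma$ (where $e\,R^{-1}f$ means $f\,R\,e$), $\mathrm{type}_M(e)=(\mathrm{type}^{\bowtie}_M(e))_{\bowtie\in\mathrm{Rel}}$, and $\mathrm{Types}=\prod_{\bowtie\in\mathrm{Rel}}2^{P\times\Sigma}$. A CFM over $P$ and an alphabet $\Sigma_0$ is $((\mathcal A_p)_{p},\mathit{Msg},\mathit{Acc})$ with $\mathcal A_p=(S_p,\iota_p,\Delta_p)$ a finite transition system (states $S_p$, initial state $\iota_p$) over actions $\Sigma_0\cup(\Sigma_0\times\{!,?\}\times\mathit{Msg}\times(P\setminus\{p\}))$ (internal, send $m$ to $q$, receive $m$ from $q$, each with a label in $\Sigma_0$), $\mathit{Msg}$ finite, $\mathit{Acc}\subseteq\prod_pS_p$. A run on an MSC assigns to each $e\in E_p$ a transition of $\Delta_p$ whose label is the $\Sigma_0$-label of $e$, starting each nonempty process in $\iota_p$, chaining along $\to$, with internal transitions at events in no $\lhd$-pair, and for $(e,f)\in\lhd$ from $p$ to $q$ a send $(\cdot,!,m,q)$ at $e$ and a receive $(\cdot,?,m,p)$ at $f$ with equal $m$; it accepts if the tuple of final local states (or $\iota_p$ for empty processes) is in $\mathit{Acc}$. $L(\mathcal A)$ is the set of accepted MSCs; number of states means states per process. *)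

theory Defs
  imports Complex_Main "HOL-Library.FuncSet" "HOL-Library.Landau_Symbols"
begin

section \<open>Message sequence charts\<close>

text \<open>The pair \<open>(p, i)\<close> is the \<open>i\<close>-th event on process \<open>p\<close>, counted from 1.\<close>

type_synonym 'p event = "'p \<times> nat"

record ('p, 'a) msc =
  word :: "'p \<Rightarrow> 'a list"
  msg :: "'p event rel"

text \<open>
  The set of processes is not a parameter here: \<open>MSC\<close> below forces the words of all
  non-processes to be empty.
\<close>

definition events :: "('p, 'a) msc \<Rightarrow> 'p event set" where
  "events M = {(p, i). 1 \<le> i \<and> i \<le> length (word M p)}"

definition letter :: "('p, 'a) msc \<Rightarrow> 'p event \<Rightarrow> 'a" where
  "letter M e = word M (fst e) ! (snd e - 1)"

definition label :: "('p, 'a) msc \<Rightarrow> 'p event \<Rightarrow> 'p \<times> 'a" where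
  "label M e = (fst e, letter M e)"

definition proc_rel :: "('p, 'a) msc \<Rightarrow> 'p event rel" where
  "proc_rel M = {((p, i), (p, i + 1)) | p i. (p, i) \<in> events M \<and> (p, i + 1) \<in> events M}"

definition edges :: "('p, 'a) msc \<Rightarrow> 'p event rel" where
  "edges M = proc_rel M \<union> msg M"

definition MSC :: "'p set \<Rightarrow> 'a set \<Rightarrow> ('p, 'a) msc set" where
  "MSC P \<Sigma> = {M.
     (\<forall>p\<in>P. word M p \<in> lists \<Sigma>) \<and>
     (\<forall>p. p \<notin> P \<longrightarrow> word M p = []) \<and>
     (\<exists>p\<in>P. word M p \<noteq> []) \<and>
     msg M \<subseteq> {(e, f). e \<in> events M \<and> f \<in> events M \<and> fst e \<noteq> fst f} \<and>
     acyclic (edges M) \<and>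
     (\<forall>(e, f)\<in>msg M. \<forall>(e', f')\<in>msg M. {e, f} \<inter> {e', f'} \<noteq> {} \<longrightarrow> (e, f) = (e', f')) \<and>
     (\<forall>(e, f)\<in>msg M. \<forall>(e', f')\<in>msg M. fst e = fst e' \<and> fst f = fst f' \<longrightarrow>
        ((e, e') \<in> (proc_rel M)\<^sup>* \<longleftrightarrow> (f, f') \<in> (proc_rel M)\<^sup>*))}"

text \<open>
  The chart over \<open>\<Sigma> \<times> \<Gamma>\<close> that corresponds to the pair \<open>(M, \<gamma>)\<close>; only the values of
  \<open>\<gamma>\<close> on \<open>events M\<close> matter.
\<close>

definition attach :: "('p, 'a) msc \<Rightarrow> ('p event \<Rightarrow> 'g) \<Rightarrow> ('p, 'a \<times> 'g) msc" where
  "attach M \<gamma> =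
     \<lparr>word = (\<lambda>p. map (\<lambda>i. (letter M (p, i), \<gamma> (p, i))) [1..<length (word M p) + 1]),
      msg = msg M\<rparr>"


section \<open>Types of events\<close>

definition parallel :: "('p, 'a) msc \<Rightarrow> 'p event rel" where
  "parallel M = {(e, f). e \<in> events M \<and> f \<in> events M \<and>
     (e, f) \<notin> (edges M)\<^sup>* \<and> (f, e) \<notin> (edges M)\<^sup>*}"

definition far_below :: "('p, 'a) msc \<Rightarrow> 'p event rel" where
  "far_below M = (edges M)\<^sup>+ - edges M"

datatype rel_sym =
  REq | RProc | RMsg | RPar | RProcInv | RMsgInv | RFar | RFarInv

fun rel_of :: "('p, 'a) msc \<Rightarrow> rel_sym \<Rightarrow> 'p event rel" where
  "rel_of M REq = Id_on (events M)"
| "rel_of M RProc = proc_rel M"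
| "rel_of M RMsg = msg M"
| "rel_of M RPar = parallel M"
| "rel_of M RProcInv = (proc_rel M)\<inverse>"
| "rel_of M RMsgInv = (msg M)\<inverse>"
| "rel_of M RFar = far_below M"
| "rel_of M RFarInv = (far_below M)\<inverse>"

definition type_at :: "('p, 'a) msc \<Rightarrow> 'p event \<Rightarrow> rel_sym \<Rightarrow> ('p \<times> 'a) set" where
  "type_at M e r = {label M f | f. f \<in> events M \<and> (e, f) \<in> rel_of M r}"

definition Types :: "'p set \<Rightarrow> 'a set \<Rightarrow> (rel_sym \<Rightarrow> ('p \<times> 'a) set) set" where
  "Types P \<Sigma> = {t. \<forall>r. t r \<subseteq> P \<times> \<Sigma>}"


section \<open>Communicating finite-state machines\<close>

datatype ('p, 'a, 'm) action =
  Internal 'a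
| Send 'a 'm 'p
| Recv 'a 'm 'p

fun act_letter :: "('p, 'a, 'm) action \<Rightarrow> 'a" where
  "act_letter (Internal a) = a"
| "act_letter (Send a m q) = a"
| "act_letter (Recv a m q) = a"

definition actions :: "'p set \<Rightarrow> 'a set \<Rightarrow> 'm set \<Rightarrow> 'p \<Rightarrow> ('p, 'a, 'm) action set" where
  "actions P \<Sigma> Msg p =
     {Internal a | a. a \<in> \<Sigma>} \<union>
     {Send a m q | a m q. a \<in> \<Sigma> \<and> m \<in> Msg \<and> q \<in> P - {p}} \<union>
     {Recv a m q | a m q. a \<in> \<Sigma> \<and> m \<in> Msg \<and> q \<in> P - {p}}"

type_synonym ('p, 'a, 'm, 's) transition = "'s \<times> ('p, 'a, 'm) action \<times> 's"

definition source :: "('p, 'a, 'm, 's) transition \<Rightarrow> 's" where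
  "source t = fst t"

definition act :: "('p, 'a, 'm, 's) transition \<Rightarrow> ('p, 'a, 'm) action" where
  "act t = fst (snd t)"

definition target :: "('p, 'a, 'm, 's) transition \<Rightarrow> 's" where
  "target t = snd (snd t)"

record ('p, 'a, 'm, 's) cfm =
  states :: "'p \<Rightarrow> 's set"
  init :: "'p \<Rightarrow> 's"
  trans_of :: "'p \<Rightarrow> ('p, 'a, 'm, 's) transition set"
  messages :: "'m set"
  acc :: "('p \<Rightarrow> 's) set"

definition is_cfm :: "'p set \<Rightarrow> 'a set \<Rightarrow> ('p, 'a, 'm, 's) cfm \<Rightarrow> bool" where
  "is_cfm P \<Sigma> A \<longleftrightarrow>
     (\<forall>p\<in>P. finite (states A p) \<and> init A p \<in> states A p \<and>
        trans_of A p \<subseteq> states A p \<times> actions P \<Sigma> (messages A) p \<times> states A p) \<and>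
     finite (messages A) \<and>
     acc A \<subseteq> (\<Pi>\<^sub>E p\<in>P. states A p)"

definition is_run ::
  "('p, 'a, 'm, 's) cfm \<Rightarrow> ('p, 'a) msc \<Rightarrow> ('p event \<Rightarrow> ('p, 'a, 'm, 's) transition) \<Rightarrow> bool" where
  "is_run A M \<rho> \<longleftrightarrow>
     (\<forall>e\<in>events M. \<rho> e \<in> trans_of A (fst e) \<and> act_letter (act (\<rho> e)) = letter M e) \<and>
     (\<forall>p. (p, 1) \<in> events M \<longrightarrow> source (\<rho> (p, 1)) = init A p) \<and>
     (\<forall>(e, f)\<in>proc_rel M. target (\<rho> e) = source (\<rho> f)) \<and>
     (\<forall>e\<in>events M - Field (msg M). \<exists>a. act (\<rho> e) = Internal a) \<and>
     (\<forall>(e, f)\<in>msg M. \<exists>a b m. act (\<rho> e) = Send a m (fst f) \<and> act (\<rho> f) = Recv b m (fst e))"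

definition final_state ::
  "'p set \<Rightarrow> ('p, 'a, 'm, 's) cfm \<Rightarrow> ('p, 'a) msc \<Rightarrow>
   ('p event \<Rightarrow> ('p, 'a, 'm, 's) transition) \<Rightarrow> 'p \<Rightarrow> 's" where
  "final_state P A M \<rho> = (\<lambda>p\<in>P.
     if word M p = [] then init A p else target (\<rho> (p, length (word M p))))"

definition language :: "'p set \<Rightarrow> 'a set \<Rightarrow> ('p, 'a, 'm, 's) cfm \<Rightarrow> ('p, 'a) msc set" where
  "language P \<Sigma> A = {M \<in> MSC P \<Sigma>. \<exists>\<rho>. is_run A M \<rho> \<and> final_state P A M \<rho> \<in> acc A}"

end

theory Submission
  imports Defs "HOL-Library.Cardinality" "HOL-Real_Asymp.Real_Asymp"
begin

text \<open>
  The automaton guesses an annotation of the events and checks it locally. All relations except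
  \<open>\<parallel>\<close> are easy: the labels in the strict past and future, together with the information whether they
  occur twice there, are the unique solution of a local equation, and \<open>e \<sqsubset> f\<close> for some \<open>f\<close> with a
  given label means that the label occurs in the future of \<open>e\<close>, and twice if an edge successor of
  \<open>e\<close> has this label.

  For \<open>\<parallel>\<close>, consider an event \<open>e\<close> of \<open>p\<close>, the events \<open>F\<close> of \<open>q\<close> with letter \<open>a\<close>, a simple process
  path \<open>w\<close> from \<open>q\<close> to \<open>p\<close>, and a simple path \<open>w'\<close> back. By FIFO, the last event \<open>L\<close> of \<open>q\<close> below \<open>e\<close>
  along \<open>w\<close> and the first one above \<open>e\<close> along \<open>w'\<close> can be tracked: any finite colouring of \<open>q\<close> can be
  transported to \<open>e\<close> along these paths. The event \<open>e\<close> is parallel to some element of \<open>F\<close> iff for all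
  \<open>w\<close> and \<open>w'\<close> there is an element of \<open>F\<close> strictly in between, that is, the two bounds lie in
  different gaps of \<open>F\<close>. That the gaps differ is certified by a 3-colouring of the gaps. That they
  coincide is certified by marking the gaps for which this happens and their parities: the upper
  boundary of a marked gap checks the parity of the last event of \<open>p\<close> below it along \<open>w'\<close>, which
  prevents the upper bound from skipping a marked gap. There are at most
  \<open>(|P| + 1)\<^bsup>2|P|\<^esup>\<close> pairs of paths.
\<close>

section \<open>Gaps between the points of a chain\<close>

text \<open>The obstacle is that concurrency is the absence of a path. The process path that yields
  the last event of \<open>q\<close> below \<open>e\<close> changes with \<open>e\<close>, and
  positions are unbounded, so a finite state can neither store the bounds nor compare two of them.
  Quantifying over all pairs \<open>(w, w')\<close> removes the comparison: a parallel event lies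
  strictly between the bounds of every pair, and some pair attains both extreme bounds at once,
  since the two paths are chosen independently. For a fixed pair only finitely many data travel, and
  this makes the two answers asymmetric. Different data at the two bounds prove different gaps,
  whereas equal data alone prove nothing; hence one answer needs only a colouring and the other an
  induction along the process of \<open>e\<close>. A state stores functions on the triples of a
  letter and a pair of paths; the number of pairs is at most 2^(2|P| log(|P| + 1)), which is where
  the double exponent of the bound comes from.\<close>

text \<open>
  Gaps are coloured by counting, modulo 3, the points of the greedy chain in which the successor
  of \<open>s\<close> is the least \<open>h j\<close> with \<open>s \<le> l j < h j\<close>; monotonicity forces one or two
  chain points into each \<open>{l j<..h j}\<close>.
\<close>

lemma three_colouring:
  fixes l h :: "'i::linorder \<Rightarrow> nat"
  assumes mono: "\<And>i j. i \<in> J \<Longrightarrow> j \<in> J \<Longrightarrow> i \<le> j \<Longrightarrow> l i \<le> l j \<and> h i \<le> h j"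
  shows "\<exists>col :: nat \<Rightarrow> bool option. col 0 = None \<and>
    (\<forall>j\<in>J. l j < h j \<longrightarrow> col (l j) \<noteq> col (h j))"
proof -
  define hit where "hit s x \<longleftrightarrow> (\<exists>j\<in>J. s \<le> l j \<and> l j < h j \<and> h j \<le> x)" for s x
  \<comment> \<open>The state at \<open>t\<close> consists of the last chain point up to
    \<open>t\<close> and the number of chain points after the start 0.\<close>
  define st :: "nat \<Rightarrow> nat \<times> nat" where
    "st = rec_nat (0, 0) (\<lambda>t (s, c). if hit s (Suc t) then (Suc t, Suc c) else (s, c))"
  have st_0: "st 0 = (0, 0)" by (simp add: st_def)
  have st_Suc: "st (Suc t) =
      (if hit (fst (st t)) (Suc t) then (Suc t, Suc (snd (st t))) else st t)" for t
    by (simp add: st_def split: prod.splits)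
  have inv: "fst (st t) \<le> t \<and> \<not> hit (fst (st t)) t" for t
  proof (induction t)
    case 0
    then show ?case by (auto simp: st_0 hit_def)
  next
    case (Suc t)
    then show ?case by (auto simp: st_Suc hit_def)
  qed
  have count: "snd (st (h j)) = Suc (snd (st (l j))) \<or> snd (st (h j)) = Suc (Suc (snd (st (l j))))"
    if j: "j \<in> J" "l j < h j" for j
  proof -
    define s c where "s = fst (st (l j))" and "c = snd (st (l j))"
    \<comment> \<open>After \<open>l j\<close> there is no chain point yet, or exactly one, or
      \<open>h j\<close> has been reached. A second one cannot come before \<open>h j\<close>: its
      witness \<open>i\<close> starts beyond \<open>l j\<close>, so \<open>j \<le> i\<close>, and
      monotonicity gives \<open>h j \<le> h i\<close>.\<close>
    have reach: "st t = (s, c) \<or> (snd (st t) = Suc c \<and> l j < fst (st t)) \<or>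
        (h j \<le> t \<and> (snd (st t) = Suc (Suc c) \<or> h j < t))"
      if "l j \<le> t" for t
      using that
    proof (induction t rule: dec_induct)
      case base
      then show ?case by (simp add: s_def c_def)
    next
      case (step t)
      have "h j \<le> Suc t" if "hit u (Suc t)" "l j < u" for u
      proof -
        from that obtain i where i: "i \<in> J" "u \<le> l i" "h i \<le> Suc t"
          by (auto simp: hit_def)
        have "j \<le> i"
        proof (rule ccontr)
          assume "\<not> j \<le> i"
          then have "l i \<le> l j" using mono[of i j] i j by auto
          then show False using i that(2) by simp
        qed
        then show ?thesis using mono[of j i] i j by auto
      qed
      with step show ?case by (auto simp: st_Suc)
    qed
    \<comment> \<open>The index \<open>j\<close> itself is a witness, so by \<open>inv\<close> the
      chain must have moved on by \<open>h j\<close>.\<close>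
    have "hit s (h j)" using j inv[of "l j"] by (auto simp: hit_def s_def)
    then have "st (h j) \<noteq> (s, c)" using inv[of "h j"] by auto
    then show ?thesis using reach[of "h j"] j by (auto simp: c_def)
  qed
  \<comment> \<open>Adding 1 or 2 changes the residue modulo 3. Residue 0 becomes
    \<open>None\<close>, which fixes the colour of the initial gap to the one in
    \<open>gap_init\<close>.\<close>
  define col :: "nat \<Rightarrow> bool option" where
    "col t = (if snd (st t) mod 3 = 0 then None else Some (snd (st t) mod 3 = 1))" for t
  show ?thesis
  proof (intro exI[of _ col] conjI ballI impI)
    show "col 0 = None" by (simp add: col_def st_0)
    fix j assume "j \<in> J" "l j < h j"
    note count[OF this]
    moreover have "(Suc c mod 3 = 0) \<noteq> (c mod 3 = 0) \<or> c mod 3 = 1 \<and> Suc c mod 3 = 2"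
      and "(Suc (Suc c) mod 3 = 0) \<noteq> (c mod 3 = 0) \<or> c mod 3 = 2 \<and> Suc (Suc c) mod 3 = 1"
      for c :: nat by presburger+
    ultimately show "col (l j) \<noteq> col (h j)"
      unfolding col_def by (smt (verit) numeral_One numeral_eq_iff option.inject option.simps(3) semiring_norm(85))
  qed
qed

text \<open>
  The positions \<open>1..m\<close> of a process contain the points of \<open>F\<close>, which cut \<open>0..m\<close> into gaps.
  A gap carries a colour, a flag telling whether the gap is used, and the parity of the
  number of used gaps after the initial one, up to this gap.
\<close>

type_synonym gap = "bool option \<times> bool \<times> bool"

definition gap_init :: gap where
  "gap_init = (None, True, False)"

text \<open>A point of \<open>F\<close> opens a new gap whose colour and mark are free guesses; only
  the parity is forced, and it flips exactly when the new gap is marked.\<close>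

definition gap_step :: "bool \<Rightarrow> gap \<Rightarrow> gap \<Rightarrow> bool" where
  "gap_step f s s' \<longleftrightarrow>
     (if f then snd (snd s') = (snd (snd s) \<noteq> fst (snd s')) else s' = s)"

definition upper_check :: "bool \<Rightarrow> gap \<Rightarrow> bool option \<Rightarrow> bool" where
  "upper_check f s z \<longleftrightarrow> (f \<and> fst (snd s) \<longrightarrow> z = Some (snd (snd s)))"

text \<open>The claim \<open>None\<close> stands for two different gaps and is witnessed by the
  colours. The claim \<open>Some d\<close> stands for one common gap, asserted to be marked and of
  parity \<open>d\<close>.\<close>

definition gap_check :: "bool option \<Rightarrow> gap \<Rightarrow> gap \<Rightarrow> bool" where
  "gap_check z s s' \<longleftrightarrow> (case z of
     None \<Rightarrow> fst s \<noteq> fst s'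
   | Some d \<Rightarrow> snd s = (True, d) \<and> snd s' = (True, d))"

text \<open>This abstracts one pair of paths. The points of \<open>F\<close> lie on
  \<open>1..m\<close>, the claiming events are \<open>1..n\<close>, and event \<open>j\<close> asks
  about the interval \<open>{L j<..H j}\<close>. By the Galois connection \<open>V_iff\<close>,
  \<open>V i\<close> is the last claiming event whose interval ends before \<open>i\<close>.\<close>

locale gap_system =
  fixes F :: "nat \<Rightarrow> bool" and n m :: nat and L H V :: "nat \<Rightarrow> nat"
  assumes L_mono: "\<And>j j'. 1 \<le> j \<Longrightarrow> j \<le> j' \<Longrightarrow> j' \<le> n \<Longrightarrow> L j \<le> L j'"
    and H_mono: "\<And>j j'. 1 \<le> j \<Longrightarrow> j \<le> j' \<Longrightarrow> j' \<le> n \<Longrightarrow> H j \<le> H j'"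
    and L_le_H: "\<And>j. 1 \<le> j \<Longrightarrow> j \<le> n \<Longrightarrow> L j \<le> H j"
    and H_le: "\<And>j. 1 \<le> j \<Longrightarrow> j \<le> n \<Longrightarrow> H j \<le> m"
    and V_le: "\<And>i. 1 \<le> i \<Longrightarrow> i \<le> m \<Longrightarrow> V i \<le> n"
    and V_iff: "\<And>i j. 1 \<le> i \<Longrightarrow> i \<le> m \<Longrightarrow> 1 \<le> j \<Longrightarrow> j \<le> n \<Longrightarrow> j \<le> V i \<longleftrightarrow> H j < i"
begin

text \<open>Position 0 of the observing process is a virtual one that lies in the initial gap.\<close>

definition certificate :: "(nat \<Rightarrow> gap) \<Rightarrow> (nat \<Rightarrow> bool option) \<Rightarrow> bool" where
  "certificate A z \<longleftrightarrow> A 0 = gap_init \<and> z 0 = Some False \<and>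
     (\<forall>i\<in>{1..m}. gap_step (F i) (A (i - 1)) (A i) \<and> upper_check (F i) (A (i - 1)) (z (V i))) \<and>
     (\<forall>j\<in>{1..n}. gap_check (z j) (A (L j)) (A (H j)))"

text \<open>Different colours separate gaps at once. For a claim \<open>Some\<close>, strong
  induction over the claiming events shows that no marked gap opens between \<open>L j\<close> and
  \<open>H j\<close>; since the gap of \<open>H j\<close> is itself marked, no gap at all opens
  there.\<close>

lemma certificate_sound:
  assumes cert: "certificate A z" and j: "1 \<le> j" "j \<le> n"
  shows "z j = None \<longleftrightarrow> (\<exists>i. L j < i \<and> i \<le> H j \<and> F i)"
proof -
  define b where "b i \<longleftrightarrow> fst (snd (A i))" for i
  define c where "c i \<longleftrightarrow> snd (snd (A i))" for i
  \<comment> \<open>\<open>C\<close> numbers the marked gaps; the certificate knows this number only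
    modulo 2.\<close>
  define C where "C i = card {k \<in> {1..i}. F k \<and> b k}" for i
  have A0: "A 0 = gap_init" and z0: "z 0 = Some False"
    using cert by (auto simp: certificate_def)
  have step: "gap_step (F i) (A (i - 1)) (A i)" and upper: "upper_check (F i) (A (i - 1)) (z (V i))"
    if "1 \<le> i" "i \<le> m" for i
    using cert that by (auto simp: certificate_def)
  have check: "gap_check (z j) (A (L j)) (A (H j))" if "1 \<le> j" "j \<le> n" for j
    using cert that by (auto simp: certificate_def)
  have C_0: "C 0 = 0" by (simp add: C_def)
  have C_Suc: "C (Suc i) = C i + (if F (Suc i) \<and> b (Suc i) then 1 else 0)" for i
  proof -
    have "{k \<in> {1..Suc i}. F k \<and> b k} =
        (if F (Suc i) \<and> b (Suc i) then insert (Suc i) {k \<in> {1..i}. F k \<and> b k}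
         else {k \<in> {1..i}. F k \<and> b k})"
      by (auto simp: le_Suc_eq)
    then show ?thesis by (simp add: C_def)
  qed
  have C_mono: "C i \<le> C i'" if "i \<le> i'" for i i'
    unfolding C_def using that by (intro card_mono) auto
  have parity: "i \<le> m \<Longrightarrow> c i \<longleftrightarrow> odd (C i)" for i
  proof (induction i)
    case 0
    then show ?case by (simp add: C_0 c_def A0 gap_init_def)
  next
    case (Suc i)
    then show ?case using step[of "Suc i"]
      by (auto simp: gap_step_def C_Suc c_def b_def split: if_splits)
  qed
  have const: "(\<forall>k. i < k \<and> k \<le> i' \<longrightarrow> \<not> F k) \<Longrightarrow> i' \<le> m \<Longrightarrow> A i' = A i" if "i \<le> i'" for i i'
    using that
  proof (induction i' rule: dec_induct)
    case base
    then show ?case by simp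
  next
    case (step i')
    then show ?case using \<open>i \<le> i'\<close> step.prems
        \<open>\<And>i. 1 \<le> i \<Longrightarrow> i \<le> m \<Longrightarrow> gap_step (F i) (A (i - 1)) (A i)\<close>[of "Suc i'"]
      by (auto simp: gap_step_def)
  qed
  \<comment> \<open>A virtual event 0 with an empty interval and the claim
    \<open>z 0 = Some False\<close> gives every later claim \<open>Some\<close> an earlier one to
    compare with.\<close>
  define L' H' where "L' k = (if k = 0 then 0 else L k)" and "H' k = (if k = 0 then 0 else H k)"
    for k
  have H'_le: "H' k \<le> m" if "k \<le> n" for k using that H_le[of k] by (auto simp: H'_def)
  have L'_le: "L' k \<le> H' k" if "k \<le> n" for k
    using that L_le_H[of k] by (auto simp: L'_def H'_def)
  have L'_mono: "L' k \<le> L' k'" and H'_mono: "H' k \<le> H' k'" if "k \<le> k'" "k' \<le> n" for k k'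
    using that L_mono[of k k'] H_mono[of k k'] by (auto simp: L'_def H'_def)
  have V_iff': "k \<le> V i \<longleftrightarrow> H' k < i" if "1 \<le> i" "i \<le> m" "k \<le> n" for i k
    using that V_iff[of i k] by (auto simp: H'_def)
  have z_Some: "b (L' k) \<and> b (H' k) \<and> c (L' k) = d \<and> c (H' k) = d" if "z k = Some d" "k \<le> n" for k d
    using that check[of k] z0 A0
    by (cases "k = 0") (auto simp: gap_check_def gap_init_def b_def c_def L'_def H'_def)
  have same: "C (L' k) = C (H' k)" if "k \<le> n" "z k \<noteq> None" for k
    using that
  proof (induction k rule: less_induct)
    case (less k)
    show ?case
    proof (cases "k = 0")
      case True
      then show ?thesis by (simp add: L'_def H'_def)
    next
      case False
      \<comment> \<open>The latest earlier event with a claim \<open>Some\<close>; by induction the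
        count is the same number \<open>x\<close> at both ends of its interval.\<close>
      define k0 where "k0 = Max {i. i < k \<and> z i \<noteq> None}"
      have "0 \<in> {i. i < k \<and> z i \<noteq> None}" using False z0 by auto
      then have "k0 \<in> {i. i < k \<and> z i \<noteq> None}" unfolding k0_def by (intro Max_in) auto
      then have k0: "k0 < k" "z k0 \<noteq> None" by auto
      have k0_max: "i \<le> k0" if "i < k" "z i \<noteq> None" for i
        unfolding k0_def using that by (intro Max_ge) auto
      define x where "x = C (H' k0)"
      have xL: "C (L' k0) = x" using less k0 by (auto simp: x_def)
      \<comment> \<open>Otherwise marked gap number \<open>Suc x\<close> opens at some
        \<open>i'\<close> and closes at some \<open>i \<le> H' k\<close>. The event
        \<open>V i\<close> lies in \<open>{k0..<k}\<close> and, its claim being a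
        \<open>Some\<close>, equals \<open>k0\<close>. But the check at \<open>i\<close> demands the
        parity of \<open>Suc x\<close> from it, while its claim has the parity of \<open>x\<close>.
        Once this is excluded, both ends of the interval of \<open>k\<close> have count
        \<open>x\<close> or \<open>Suc x\<close>, and equal parity makes them agree.\<close>
      have "C (H' k) \<le> Suc x"
      proof (rule ccontr)
        assume big: "\<not> C (H' k) \<le> Suc x"
        define i' where "i' = (LEAST i. C i = Suc x)"
        have "\<exists>i\<le>H' k. C i = Suc x"
        proof -
          have "Suc x \<le> C i \<Longrightarrow> \<exists>k\<le>i. C k = Suc x" for i
          proof (induction i)
            case (Suc i)
            show ?case
            proof (cases "Suc x \<le> C i")
              case True
              then show ?thesis using Suc by (meson le_Suc_eq)
            next
              case False
              then have "C (Suc i) = Suc x" using Suc.prems by (auto simp: C_Suc split: if_splits)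
              then show ?thesis by blast
            qed
          qed (simp add: C_0)
          then show ?thesis using big by auto
        qed
        then have i': "C i' = Suc x" "i' \<le> H' k"
          unfolding i'_def by (auto intro: LeastI Least_le[THEN order.trans])
        have i'_pos: "i' \<noteq> 0" using i' C_0 by (intro notI) simp
        have "C (i' - 1) \<noteq> Suc x" using i'_pos not_less_Least[of "i' - 1" "\<lambda>i. C i = Suc x"]
          by (simp add: i'_def)
        then have bi': "b i'" using i' i'_pos C_Suc[of "i' - 1"] by (auto split: if_splits)
        have ex: "\<exists>i. i' < i \<and> i \<le> H' k \<and> F i"
        proof (rule ccontr)
          assume "\<not> ?thesis"
          then have "{i \<in> {1..H' k}. F i \<and> b i} \<subseteq> {i \<in> {1..i'}. F i \<and> b i}"
            by (auto simp: not_less)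
          then have "C (H' k) \<le> C i'" unfolding C_def by (intro card_mono) auto
          then show False using big i' by simp
        qed
        define i where "i = (LEAST i. i' < i \<and> i \<le> H' k \<and> F i)"
        have i: "i' < i" "i \<le> H' k" "F i"
          using LeastI_ex[OF ex] by (auto simp: i_def)
        have i_least: "\<not> F r" if "i' < r" "r < i" for r
          using not_less_Least[of r "\<lambda>i. i' < i \<and> i \<le> H' k \<and> F i"] that i by (auto simp: i_def)
        have im: "i \<le> m" using i H'_le[of k] less.prems by simp
        have Ai: "A (i - 1) = A i'"
          using i i_least im by (intro const) auto
        have "C (i - 1) = Suc x"
        proof -
          have "{r \<in> {1..i - 1}. F r \<and> b r} = {r \<in> {1..i'}. F r \<and> b r}"
            using i i_least by (intro Collect_cong) (metis One_nat_def Suc_pred atLeastAtMost_iff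
                le_trans less_Suc_eq_le less_imp_le_nat not_less_zero not_le zero_less_iff_neq_zero)
          then show ?thesis using i' by (simp add: C_def)
        qed
        then have "z (V i) = Some (odd (Suc x))"
          using upper[of i] i im Ai bi' parity[of "i - 1"]
          by (auto simp: upper_check_def b_def c_def)
        moreover have "V i < k" using V_iff'[of i k] i im less.prems by auto
        moreover have "k0 \<le> V i"
        proof -
          have "C (H' k0) < C i'" using i' by (simp add: x_def)
          then have "H' k0 < i'" using C_mono by (meson not_le)
          then show ?thesis using V_iff'[of i k0] i im less.prems k0 by auto
        qed
        ultimately have "V i = k0" using k0_max[of "V i"] by auto
        moreover have "z k0 = Some (odd x)"
          using z_Some[of k0] k0 less.prems parity[of "H' k0"] H'_le[of k0] by (auto simp: x_def)
        ultimately show False using \<open>z (V i) = Some (odd (Suc x))\<close> by simp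
      qed
      moreover have "x \<le> C (L' k)" using xL C_mono L'_mono[of k0 k] k0 less.prems by auto
      moreover have "C (L' k) \<le> C (H' k)" using C_mono L'_le less.prems by auto
      moreover have "odd (C (L' k)) \<longleftrightarrow> odd (C (H' k))"
        using z_Some[of k] less.prems parity[of "L' k"] parity[of "H' k"] H'_le[of k] L'_le[of k]
        by auto
      ultimately show ?thesis by presburger
    qed
  qed
  have LH: "L j = L' j" "H j = H' j" using j by (auto simp: L'_def H'_def)
  show ?thesis
  proof
    assume "z j = None"
    then have "A (L j) \<noteq> A (H j)" using check[OF j] by (auto simp: gap_check_def)
    then show "\<exists>i. L j < i \<and> i \<le> H j \<and> F i"
      using const[of "L j" "H j"] L_le_H H_le j by metis
  next
    assume ex: "\<exists>i. L j < i \<and> i \<le> H j \<and> F i"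
    show "z j = None"
    proof (rule ccontr)
      assume Z: "z j \<noteq> None"
      \<comment> \<open>The last point of \<open>F\<close> in the interval opens the gap of
        \<open>H j\<close>. As this gap is marked, \<open>C\<close> grows there, although
        \<open>same\<close> says that it does not.\<close>
      define i where "i = Max {i. L j < i \<and> i \<le> H j \<and> F i}"
      have "i \<in> {i. L j < i \<and> i \<le> H j \<and> F i}"
        unfolding i_def using ex by (intro Max_in) auto
      then have i: "L j < i" "i \<le> H j" "F i" by auto
      have "\<not> F r" if "i < r" "r \<le> H j" for r
      proof
        assume "F r"
        then have "r \<le> i" unfolding i_def using that i by (intro Max_ge) auto
        then show False using that by simp
      qed
      then have "A (H j) = A i" using const[of i "H j"] i H_le j by auto
      then have "b i" using z_Some[of j] Z j by (auto simp: b_def LH)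
      then have "C i = Suc (C (i - 1))" using C_Suc[of "i - 1"] i by auto
      moreover have "C (L j) \<le> C (i - 1)" using i by (intro C_mono) auto
      moreover have "C i \<le> C (H j)" using i by (intro C_mono) auto
      ultimately show False using same[of j] Z j by (simp add: LH)
    qed
  qed
qed

text \<open>Mark exactly the gaps that contain both ends of some interval, and colour gap indices by
  \<open>three_colouring\<close>.\<close>

lemma certificate_exists: "\<exists>A z. certificate A z"
proof -
  define g where "g i = card {k \<in> {1..i}. F k}" for i
  have g_Suc: "g (Suc i) = g i + (if F (Suc i) then 1 else 0)" for i
  proof -
    have "{k \<in> {1..Suc i}. F k} =
        (if F (Suc i) then insert (Suc i) {k \<in> {1..i}. F k} else {k \<in> {1..i}. F k})"
      by (auto simp: le_Suc_eq)
    then show ?thesis by (simp add: g_def)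
  qed
  have g_mono: "i \<le> i' \<Longrightarrow> g i \<le> g i'" for i i'
    unfolding g_def by (intro card_mono) auto
  define L' H' where "L' k = (if k = 0 then 0 else L k)" and "H' k = (if k = 0 then 0 else H k)"
    for k
  have L'_le: "L' k \<le> H' k" if "k \<le> n" for k
    using that L_le_H[of k] by (auto simp: L'_def H'_def)
  have L'_mono: "L' k \<le> L' k'" if "k \<le> k'" "k' \<le> n" for k k'
    using that L_mono[of k k'] by (auto simp: L'_def)
  have V_iff': "k \<le> V i \<longleftrightarrow> H' k < i" if "1 \<le> i" "i \<le> m" "k \<le> n" for i k
    using that V_iff[of i k] by (auto simp: H'_def)
  have "\<exists>col :: nat \<Rightarrow> bool option. col 0 = None \<and>
      (\<forall>j\<in>{1..n}. g (L j) < g (H j) \<longrightarrow> col (g (L j)) \<noteq> col (g (H j)))"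
    by (rule three_colouring) (auto intro!: g_mono L_mono H_mono)
  then obtain col :: "nat \<Rightarrow> bool option" where col: "col 0 = None"
    "\<And>j. j \<in> {1..n} \<Longrightarrow> g (L j) < g (H j) \<Longrightarrow> col (g (L j)) \<noteq> col (g (H j))"
    by blast
  \<comment> \<open>The range includes \<open>k = 0\<close>, which marks the initial gap as
    \<open>gap_init\<close> requires; \<open>odds\<close> counts from gap 1 on.\<close>
  define used where "used t \<longleftrightarrow> (\<exists>k\<le>n. g (L' k) = t \<and> g (H' k) = t)" for t
  define odds where "odds t \<longleftrightarrow> odd (card {s \<in> {1..t}. used s})" for t
  have odds_Suc: "odds (Suc t) \<longleftrightarrow> (odds t \<noteq> used (Suc t))" for t
  proof -
    have "{s \<in> {1..Suc t}. used s} =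
        (if used (Suc t) then insert (Suc t) {s \<in> {1..t}. used s} else {s \<in> {1..t}. used s})"
      by (auto simp: le_Suc_eq)
    then show ?thesis by (simp add: odds_def)
  qed
  define A :: "nat \<Rightarrow> gap" where "A i = (col (g i), used (g i), odds (g i))" for i
  define z where "z k = (if g (L' k) = g (H' k) then Some (odds (g (L' k))) else None)" for k
  have g0: "g 0 = 0" by (simp add: g_def)
  have o0: "\<not> odds 0" by (simp add: odds_def)
  have "A 0 = gap_init"
    by (auto simp: A_def g0 col o0 gap_init_def used_def L'_def H'_def intro!: exI[of _ 0])
  moreover have "z 0 = Some False" by (simp add: z_def g0 o0 L'_def H'_def)
  moreover have "gap_step (F i) (A (i - 1)) (A i)" if "1 \<le> i" for i
    using g_Suc[of "i - 1"] odds_Suc[of "g (i - 1)"] that by (auto simp: gap_step_def A_def)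
  \<comment> \<open>If event \<open>k\<close> uses the gap that closes at \<open>i\<close>, then
    \<open>k \<le> V i\<close>. Monotonicity bounds the interval of \<open>V i\<close> from below
    and \<open>V_iff\<close> bounds it from above, so it lies in the same gap and its claim has the
    right parity.\<close>
  moreover have "upper_check (F i) (A (i - 1)) (z (V i))" if i: "1 \<le> i" "i \<le> m" for i
    unfolding upper_check_def
  proof
    assume f: "F i \<and> fst (snd (A (i - 1)))"
    then obtain k where k: "k \<le> n" "g (L' k) = g (i - 1)" "g (H' k) = g (i - 1)"
      by (auto simp: A_def used_def)
    have "g (i - 1) < g i" using g_Suc[of "i - 1"] f i by simp
    then have "H' k < i" using k g_mono by (metis not_le)
    then have kV: "k \<le> V i" using V_iff' i k by blast
    have V: "V i \<le> n" using V_le i by blast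
    have "H' (V i) < i" using V_iff'[OF i V] by simp
    then have "g (H' (V i)) \<le> g (i - 1)" by (intro g_mono) simp
    moreover have "g (i - 1) \<le> g (L' (V i))" using L'_mono[OF kV V] k g_mono by metis
    moreover have "g (L' (V i)) \<le> g (H' (V i))" using L'_le[OF V] g_mono by blast
    ultimately have "g (L' (V i)) = g (i - 1)" "g (H' (V i)) = g (i - 1)" by linarith+
    then show "z (V i) = Some (snd (snd (A (i - 1))))" by (simp add: z_def A_def)
  qed
  moreover have "gap_check (z j) (A (L j)) (A (H j))" if j: "1 \<le> j" "j \<le> n" for j
  proof (cases "g (L j) = g (H j)")
    case True
    then have "used (g (L j))" unfolding used_def using j
      by (intro exI[of _ j]) (auto simp: L'_def H'_def)
    then show ?thesis using True j by (auto simp: gap_check_def z_def A_def L'_def H'_def)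
  next
    case False
    moreover have "g (L j) \<le> g (H j)" using L_le_H[OF j] g_mono by blast
    ultimately show ?thesis using j col(2)[of j]
      by (auto simp: gap_check_def z_def A_def L'_def H'_def)
  qed
  ultimately show ?thesis unfolding certificate_def by (intro exI[of _ A] exI[of _ z]) auto
qed

end

section \<open>Process paths in message sequence charts\<close>

definition adj :: "'p list \<Rightarrow> 'p \<Rightarrow> 'p \<Rightarrow> bool" where
  "adj w r s \<longleftrightarrow> (\<exists>i. Suc i < length w \<and> w ! i = r \<and> w ! Suc i = s)"

lemma adj_left_unique: "distinct w \<Longrightarrow> adj w r s \<Longrightarrow> adj w r' s \<Longrightarrow> r = r'"
  unfolding adj_def by (metis Suc_inject nth_eq_iff_index_eq)

lemma adj_right_unique: "distinct w \<Longrightarrow> adj w r s \<Longrightarrow> adj w r s' \<Longrightarrow> s = s'"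
  unfolding adj_def by (metis Suc_lessD nth_eq_iff_index_eq)

lemma adj_set: "adj w r s \<Longrightarrow> r \<in> set w \<and> s \<in> set w"
  unfolding adj_def by (metis Suc_lessD nth_mem)

lemma adj_not_hd: "distinct w \<Longrightarrow> adj w r s \<Longrightarrow> s \<noteq> hd w"
  unfolding adj_def by (metis Suc_lessE hd_conv_nth length_greater_0_conv nat.distinct(1)
      nth_eq_iff_index_eq list.size(3) not_less_zero zero_less_Suc)

lemma adj_not_last: "distinct w \<Longrightarrow> adj w r s \<Longrightarrow> r \<noteq> last w"
proof
  assume w: "distinct w" "adj w r s" "r = last w"
  then obtain i where i: "Suc i < length w" "w ! i = last w" by (auto simp: adj_def)
  then have "w ! i = w ! (length w - 1)" by (subst (asm) last_conv_nth) auto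
  then show False using w(1) i by (subst (asm) nth_eq_iff_index_eq) auto
qed

lemma adj_append: "adj w r s \<Longrightarrow> adj (w @ v) r s"
  unfolding adj_def by (metis Suc_lessD length_append nth_append trans_less_add1)

lemma adj_snoc: "w \<noteq> [] \<Longrightarrow> adj (w @ [r]) (last w) r"
  unfolding adj_def by (rule exI[of _ "length w - 1"]) (auto simp: nth_append last_conv_nth)

lemma rtrancl_last_step: "(x, y) \<in> r\<^sup>* \<Longrightarrow> x \<noteq> y \<Longrightarrow> \<exists>z. (x, z) \<in> r\<^sup>* \<and> (z, y) \<in> r"
  by (erule rtranclE) auto

lemma rtrancl_first_step: "(x, y) \<in> r\<^sup>* \<Longrightarrow> x \<noteq> y \<Longrightarrow> \<exists>z. (z, y) \<in> r\<^sup>* \<and> (x, z) \<in> r"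
  by (erule converse_rtranclE) auto

definition steps :: "('p, 'a) msc \<Rightarrow> 'p list \<Rightarrow> 'p event rel" where
  "steps M w = proc_rel M \<union> {(e, f) \<in> msg M. adj w (fst e) (fst f)}"

text \<open>
  Position 0 and the position after the last one stand for the absence of an event.
\<close>

definition last_pos :: "('p, 'a) msc \<Rightarrow> 'p list \<Rightarrow> 'p event \<Rightarrow> nat" where
  "last_pos M w e = Max (insert 0 {i. ((hd w, i), e) \<in> (steps M w)\<^sup>*})"

definition first_pos :: "('p, 'a) msc \<Rightarrow> 'p list \<Rightarrow> 'p event \<Rightarrow> nat" where
  "first_pos M w e =
     Min (insert (Suc (length (word M (last w)))) {i. (e, (last w, i)) \<in> (steps M w)\<^sup>*})"

section \<open>Order facts about the events of one chart\<close>

locale chart =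
  fixes P :: "'p set" and \<Sigma> :: "'a set" and M :: "('p, 'a) msc"
  assumes finite_P: "finite P" and MSC: "M \<in> MSC P \<Sigma>"
begin

lemma events_iff: "(p, i) \<in> events M \<longleftrightarrow> 1 \<le> i \<and> i \<le> length (word M p)"
  by (simp add: events_def)

lemma event_process: "e \<in> events M \<Longrightarrow> fst e \<in> P"
  using MSC by (cases e) (force simp: MSC_def events_def)

lemma letter_in: "e \<in> events M \<Longrightarrow> letter M e \<in> \<Sigma>"
  using MSC event_process[of e]
  by (cases e) (auto simp: MSC_def events_def letter_def in_lists_conv_set)

lemma msg_events: "(e, f) \<in> msg M \<Longrightarrow> e \<in> events M \<and> f \<in> events M \<and> fst e \<noteq> fst f"
  using MSC by (auto simp: MSC_def)

lemma msg_unique: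
  "(e, f) \<in> msg M \<Longrightarrow> (e', f') \<in> msg M \<Longrightarrow> e = e' \<or> f = f' \<or> e = f' \<or> f = e' \<Longrightarrow> e = e' \<and> f = f'"
  using MSC unfolding MSC_def by blast

lemma acyclic: "acyclic (edges M)"
  using MSC by (simp add: MSC_def)

lemma proc_rel_iff:
  "(e, f) \<in> proc_rel M \<longleftrightarrow> e \<in> events M \<and> f \<in> events M \<and> fst e = fst f \<and> snd f = Suc (snd e)"
  by (cases e; cases f) (auto simp: proc_rel_def)

lemma proc_rel_rtrancl:
  "(e, f) \<in> (proc_rel M)\<^sup>* \<longleftrightarrow> e = f \<or> e \<in> events M \<and> f \<in> events M \<and> fst e = fst f \<and> snd e \<le> snd f"
proof
  assume "(e, f) \<in> (proc_rel M)\<^sup>*"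
  then show "e = f \<or> e \<in> events M \<and> f \<in> events M \<and> fst e = fst f \<and> snd e \<le> snd f"
    by (induction rule: rtrancl_induct) (auto simp: proc_rel_iff)
next
  assume *: "e = f \<or> e \<in> events M \<and> f \<in> events M \<and> fst e = fst f \<and> snd e \<le> snd f"
  have "((p, i), (p, j)) \<in> (proc_rel M)\<^sup>*"
    if "(p, i) \<in> events M" "(p, j) \<in> events M" "i \<le> j" for p i j
    using that(3,1,2)
  proof (induction j rule: dec_induct)
    case (step j)
    then have "(p, j) \<in> events M" by (auto simp: events_iff)
    then have "((p, j), (p, Suc j)) \<in> proc_rel M" using step by (auto simp: proc_rel_iff)
    then show ?case using step \<open>(p, j) \<in> events M\<close> by (auto intro: rtrancl_into_rtrancl)
  qed simp
  then show "(e, f) \<in> (proc_rel M)\<^sup>*" using * by (cases e; cases f) auto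
qed

lemma fifo:
  assumes "(s, e) \<in> msg M" "(s', e') \<in> msg M" "fst s = fst s'" "fst e = fst e'"
  shows "snd s \<le> snd s' \<longleftrightarrow> snd e \<le> snd e'"
proof -
  have "\<forall>(e, f)\<in>msg M. \<forall>(e', f')\<in>msg M. fst e = fst e' \<and> fst f = fst f' \<longrightarrow>
      ((e, e') \<in> (proc_rel M)\<^sup>* \<longleftrightarrow> (f, f') \<in> (proc_rel M)\<^sup>*)"
    using MSC by (simp add: MSC_def)
  from this[THEN bspec, OF assms(1), simplified split, THEN bspec, OF assms(2), simplified split]
  have "(s, s') \<in> (proc_rel M)\<^sup>* \<longleftrightarrow> (e, e') \<in> (proc_rel M)\<^sup>*"
    using assms(3,4) by blast
  moreover have "(s, s') \<in> (proc_rel M)\<^sup>* \<longleftrightarrow> snd s \<le> snd s'"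
    using proc_rel_rtrancl[of s s'] msg_events[OF assms(1)] msg_events[OF assms(2)] assms(3)
    by (metis order_refl)
  moreover have "(e, e') \<in> (proc_rel M)\<^sup>* \<longleftrightarrow> snd e \<le> snd e'"
    using proc_rel_rtrancl[of e e'] msg_events[OF assms(1)] msg_events[OF assms(2)] assms(4)
    by (metis order_refl)
  ultimately show ?thesis by blast
qed

lemma edges_events: "(e, f) \<in> edges M \<Longrightarrow> e \<in> events M \<and> f \<in> events M"
  using msg_events[of e f] by (auto simp: edges_def proc_rel_iff)

lemma finite_events: "finite (events M)"
proof (rule finite_subset)
  show "events M \<subseteq> (SIGMA p:P. {..length (word M p)})"
    using event_process by (force simp: events_def)
qed (simp add: finite_P)

lemma finite_edges: "finite (edges M)"
  by (rule finite_subset[of _ "events M \<times> events M"]) (auto dest: edges_events simp: finite_events)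

lemma wf_edges: "wf (edges M)"
  by (rule finite_acyclic_wf[OF finite_edges acyclic])

lemma wf_edges_converse: "wf ((edges M)\<inverse>)"
  by (rule finite_acyclic_wf_converse[OF finite_edges acyclic])

section \<open>Reachability along a process path and its extremal events\<close>

lemma steps_edges: "steps M w \<subseteq> edges M"
  by (auto simp: steps_def edges_def)

lemma proc_steps: "(e, f) \<in> (proc_rel M)\<^sup>* \<Longrightarrow> (e, f) \<in> (steps M w)\<^sup>*"
  by (rule rtrancl_mono[THEN subsetD, of "proc_rel M"]) (auto simp: steps_def)

lemma proc_edges: "(e, f) \<in> (proc_rel M)\<^sup>* \<Longrightarrow> (e, f) \<in> (edges M)\<^sup>*"
  by (rule rtrancl_mono[THEN subsetD, of "proc_rel M"]) (auto simp: edges_def)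

lemma steps_rtrancl_edges: "(e, f) \<in> (steps M w)\<^sup>* \<Longrightarrow> (e, f) \<in> (edges M)\<^sup>*"
  by (rule rtrancl_mono[THEN subsetD, OF steps_edges])

lemma edges_rtrancl_events: "(e, f) \<in> (edges M)\<^sup>* \<Longrightarrow> e \<in> events M \<longleftrightarrow> f \<in> events M"
  by (induction rule: rtrancl_induct) (auto dest: edges_events)

lemma edges_antisym: "(e, f) \<in> (edges M)\<^sup>* \<Longrightarrow> (f, e) \<in> (edges M)\<^sup>* \<Longrightarrow> e = f"
  using acyclic_impl_antisym_rtrancl[OF acyclic] by (auto dest: antisymD)

lemma same_process_le:
  assumes "e \<in> events M" "f \<in> events M" "fst e = fst f"
  shows "(e, f) \<in> (edges M)\<^sup>* \<longleftrightarrow> snd e \<le> snd f"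
proof
  assume *: "(e, f) \<in> (edges M)\<^sup>*"
  show "snd e \<le> snd f"
  proof (rule ccontr)
    assume "\<not> snd e \<le> snd f"
    then have "(f, e) \<in> (edges M)\<^sup>*" using assms by (intro proc_edges) (simp add: proc_rel_rtrancl)
    with * have "e = f" by (rule edges_antisym)
    then show False using \<open>\<not> snd e \<le> snd f\<close> by simp
  qed
qed (use assms in \<open>auto intro!: proc_edges simp: proc_rel_rtrancl\<close>)

lemma same_process_steps:
  assumes "e \<in> events M" "f \<in> events M" "fst e = fst f"
  shows "(e, f) \<in> (steps M w)\<^sup>* \<longleftrightarrow> snd e \<le> snd f"
  using same_process_le[OF assms] steps_rtrancl_edges[of e f w] proc_steps[of e f w] assms
  by (auto simp: proc_rel_rtrancl)

lemma last_pos_iff: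
  assumes "e \<in> events M" "1 \<le> i"
  shows "i \<le> last_pos M w e \<longleftrightarrow> ((hd w, i), e) \<in> (steps M w)\<^sup>*"
proof -
  let ?I = "{i. ((hd w, i), e) \<in> (steps M w)\<^sup>*}"
  have ev: "(hd w, i) \<in> events M" if "i \<in> ?I" for i
    using that assms steps_rtrancl_edges edges_rtrancl_events by blast
  then have "?I \<subseteq> {..length (word M (hd w))}" by (auto simp: events_iff)
  then have fin: "finite ?I" by (rule finite_subset) simp
  show ?thesis
  proof
    assume "i \<le> last_pos M w e"
    then obtain k where k: "k \<in> ?I" "i \<le> k"
      using fin assms by (auto simp: last_pos_def Max_ge_iff)
    then have "((hd w, i), (hd w, k)) \<in> (steps M w)\<^sup>*"
      using ev[OF k(1)] assms by (subst same_process_steps) (auto simp: events_iff)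
    then show "((hd w, i), e) \<in> (steps M w)\<^sup>*" using k by auto
  next
    assume "((hd w, i), e) \<in> (steps M w)\<^sup>*"
    then show "i \<le> last_pos M w e" unfolding last_pos_def using fin by (intro Max_ge) auto
  qed
qed

lemma first_pos_iff:
  assumes "e \<in> events M" "i \<le> length (word M (last w))"
  shows "first_pos M w e \<le> i \<longleftrightarrow> (e, (last w, i)) \<in> (steps M w)\<^sup>*"
proof -
  let ?I = "{i. (e, (last w, i)) \<in> (steps M w)\<^sup>*}"
  have ev: "(last w, i) \<in> events M" if "i \<in> ?I" for i
    using that assms steps_rtrancl_edges edges_rtrancl_events by blast
  then have "?I \<subseteq> {..length (word M (last w))}" by (auto simp: events_iff)
  then have fin: "finite ?I" by (rule finite_subset) simp
  show ?thesis
  proof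
    assume "first_pos M w e \<le> i"
    then obtain k where k: "k \<in> ?I" "k \<le> i"
      using fin assms by (auto simp: first_pos_def Min_le_iff)
    then have "((last w, k), (last w, i)) \<in> (steps M w)\<^sup>*"
      using ev[OF k(1)] assms by (subst same_process_steps) (auto simp: events_iff)
    then show "(e, (last w, i)) \<in> (steps M w)\<^sup>*" using k by auto
  next
    assume "(e, (last w, i)) \<in> (steps M w)\<^sup>*"
    then show "first_pos M w e \<le> i" unfolding first_pos_def using fin by (intro Min_le) auto
  qed
qed

lemma last_pos_le:
  assumes "e \<in> events M" shows "last_pos M w e \<le> length (word M (hd w))"
proof (cases "last_pos M w e = 0")
  case False
  then have "((hd w, last_pos M w e), e) \<in> (steps M w)\<^sup>*"
    using last_pos_iff[OF assms, of "last_pos M w e" w] by simp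
  then have "(hd w, last_pos M w e) \<in> events M"
    using steps_rtrancl_edges edges_rtrancl_events assms by blast
  then show ?thesis by (simp add: events_iff)
qed simp

lemma first_pos_ge:
  assumes "e \<in> events M" shows "1 \<le> first_pos M w e"
proof (rule ccontr)
  assume "\<not> 1 \<le> first_pos M w e"
  then have "(e, (last w, 0)) \<in> (steps M w)\<^sup>*" using first_pos_iff[OF assms, of 0 w] by simp
  then have "(last w, 0) \<in> events M" using steps_rtrancl_edges edges_rtrancl_events assms by blast
  then show False by (simp add: events_iff)
qed

lemma first_pos_le:
  assumes "e \<in> events M" shows "first_pos M w e \<le> Suc (length (word M (last w)))"
proof (cases "first_pos M w e \<le> length (word M (last w))")
  case False
  let ?I = "{i. (e, (last w, i)) \<in> (steps M w)\<^sup>*}"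
  have "?I \<subseteq> {..length (word M (last w))}"
  proof
    fix i assume "i \<in> ?I"
    then have "(last w, i) \<in> events M" using assms steps_rtrancl_edges edges_rtrancl_events by blast
    then show "i \<in> {..length (word M (last w))}" by (simp add: events_iff)
  qed
  then have fin: "finite ?I" by (rule finite_subset) simp
  then show ?thesis unfolding first_pos_def by (intro Min_le) auto
qed simp

text \<open>Cut the chain at its last message: what follows stays on the process of
  \<open>e\<close>.\<close>

lemma reach_through_sender:
  assumes "(f, e) \<in> (steps M w)\<^sup>*" "fst f \<noteq> fst e"
  obtains s e' where "(s, e') \<in> msg M" "adj w (fst s) (fst e)" "fst e' = fst e" "snd e' \<le> snd e"
    "(f, s) \<in> (steps M w)\<^sup>*"
proof -
  from assms(1) have "fst f = fst e \<or> (\<exists>s e'. (s, e') \<in> msg M \<and> adj w (fst s) (fst e) \<and>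
      fst e' = fst e \<and> snd e' \<le> snd e \<and> (f, s) \<in> (steps M w)\<^sup>*)"
  proof (induction rule: rtrancl_induct)
    case (step e g)
    show ?case
    proof (cases "(e, g) \<in> proc_rel M")
      case True
      then have "fst g = fst e" "snd e \<le> snd g" by (auto simp: proc_rel_iff)
      then show ?thesis using step.IH by (metis le_trans)
    next
      case False
      then have "(e, g) \<in> msg M \<and> adj w (fst e) (fst g)" using step by (auto simp: steps_def)
      then show ?thesis using step.hyps(1) by blast
    qed
  qed simp
  then obtain s e' where "(s, e') \<in> msg M" "adj w (fst s) (fst e)" "fst e' = fst e"
    "snd e' \<le> snd e" "(f, s) \<in> (steps M w)\<^sup>*"
    using assms(2) by metis
  then show thesis by (rule that)
qed

lemma reach_through_receiver:
  assumes "(e, f) \<in> (steps M w)\<^sup>*" "fst e \<noteq> fst f"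
  obtains s g where "(s, g) \<in> msg M" "adj w (fst e) (fst g)" "fst s = fst e" "snd e \<le> snd s"
    "(g, f) \<in> (steps M w)\<^sup>*"
proof -
  from assms(1) have "fst e = fst f \<or> (\<exists>s g. (s, g) \<in> msg M \<and> adj w (fst e) (fst g) \<and>
      fst s = fst e \<and> snd e \<le> snd s \<and> (g, f) \<in> (steps M w)\<^sup>*)"
  proof (induction rule: converse_rtrancl_induct)
    case (step e g)
    show ?case
    proof (cases "(e, g) \<in> proc_rel M")
      case True
      then have "fst g = fst e" "snd e \<le> snd g" by (auto simp: proc_rel_iff)
      then show ?thesis using step.IH by (metis le_trans)
    next
      case False
      then have "(e, g) \<in> msg M \<and> adj w (fst e) (fst g)" using step by (auto simp: steps_def)
      then show ?thesis using step.hyps(2) by blast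
    qed
  qed simp
  then obtain s g where "(s, g) \<in> msg M" "adj w (fst e) (fst g)" "fst s = fst e"
    "snd e \<le> snd s" "(g, f) \<in> (steps M w)\<^sup>*"
    using assms(2) by metis
  then show thesis by (rule that)
qed

text \<open>By the FIFO condition, only the last message received matters.\<close>

lemma reach_receive:
  assumes w: "distinct w" and s: "(s, e) \<in> msg M" "adj w (fst s) (fst e)" and f: "fst f \<noteq> fst e"
  shows "(f, e) \<in> (steps M w)\<^sup>* \<longleftrightarrow> (f, s) \<in> (steps M w)\<^sup>*"
proof
  assume "(f, e) \<in> (steps M w)\<^sup>*"
  then obtain s' e' where s': "(s', e') \<in> msg M" "adj w (fst s') (fst e)" "fst e' = fst e"
    "snd e' \<le> snd e" "(f, s') \<in> (steps M w)\<^sup>*"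
    using reach_through_sender[OF _ f] by metis
  have "fst s' = fst s" using adj_left_unique[OF w s'(2) s(2)] .
  then have "snd s' \<le> snd s" using fifo[OF s'(1) s(1)] s' by simp
  then have "(s', s) \<in> (steps M w)\<^sup>*"
    using same_process_steps msg_events[OF s(1)] msg_events[OF s'(1)] \<open>fst s' = fst s\<close> by blast
  then show "(f, s) \<in> (steps M w)\<^sup>*" using s' by auto
next
  assume "(f, s) \<in> (steps M w)\<^sup>*"
  then show "(f, e) \<in> (steps M w)\<^sup>*" using s by (auto simp: steps_def intro: rtrancl_into_rtrancl)
qed

text \<open>Dual use of FIFO: a later message to the next process of \<open>w\<close> is received
  after \<open>g\<close>, so \<open>g\<close> reaches everything that is reached through it.\<close>

lemma reach_send:
  assumes w: "distinct w" and g: "(e, g) \<in> msg M" "adj w (fst e) (fst g)" and f: "fst e \<noteq> fst f"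
  shows "(e, f) \<in> (steps M w)\<^sup>* \<longleftrightarrow> (g, f) \<in> (steps M w)\<^sup>*"
proof
  assume "(e, f) \<in> (steps M w)\<^sup>*"
  then obtain s' g' where s': "(s', g') \<in> msg M" "adj w (fst e) (fst g')" "fst s' = fst e"
    "snd e \<le> snd s'" "(g', f) \<in> (steps M w)\<^sup>*"
    using reach_through_receiver[OF _ f] by metis
  have "fst g' = fst g" using adj_right_unique[OF w s'(2) g(2)] .
  then have "snd g \<le> snd g'" using fifo[OF g(1) s'(1)] s' by simp
  then have "(g, g') \<in> (steps M w)\<^sup>*"
    using same_process_steps msg_events[OF g(1)] msg_events[OF s'(1)] \<open>fst g' = fst g\<close> by metis
  then show "(g, f) \<in> (steps M w)\<^sup>*" using s' by auto
next
  assume "(g, f) \<in> (steps M w)\<^sup>*"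
  then show "(e, f) \<in> (steps M w)\<^sup>*"
    using g by (auto simp: steps_def intro: converse_rtrancl_into_rtrancl)
qed

section \<open>Local recursion for the extremal positions\<close>

lemma last_pos_hd: "e \<in> events M \<Longrightarrow> fst e = hd w \<Longrightarrow> last_pos M w e = snd e"
proof -
  assume e: "e \<in> events M" "fst e = hd w"
  have "i \<le> last_pos M w e \<longleftrightarrow> i \<le> snd e" if "1 \<le> i" "i \<le> length (word M (hd w))" for i
    using last_pos_iff[OF e(1) that(1), of w] same_process_steps[of "(hd w, i)" e w] e that
    by (auto simp: events_iff)
  moreover have "last_pos M w e \<le> length (word M (hd w))" using last_pos_le e by blast
  moreover have "1 \<le> snd e \<and> snd e \<le> length (word M (hd w))"
    using e by (cases e) (auto simp: events_iff)
  ultimately show ?thesis by (metis le_antisym le_trans linorder_le_cases)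
qed

lemma last_pos_receive:
  assumes "distinct w" "(s, e) \<in> msg M" "adj w (fst s) (fst e)"
  shows "last_pos M w e = last_pos M w s"
proof -
  have "((hd w, i), e) \<in> (steps M w)\<^sup>* \<longleftrightarrow> ((hd w, i), s) \<in> (steps M w)\<^sup>*" for i
    using adj_not_hd[OF assms(1,3)] by (intro reach_receive[OF assms]) simp
  then show ?thesis by (simp only: last_pos_def)
qed

text \<open>Without a message along \<open>w\<close> into \<open>e\<close>, the last step of any
  chain from another process is the process edge. The first event of a process has no such edge,
  hence the default 0.\<close>

lemma last_pos_prev:
  assumes e: "e \<in> events M" "fst e \<noteq> hd w"
    and no: "\<nexists>s. (s, e) \<in> msg M \<and> adj w (fst s) (fst e)"
  shows "last_pos M w e = (if snd e = 1 then 0 else last_pos M w (fst e, snd e - 1))"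
proof -
  have *: "(f, e) \<in> (steps M w)\<^sup>* \<longleftrightarrow> snd e \<noteq> 1 \<and> (f, (fst e, snd e - 1)) \<in> (steps M w)\<^sup>*"
    if ne: "fst f \<noteq> fst e" for f
  proof
    assume "(f, e) \<in> (steps M w)\<^sup>*"
    then obtain g where g: "(f, g) \<in> (steps M w)\<^sup>*" "(g, e) \<in> steps M w"
      using rtrancl_last_step[of f e] ne by metis
    then have ge: "(g, e) \<in> proc_rel M" using no g(2) unfolding steps_def by blast
    then have "g = (fst e, snd e - 1)" by (cases g) (auto simp: proc_rel_iff)
    moreover have "snd e \<noteq> 1" using ge by (cases g) (auto simp: proc_rel_iff events_iff)
    ultimately show "snd e \<noteq> 1 \<and> (f, (fst e, snd e - 1)) \<in> (steps M w)\<^sup>*" using g by simp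
  next
    assume *: "snd e \<noteq> 1 \<and> (f, (fst e, snd e - 1)) \<in> (steps M w)\<^sup>*"
    then have "((fst e, snd e - 1), e) \<in> proc_rel M" using e
      by (cases e) (auto simp: proc_rel_iff events_iff)
    then show "(f, e) \<in> (steps M w)\<^sup>*" using *
      by (auto simp: steps_def intro: rtrancl_into_rtrancl)
  qed
  show ?thesis using * e by (auto simp: last_pos_def)
qed

lemma first_pos_last: "e \<in> events M \<Longrightarrow> fst e = last w \<Longrightarrow> first_pos M w e = snd e"
proof -
  assume e: "e \<in> events M" "fst e = last w"
  have "first_pos M w e \<le> i \<longleftrightarrow> snd e \<le> i" if "1 \<le> i" "i \<le> length (word M (last w))" for i
    using first_pos_iff[OF e(1) that(2)] same_process_steps[of e "(last w, i)" w] e that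
    by (auto simp: events_iff)
  moreover have "1 \<le> first_pos M w e" using first_pos_ge e by blast
  moreover have "1 \<le> snd e \<and> snd e \<le> length (word M (last w))"
    using e by (cases e) (auto simp: events_iff)
  ultimately show ?thesis by (metis le_antisym le_trans order_refl)
qed

lemma first_pos_send:
  assumes "distinct w" "(e, g) \<in> msg M" "adj w (fst e) (fst g)"
  shows "first_pos M w e = first_pos M w g"
proof -
  have "(e, (last w, i)) \<in> (steps M w)\<^sup>* \<longleftrightarrow> (g, (last w, i)) \<in> (steps M w)\<^sup>*" for i
    using adj_not_last[OF assms(1,3)] by (intro reach_send[OF assms]) simp
  then show ?thesis by (simp only: first_pos_def)
qed

lemma first_pos_next:
  assumes e: "e \<in> events M" "fst e \<noteq> last w"
    and no: "\<nexists>g. (e, g) \<in> msg M \<and> adj w (fst e) (fst g)"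
  shows "first_pos M w e = (if snd e = length (word M (fst e))
    then Suc (length (word M (last w))) else first_pos M w (fst e, Suc (snd e)))"
proof -
  have *: "(e, f) \<in> (steps M w)\<^sup>* \<longleftrightarrow>
      snd e \<noteq> length (word M (fst e)) \<and> ((fst e, Suc (snd e)), f) \<in> (steps M w)\<^sup>*"
    if ne: "fst e \<noteq> fst f" for f
  proof
    assume "(e, f) \<in> (steps M w)\<^sup>*"
    then obtain g where g: "(g, f) \<in> (steps M w)\<^sup>*" "(e, g) \<in> steps M w"
      using rtrancl_first_step[of e f] ne by metis
    then have eg: "(e, g) \<in> proc_rel M" using no g(2) unfolding steps_def by blast
    then have "g = (fst e, Suc (snd e))" by (cases g) (auto simp: proc_rel_iff)
    moreover have "snd e \<noteq> length (word M (fst e))" using eg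
      by (cases g) (auto simp: proc_rel_iff events_iff)
    ultimately show "snd e \<noteq> length (word M (fst e)) \<and> ((fst e, Suc (snd e)), f) \<in> (steps M w)\<^sup>*"
      using g by simp
  next
    assume *: "snd e \<noteq> length (word M (fst e)) \<and> ((fst e, Suc (snd e)), f) \<in> (steps M w)\<^sup>*"
    then have "(e, (fst e, Suc (snd e))) \<in> proc_rel M" using e
      by (cases e) (auto simp: proc_rel_iff events_iff)
    then show "(e, f) \<in> (steps M w)\<^sup>*" using *
      by (auto simp: steps_def intro: converse_rtrancl_into_rtrancl)
  qed
  show ?thesis using * e by (auto simp: first_pos_def)
qed

section \<open>Transport of a colouring along a process path\<close>

definition forward_ok :: "'p list \<Rightarrow> (nat \<Rightarrow> 'x) \<Rightarrow> ('p event \<Rightarrow> 'x) \<Rightarrow> bool" where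
  "forward_ok w sv v \<longleftrightarrow> (\<forall>e\<in>events M. fst e \<in> set w \<longrightarrow>
     (fst e = hd w \<longrightarrow> v e = sv (snd e)) \<and>
     (\<forall>s. (s, e) \<in> msg M \<longrightarrow> adj w (fst s) (fst e) \<longrightarrow> v e = v s) \<and>
     (fst e \<noteq> hd w \<longrightarrow> (\<nexists>s. (s, e) \<in> msg M \<and> adj w (fst s) (fst e)) \<longrightarrow>
        v e = (if snd e = 1 then sv 0 else v (fst e, snd e - 1))))"

definition backward_ok :: "'p list \<Rightarrow> (nat \<Rightarrow> 'x) \<Rightarrow> ('p event \<Rightarrow> 'x) \<Rightarrow> bool" where
  "backward_ok w sv v \<longleftrightarrow> (\<forall>e\<in>events M. fst e \<in> set w \<longrightarrow>
     (fst e = last w \<longrightarrow> v e = sv (snd e)) \<and>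
     (\<forall>g. (e, g) \<in> msg M \<longrightarrow> adj w (fst e) (fst g) \<longrightarrow> v e = v g) \<and>
     (fst e \<noteq> last w \<longrightarrow> (\<nexists>g. (e, g) \<in> msg M \<and> adj w (fst e) (fst g)) \<longrightarrow>
        v e = (if snd e = length (word M (fst e)) then sv (Suc (length (word M (last w))))
               else v (fst e, Suc (snd e)))))"

text \<open>The three clauses mirror \<open>last_pos_hd\<close>, \<open>last_pos_receive\<close> and
  \<open>last_pos_prev\<close>. They form a recursion along \<open>edges M\<close> and thus have a
  unique solution: the value of \<open>sv\<close> at the tracked position travels without the
  position being known.\<close>

lemma forward_ok_iff:
  assumes w: "distinct w"
  shows "forward_ok w sv v \<longleftrightarrow> (\<forall>e\<in>events M. fst e \<in> set w \<longrightarrow> v e = sv (last_pos M w e))"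
proof
  assume ok: "forward_ok w sv v"
  have "e \<in> events M \<longrightarrow> fst e \<in> set w \<longrightarrow> v e = sv (last_pos M w e)" for e
    using wf_edges
  proof (induction e rule: wf_induct_rule)
    case (less e)
    show ?case
    proof (intro impI)
      assume e: "e \<in> events M" "fst e \<in> set w"
      consider "fst e = hd w" | s where "(s, e) \<in> msg M" "adj w (fst s) (fst e)"
        | "fst e \<noteq> hd w" "\<nexists>s. (s, e) \<in> msg M \<and> adj w (fst s) (fst e)" by blast
      then show "v e = sv (last_pos M w e)"
      proof cases
        case 1
        then show ?thesis using ok e last_pos_hd[OF e(1) 1] by (auto simp: forward_ok_def)
      next
        case 2
        then have "v e = v s" using ok e unfolding forward_ok_def by blast
        moreover have "v s = sv (last_pos M w s)"
          using less[of s] 2 msg_events[OF 2(1)] adj_set[OF 2(2)] by (auto simp: edges_def)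
        ultimately show ?thesis using last_pos_receive[OF w 2] by simp
      next
        case 3
        then have v: "v e = (if snd e = 1 then sv 0 else v (fst e, snd e - 1))"
          using ok e unfolding forward_ok_def by blast
        show ?thesis
        proof (cases "snd e = 1")
          case False
          then have "((fst e, snd e - 1), e) \<in> proc_rel M" using e
            by (cases e) (auto simp: proc_rel_iff events_iff)
          then have "v (fst e, snd e - 1) = sv (last_pos M w (fst e, snd e - 1))"
            using less[of "(fst e, snd e - 1)"] e by (auto simp: edges_def proc_rel_iff)
          then show ?thesis using v False last_pos_prev[OF e(1) 3] by simp
        qed (use v last_pos_prev[OF e(1) 3] in simp)
      qed
    qed
  qed
  then show "\<forall>e\<in>events M. fst e \<in> set w \<longrightarrow> v e = sv (last_pos M w e)" by blast
next
  assume v: "\<forall>e\<in>events M. fst e \<in> set w \<longrightarrow> v e = sv (last_pos M w e)"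
  show "forward_ok w sv v"
    unfolding forward_ok_def
  proof (intro ballI impI conjI allI)
    fix e assume e: "e \<in> events M" "fst e \<in> set w"
    show "v e = sv (snd e)" if "fst e = hd w" using v e last_pos_hd that by auto
    show "v e = v s" if "(s, e) \<in> msg M" "adj w (fst s) (fst e)" for s
      using v e last_pos_receive[OF w that] msg_events[OF that(1)] adj_set[OF that(2)] by auto
    assume *: "fst e \<noteq> hd w" "\<nexists>s. (s, e) \<in> msg M \<and> adj w (fst s) (fst e)"
    show "v e = (if snd e = 1 then sv 0 else v (fst e, snd e - 1))"
    proof (cases "snd e = 1")
      case False
      then have "(fst e, snd e - 1) \<in> events M" using e
        by (cases e) (auto simp: events_iff)
      then show ?thesis using v e last_pos_prev[OF e(1) *] False by auto
    qed (use v e last_pos_prev[OF e(1) *] in auto)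
  qed
qed

text \<open>Here the recursion runs along the converse edges, and the end value is \<open>sv\<close>
  at the position after the last one.\<close>

lemma backward_ok_iff:
  assumes w: "distinct w"
  shows "backward_ok w sv v \<longleftrightarrow> (\<forall>e\<in>events M. fst e \<in> set w \<longrightarrow> v e = sv (first_pos M w e))"
proof
  assume ok: "backward_ok w sv v"
  have "e \<in> events M \<longrightarrow> fst e \<in> set w \<longrightarrow> v e = sv (first_pos M w e)" for e
    using wf_edges_converse
  proof (induction e rule: wf_induct_rule)
    case (less e)
    show ?case
    proof (intro impI)
      assume e: "e \<in> events M" "fst e \<in> set w"
      consider "fst e = last w" | g where "(e, g) \<in> msg M" "adj w (fst e) (fst g)"
        | "fst e \<noteq> last w" "\<nexists>g. (e, g) \<in> msg M \<and> adj w (fst e) (fst g)" by blast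
      then show "v e = sv (first_pos M w e)"
      proof cases
        case 1
        then show ?thesis using ok e first_pos_last[OF e(1) 1] by (auto simp: backward_ok_def)
      next
        case 2
        then have "v e = v g" using ok e unfolding backward_ok_def by blast
        moreover have "v g = sv (first_pos M w g)"
          using less[of g] 2 msg_events[OF 2(1)] adj_set[OF 2(2)] by (auto simp: edges_def)
        ultimately show ?thesis using first_pos_send[OF w 2] by simp
      next
        case 3
        then have v: "v e = (if snd e = length (word M (fst e))
            then sv (Suc (length (word M (last w)))) else v (fst e, Suc (snd e)))"
          using ok e unfolding backward_ok_def by blast
        show ?thesis
        proof (cases "snd e = length (word M (fst e))")
          case False
          then have "(e, (fst e, Suc (snd e))) \<in> proc_rel M" using e
            by (cases e) (auto simp: proc_rel_iff events_iff)
          then have "v (fst e, Suc (snd e)) = sv (first_pos M w (fst e, Suc (snd e)))"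
            using less[of "(fst e, Suc (snd e))"] e by (auto simp: edges_def proc_rel_iff)
          then show ?thesis using v False first_pos_next[OF e(1) 3] by simp
        qed (use v first_pos_next[OF e(1) 3] in simp)
      qed
    qed
  qed
  then show "\<forall>e\<in>events M. fst e \<in> set w \<longrightarrow> v e = sv (first_pos M w e)" by blast
next
  assume v: "\<forall>e\<in>events M. fst e \<in> set w \<longrightarrow> v e = sv (first_pos M w e)"
  show "backward_ok w sv v"
    unfolding backward_ok_def
  proof (intro ballI impI conjI allI)
    fix e assume e: "e \<in> events M" "fst e \<in> set w"
    show "v e = sv (snd e)" if "fst e = last w" using v e first_pos_last that by auto
    show "v e = v g" if "(e, g) \<in> msg M" "adj w (fst e) (fst g)" for g
      using v e first_pos_send[OF w that] msg_events[OF that(1)] adj_set[OF that(2)] by auto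
    assume *: "fst e \<noteq> last w" "\<nexists>g. (e, g) \<in> msg M \<and> adj w (fst e) (fst g)"
    show "v e = (if snd e = length (word M (fst e)) then sv (Suc (length (word M (last w))))
               else v (fst e, Suc (snd e)))"
    proof (cases "snd e = length (word M (fst e))")
      case False
      then have "(fst e, Suc (snd e)) \<in> events M" using e
        by (cases e) (auto simp: events_iff)
      then show ?thesis using v e first_pos_next[OF e(1) *] False by auto
    qed (use v e first_pos_next[OF e(1) *] in auto)
  qed
qed

text \<open>
  A path that comes back to a process visited before can be cut short along that process.
\<close>

lemma simple_path:
  assumes "(f, e) \<in> (edges M)\<^sup>*" "f \<in> events M"
  shows "\<exists>w. distinct w \<and> w \<noteq> [] \<and> hd w = fst f \<and> last w = fst e \<and> set w \<subseteq> P \<and>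
    (f, e) \<in> (steps M w)\<^sup>* \<and>
    (\<forall>r\<in>set w. \<exists>x. fst x = r \<and> (f, x) \<in> (edges M)\<^sup>* \<and> (x, e) \<in> (edges M)\<^sup>*)"
  using assms(1)
proof (induction e rule: wf_induct_rule[OF wf_trancl[OF wf_edges]])
  case (1 e)
  note e = edges_rtrancl_events[OF 1(2)]
  \<comment> \<open>The earliest event above \<open>f\<close> on the process of \<open>e\<close>.
    Unless it is \<open>f\<close>, its predecessor on a path from \<open>f\<close> cannot be on the
    same process, so the path enters by a message.\<close>
  define i where "i = (LEAST i. (f, (fst e, i)) \<in> (edges M)\<^sup>*)"
  define x where "x = (fst e, i)"
  have x: "(f, x) \<in> (edges M)\<^sup>*" "snd x \<le> snd e"
    unfolding i_def x_def using 1(2) LeastI[of "\<lambda>i. (f, (fst e, i)) \<in> (edges M)\<^sup>*" "snd e"]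
    by (auto intro: Least_le)
  have least: "snd x \<le> snd y" if "(f, y) \<in> (edges M)\<^sup>*" "fst y = fst e" for y
    using that unfolding i_def x_def by (cases y) (auto intro: Least_le)
  have xe: "x \<in> events M" "e \<in> events M" "fst x = fst e"
    using edges_rtrancl_events[OF x(1)] e assms by (auto simp: x_def)
  then have xe_proc: "(x, e) \<in> (proc_rel M)\<^sup>*" using x by (simp add: proc_rel_rtrancl)
  show ?case
  proof (cases "x = f")
    case True
    then have "(f, e) \<in> (steps M [fst f])\<^sup>*" using proc_steps[OF xe_proc] by simp
    then show ?thesis using True xe event_process[OF assms(2)] 1(2)
      by (intro exI[of _ "[fst f]"] conjI ballI exI[of _ f]) auto
  next
    case False
    then obtain y where y: "(f, y) \<in> (edges M)\<^sup>*" "(y, x) \<in> edges M"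
      using rtrancl_last_step[OF x(1)] False by metis
    have "(y, x) \<notin> proc_rel M"
    proof
      assume "(y, x) \<in> proc_rel M"
      then have "fst y = fst e" "snd y < snd x" using xe by (auto simp: proc_rel_iff)
      then show False using least[OF y(1)] by simp
    qed
    then have yx: "(y, x) \<in> msg M" using y by (auto simp: edges_def)
    have ye: "(y, e) \<in> (edges M)\<^sup>+" using y(2) proc_edges[OF xe_proc] by (rule rtrancl_into_trancl2)
    have "\<exists>w. distinct w \<and> w \<noteq> [] \<and> hd w = fst f \<and> last w = fst y \<and> set w \<subseteq> P \<and>
        (f, y) \<in> (steps M w)\<^sup>* \<and>
        (\<forall>r\<in>set w. \<exists>x. fst x = r \<and> (f, x) \<in> (edges M)\<^sup>* \<and> (x, y) \<in> (edges M)\<^sup>*)"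
      using 1(1)[OF ye y(1)] .
    then obtain w where w: "distinct w" "w \<noteq> []" "hd w = fst f" "last w = fst y" "set w \<subseteq> P"
      "(f, y) \<in> (steps M w)\<^sup>*"
      "\<And>r. r \<in> set w \<Longrightarrow> \<exists>x. fst x = r \<and> (f, x) \<in> (edges M)\<^sup>* \<and> (x, y) \<in> (edges M)\<^sup>*"
      by blast
    \<comment> \<open>An earlier visit would give an event \<open>x'\<close> of this process above
      \<open>f\<close> and strictly below \<open>x\<close>, while minimality of \<open>x\<close>
      puts \<open>x\<close> below \<open>x'\<close>. The last conjunct of the statement is carried
      along to supply \<open>x'\<close>.\<close>
    have new: "fst e \<notin> set w"
    proof
      assume "fst e \<in> set w"
      then obtain x' where x': "fst x' = fst e" "(f, x') \<in> (edges M)\<^sup>*" "(x', y) \<in> (edges M)\<^sup>*"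
        using w(7) by blast
      then have "(x', x) \<in> (edges M)\<^sup>+" using y(2) by (metis rtrancl_into_trancl1)
      moreover have "(x, x') \<in> (edges M)\<^sup>*"
        using least[OF x'(2,1)] x' xe edges_rtrancl_events[OF x'(2)] assms
        by (subst same_process_le) auto
      ultimately have "(x, x) \<in> (edges M)\<^sup>+" by (metis rtrancl_trancl_trancl)
      then show False using acyclic unfolding acyclic_def by blast
    qed
    have "(f, y) \<in> (steps M (w @ [fst e]))\<^sup>*"
      by (rule rtrancl_mono[THEN subsetD, OF _ w(6)]) (auto simp: steps_def adj_append)
    moreover have "(y, x) \<in> steps M (w @ [fst e])"
      using yx adj_snoc[OF w(2), of "fst e"] w(4) xe by (auto simp: steps_def)
    ultimately have steps: "(f, e) \<in> (steps M (w @ [fst e]))\<^sup>*"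
      using proc_steps[OF xe_proc, of "w @ [fst e]"]
      by (blast intro: rtrancl_trans[OF rtrancl.rtrancl_into_rtrancl])
    have through: "\<exists>z. fst z = r \<and> (f, z) \<in> (edges M)\<^sup>* \<and> (z, e) \<in> (edges M)\<^sup>*"
      if "r \<in> set (w @ [fst e])" for r
    proof (cases "r = fst e")
      case True
      then show ?thesis using 1(2) by blast
    next
      case False
      then have "r \<in> set w" using that by simp
      then obtain z where "fst z = r" "(f, z) \<in> (edges M)\<^sup>*" "(z, y) \<in> (edges M)\<^sup>*"
        using w(7) by blast
      then show ?thesis using rtrancl_trans[OF _ trancl_into_rtrancl[OF ye]] by blast
    qed
    show ?thesis
    proof (intro exI[of _ "w @ [fst e]"] conjI ballI)
      show "\<exists>z. fst z = r \<and> (f, z) \<in> (edges M)\<^sup>* \<and> (z, e) \<in> (edges M)\<^sup>*"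
        if "r \<in> set (w @ [fst e])" for r using through[OF that] .
    qed (use steps w(1-5) new event_process[OF xe(2)] in simp_all)
  qed
qed

end

section \<open>Certificates for parallel events\<close>

type_synonym ('p, 'a) index = "'a \<times> 'p list \<times> 'p list"

definition indices :: "'p set \<Rightarrow> 'a set \<Rightarrow> ('p, 'a) index set" where
  "indices P \<Sigma> = {(a, w, w'). a \<in> \<Sigma> \<and> distinct w \<and> distinct w' \<and> set w \<subseteq> P \<and> set w' \<subseteq> P \<and>
     w \<noteq> [] \<and> w' \<noteq> [] \<and> hd w = last w' \<and> last w = hd w' \<and> hd w \<noteq> last w}"

definition gap_at :: "('p event \<Rightarrow> gap) \<Rightarrow> 'p \<Rightarrow> nat \<Rightarrow> gap" where
  "gap_at f q i = (if i = 0 then gap_init else f (q, i))"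

definition claim_at :: "('p event \<Rightarrow> bool option) \<Rightarrow> 'p \<Rightarrow> nat \<Rightarrow> bool option" where
  "claim_at z p j = (if j = 0 then Some False else z (p, j))"

context chart
begin

text \<open>For the converse, let \<open>w\<close> realise the globally last event of
  \<open>q\<close> below \<open>e\<close> and \<open>w'\<close> the globally first one above it. For
  this pair the path bounds are the true bounds, so whatever lies between them is parallel to
  \<open>e\<close>.\<close>

lemma parallel_iff:
  assumes e: "e \<in> events M" and q: "q \<in> P" "q \<noteq> fst e" and a: "a \<in> \<Sigma>"
  shows "(\<exists>f\<in>events M. label M f = (q, a) \<and> (e, f) \<in> parallel M) \<longleftrightarrow>
    (\<forall>w w'. (a, w, w') \<in> indices P \<Sigma> \<longrightarrow> hd w = q \<longrightarrow> last w = fst e \<longrightarrow>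
       (\<exists>i. last_pos M w e < i \<and> i \<le> first_pos M w' e - 1 \<and> letter M (q, i) = a))"
    (is "?par \<longleftrightarrow> ?gaps")
proof
  assume ?par
  then obtain i where i: "(q, i) \<in> events M" "letter M (q, i) = a"
    "(e, (q, i)) \<notin> (edges M)\<^sup>*" "((q, i), e) \<notin> (edges M)\<^sup>*"
    by (auto simp: parallel_def label_def)
  show ?gaps
  proof (intro allI impI)
    fix w w' assume w: "(a, w, w') \<in> indices P \<Sigma>" "hd w = q" "last w = fst e"
    have "\<not> i \<le> last_pos M w e"
      using last_pos_iff[OF e, of i w] i steps_rtrancl_edges[of "(q, i)" e w] w
      by (auto simp: events_iff)
    moreover have "\<not> first_pos M w' e \<le> i"
      using first_pos_iff[OF e, of i w'] i steps_rtrancl_edges[of e "(q, i)" w'] w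
      by (auto simp: events_iff indices_def)
    ultimately show "\<exists>i. last_pos M w e < i \<and> i \<le> first_pos M w' e - 1 \<and> letter M (q, i) = a"
      using i by (intro exI[of _ i]) auto
  qed
next
  assume gaps: ?gaps
  have p: "fst e \<in> P" using event_process e .
  have "\<exists>w. distinct w \<and> w \<noteq> [] \<and> hd w = q \<and> last w = fst e \<and> set w \<subseteq> P \<and>
      (\<forall>i. ((q, i), e) \<in> (edges M)\<^sup>* \<longrightarrow> i \<le> last_pos M w e)"
  proof (cases "\<exists>i. ((q, i), e) \<in> (edges M)\<^sup>*")
    case True
    have bound: "i \<le> length (word M q)" if "((q, i), e) \<in> (edges M)\<^sup>*" for i
      using edges_rtrancl_events[OF that] e by (simp add: events_iff)
    define k where "k = (GREATEST i. ((q, i), e) \<in> (edges M)\<^sup>*)"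
    have k: "((q, k), e) \<in> (edges M)\<^sup>*"
      unfolding k_def using True bound by (rule GreatestI_ex_nat)
    have max: "i \<le> k" if "((q, i), e) \<in> (edges M)\<^sup>*" for i
      unfolding k_def using that bound by (rule Greatest_le_nat)
    have ev: "(q, k) \<in> events M" using edges_rtrancl_events[OF k] e by simp
    obtain w where w: "distinct w" "w \<noteq> []" "hd w = q" "last w = fst e" "set w \<subseteq> P"
      "((q, k), e) \<in> (steps M w)\<^sup>*"
      using simple_path[OF k ev] by auto
    then have "k \<le> last_pos M w e" using last_pos_iff[OF e, of k w] ev by (simp add: events_iff)
    then show ?thesis using w max by (intro exI[of _ w]) (auto intro: order.trans)
  next
    case False
    \<comment> \<open>If no event of \<open>q\<close> is below \<open>e\<close>, the requirement on
      the bound is vacuous and the two-element path serves.\<close>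
    then show ?thesis using p q by (intro exI[of _ "[q, fst e]"]) auto
  qed
  then obtain w where w: "distinct w" "w \<noteq> []" "hd w = q" "last w = fst e" "set w \<subseteq> P"
    "\<And>i. ((q, i), e) \<in> (edges M)\<^sup>* \<Longrightarrow> i \<le> last_pos M w e"
    by blast
  have "\<exists>w. distinct w \<and> w \<noteq> [] \<and> hd w = fst e \<and> last w = q \<and> set w \<subseteq> P \<and>
      (\<forall>i. (e, (q, i)) \<in> (edges M)\<^sup>* \<longrightarrow> first_pos M w e \<le> i)"
  proof (cases "\<exists>i. (e, (q, i)) \<in> (edges M)\<^sup>*")
    case True
    define k where "k = (LEAST i. (e, (q, i)) \<in> (edges M)\<^sup>*)"
    have k: "(e, (q, k)) \<in> (edges M)\<^sup>*" unfolding k_def using True by (auto intro: LeastI)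
    have min: "k \<le> i" if "(e, (q, i)) \<in> (edges M)\<^sup>*" for i
      unfolding k_def using that by (rule Least_le)
    have ev: "(q, k) \<in> events M" using edges_rtrancl_events[OF k] e by simp
    obtain w where w: "distinct w" "w \<noteq> []" "hd w = fst e" "last w = q" "set w \<subseteq> P"
      "(e, (q, k)) \<in> (steps M w)\<^sup>*"
      using simple_path[OF k e] by auto
    then have "first_pos M w e \<le> k" using first_pos_iff[OF e, of k w] ev by (simp add: events_iff)
    then show ?thesis using w min by (intro exI[of _ w]) (auto intro: order.trans)
  next
    case False
    then show ?thesis using p q by (intro exI[of _ "[fst e, q]"]) auto
  qed
  then obtain w' where w': "distinct w'" "w' \<noteq> []" "hd w' = fst e" "last w' = q" "set w' \<subseteq> P"
    "\<And>i. (e, (q, i)) \<in> (edges M)\<^sup>* \<Longrightarrow> first_pos M w' e \<le> i"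
    by blast
  have "(a, w, w') \<in> indices P \<Sigma>" using w w' a q by (auto simp: indices_def)
  then obtain i where i: "last_pos M w e < i" "i \<le> first_pos M w' e - 1" "letter M (q, i) = a"
    using gaps w by blast
  have "i < first_pos M w' e" using i(2) first_pos_ge[OF e, of w'] by linarith
  moreover have "(q, i) \<in> events M"
    using i first_pos_le[OF e, of w'] w' by (auto simp: events_iff)
  ultimately show ?par using i(1,3) w(6)[of i] w'(6)[of i] e
    by (intro bexI[of _ "(q, i)"]) (auto simp: parallel_def label_def)
qed

text \<open>Both sides of \<open>V_iff\<close> say that \<open>(last w, j)\<close> reaches
  \<open>(hd w, i)\<close> along \<open>w'\<close>. If \<open>L_le_H\<close> failed, an event of
  \<open>hd w\<close> would be both below and above an event of \<open>last w\<close>, against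
  acyclicity.\<close>

lemma gap_system:
  assumes k: "(a, w, w') \<in> indices P \<Sigma>"
  shows "gap_system (length (word M (last w))) (length (word M (hd w)))
    (\<lambda>j. last_pos M w (last w, j)) (\<lambda>j. first_pos M w' (last w, j) - 1)
    (\<lambda>i. last_pos M w' (hd w, i))"
proof -
  let ?p = "last w" and ?q = "hd w"
  have w: "hd w' = ?p" "last w' = ?q" "?p \<noteq> ?q" using k by (auto simp: indices_def)
  have ev: "(?p, j) \<in> events M" if "1 \<le> j" "j \<le> length (word M ?p)" for j
    using that by (simp add: events_iff)
  have mono: "((?p, j), (?p, j')) \<in> (steps M v)\<^sup>*"
    if "1 \<le> j" "j \<le> j'" "j' \<le> length (word M ?p)" for j j' v
    using that ev by (subst same_process_steps) auto
  show ?thesis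
  proof
    fix j j' assume j: "1 \<le> j" "j \<le> j'" "j' \<le> length (word M ?p)"
    let ?e = "(?p, j)" and ?e' = "(?p, j')"
    have e: "?e \<in> events M" "?e' \<in> events M" using ev j by auto
    show "last_pos M w ?e \<le> last_pos M w ?e'"
    proof (cases "last_pos M w ?e = 0")
      case False
      then have pos: "1 \<le> last_pos M w ?e" by simp
      then have "((?q, last_pos M w ?e), ?e) \<in> (steps M w)\<^sup>*"
        using last_pos_iff[OF e(1)] by blast
      then show ?thesis using last_pos_iff[OF e(2) pos] mono[OF j] by (meson rtrancl_trans)
    qed simp
    show "first_pos M w' ?e - 1 \<le> first_pos M w' ?e' - 1"
    proof (cases "first_pos M w' ?e' \<le> length (word M (last w'))")
      case True
      then have "(?e', (last w', first_pos M w' ?e')) \<in> (steps M w')\<^sup>*"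
        using first_pos_iff[OF e(2)] by blast
      then have "first_pos M w' ?e \<le> first_pos M w' ?e'"
        using first_pos_iff[OF e(1) True] mono[OF j] by (meson rtrancl_trans)
      then show ?thesis by simp
    next
      case False
      then show ?thesis using first_pos_le[OF e(1), of w'] by linarith
    qed
  next
    fix j assume j: "1 \<le> j" "j \<le> length (word M ?p)"
    let ?e = "(?p, j)"
    have e: "?e \<in> events M" using ev j by auto
    show "first_pos M w' ?e - 1 \<le> length (word M ?q)" using first_pos_le[OF e, of w'] w by simp
    show "last_pos M w ?e \<le> first_pos M w' ?e - 1"
    proof (rule ccontr)
      assume "\<not> last_pos M w ?e \<le> first_pos M w' ?e - 1"
      then have le: "1 \<le> last_pos M w ?e" "first_pos M w' ?e \<le> last_pos M w ?e" by auto
      have "((?q, last_pos M w ?e), ?e) \<in> (edges M)\<^sup>*"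
        using last_pos_iff[OF e le(1), of w] steps_rtrancl_edges by blast
      moreover have "(?e, (?q, last_pos M w ?e)) \<in> (edges M)\<^sup>*"
        using first_pos_iff[OF e, of "last_pos M w ?e" w'] le w last_pos_le[OF e, of w]
          steps_rtrancl_edges[of ?e "(?q, last_pos M w ?e)" w'] by simp
      ultimately have "?e = (?q, last_pos M w ?e)" using edges_antisym by blast
      then show False using w by simp
    qed
  next
    fix i assume i: "1 \<le> i" "i \<le> length (word M ?q)"
    then have f: "(?q, i) \<in> events M" by (simp add: events_iff)
    show "last_pos M w' (?q, i) \<le> length (word M ?p)" using last_pos_le[OF f, of w'] w by simp
    fix j assume j: "1 \<le> j" "j \<le> length (word M ?p)"
    then have e: "(?p, j) \<in> events M" by (simp add: events_iff)
    have "j \<le> last_pos M w' (?q, i) \<longleftrightarrow> first_pos M w' (?p, j) \<le> i"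
      using last_pos_iff[OF f j(1), of w'] first_pos_iff[OF e, of i w'] w i by simp
    \<comment> \<open>\<open>first_pos\<close> is at least 1, so the truncated subtraction is
      exact.\<close>
    then show "j \<le> last_pos M w' (?q, i) \<longleftrightarrow> first_pos M w' (?p, j) - 1 < i"
      using first_pos_ge[OF e, of w'] by linarith
  qed
qed

text \<open>
  For \<open>(a, w, w')\<close>, the functions \<open>f\<close> and \<open>b\<close> transport the gap data of the letter \<open>a\<close> on the
  process \<open>hd w = last w'\<close> forwards along \<open>w\<close> and backwards along \<open>w'\<close>, and \<open>z\<close> transports the
  claims of the process \<open>last w = hd w'\<close> forwards along \<open>w'\<close>.
\<close>

definition certifies ::
  "('p, 'a) index \<Rightarrow> ('p event \<Rightarrow> gap) \<Rightarrow> ('p event \<Rightarrow> gap) \<Rightarrow> ('p event \<Rightarrow> bool option) \<Rightarrow> bool" where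
  "certifies = (\<lambda>(a, w, w') f b z.
     forward_ok w (gap_at f (hd w)) f \<and> backward_ok w' (\<lambda>i. gap_at f (hd w) (i - 1)) b \<and>
     forward_ok w' (claim_at z (last w)) z \<and>
     (\<forall>e\<in>events M. fst e = hd w \<longrightarrow>
        gap_step (letter M e = a) (gap_at f (hd w) (snd e - 1)) (f e) \<and>
        upper_check (letter M e = a) (gap_at f (hd w) (snd e - 1)) (z e)) \<and>
     (\<forall>e\<in>events M. fst e = last w \<longrightarrow> gap_check (z e) (f e) (b e)))"

text \<open>By uniqueness of transport, \<open>f\<close>, \<open>b\<close> and \<open>z\<close> are
  the values of one gap assignment \<open>A\<close> and one claim assignment \<open>Z\<close> at the
  tracked positions; the local checks then become those of \<open>certificate\<close>.\<close>

lemma certifies_sound: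
  assumes k: "(a, w, w') \<in> indices P \<Sigma>" and cert: "certifies (a, w, w') f b z"
    and e: "e \<in> events M" "fst e = last w"
  shows "z e = None \<longleftrightarrow>
    (\<exists>i. last_pos M w e < i \<and> i \<le> first_pos M w' e - 1 \<and> letter M (hd w, i) = a)"
proof -
  let ?p = "last w" and ?q = "hd w"
  let ?F = "\<lambda>i. letter M (?q, i) = a"
  have w: "distinct w" "distinct w'" "w \<noteq> []" "w' \<noteq> []" "hd w' = ?p" "last w' = ?q"
    using k by (auto simp: indices_def)
  have sets: "?p \<in> set w" "?q \<in> set w" "?p \<in> set w'" "?q \<in> set w'"
    using w(3-6) by (metis last_in_set hd_in_set)+
  interpret gap_system ?F "length (word M ?p)" "length (word M ?q)"
    "\<lambda>j. last_pos M w (?p, j)" "\<lambda>j. first_pos M w' (?p, j) - 1" "\<lambda>i. last_pos M w' (?q, i)"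
    by (rule gap_system[OF k])
  define A where "A = gap_at f ?q"
  define Z where "Z = claim_at z ?p"
  have ok: "forward_ok w A f" "backward_ok w' (\<lambda>i. A (i - 1)) b" "forward_ok w' Z z"
    and q: "\<And>e. e \<in> events M \<Longrightarrow> fst e = ?q \<Longrightarrow> gap_step (letter M e = a) (A (snd e - 1)) (f e) \<and>
      upper_check (letter M e = a) (A (snd e - 1)) (z e)"
    and p: "\<And>e. e \<in> events M \<Longrightarrow> fst e = ?p \<Longrightarrow> gap_check (z e) (f e) (b e)"
    using cert unfolding certifies_def prod.case A_def[symmetric] Z_def[symmetric]
    by simp_all
  have f: "f e = A (last_pos M w e)" if "e \<in> events M" "fst e \<in> set w" for e
    using ok(1) that unfolding forward_ok_iff[OF w(1)] by blast
  have b: "b e = A (first_pos M w' e - 1)" if "e \<in> events M" "fst e \<in> set w'" for e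
    using ok(2) that unfolding backward_ok_iff[OF w(2)] by blast
  have z: "z e = Z (last_pos M w' e)" if "e \<in> events M" "fst e \<in> set w'" for e
    using ok(3) that unfolding forward_ok_iff[OF w(2)] by blast
  have "certificate A Z"
    unfolding certificate_def
  proof (intro conjI ballI)
    show "A 0 = gap_init" "Z 0 = Some False" by (simp_all add: A_def gap_at_def Z_def claim_at_def)
    fix i assume "i \<in> {1..length (word M ?q)}"
    then have ev: "(?q, i) \<in> events M" and i: "i \<noteq> 0" by (auto simp: events_iff)
    show "gap_step (?F i) (A (i - 1)) (A i)" using q[OF ev] i by (simp add: A_def gap_at_def)
    show "upper_check (?F i) (A (i - 1)) (Z (last_pos M w' (?q, i)))"
      using q[OF ev] z[OF ev] sets by simp
  next
    fix j assume "j \<in> {1..length (word M ?p)}"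
    then have ev: "(?p, j) \<in> events M" and j: "j \<noteq> 0" by (auto simp: events_iff)
    show "gap_check (Z j) (A (last_pos M w (?p, j))) (A (first_pos M w' (?p, j) - 1))"
      using p[OF ev] f[OF ev] b[OF ev] sets j by (simp add: Z_def claim_at_def)
  qed
  from certificate_sound[OF this, of "snd e"] e show ?thesis
    by (cases e) (auto simp: Z_def claim_at_def events_iff)
qed

lemma certifies_exists:
  assumes k: "(a, w, w') \<in> indices P \<Sigma>"
  shows "\<exists>f b z. certifies (a, w, w') f b z"
proof -
  let ?p = "last w" and ?q = "hd w"
  let ?F = "\<lambda>i. letter M (?q, i) = a"
  have w: "distinct w" "distinct w'" "w \<noteq> []" "w' \<noteq> []" "hd w' = ?p" "last w' = ?q"
    using k by (auto simp: indices_def)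
  interpret gap_system ?F "length (word M ?p)" "length (word M ?q)"
    "\<lambda>j. last_pos M w (?p, j)" "\<lambda>j. first_pos M w' (?p, j) - 1" "\<lambda>i. last_pos M w' (?q, i)"
    by (rule gap_system[OF k])
  obtain A Z where cert: "certificate A Z" using certificate_exists by blast
  have A0: "A 0 = gap_init" and Z0: "Z 0 = Some False"
    using cert unfolding certificate_def by blast+
  \<comment> \<open>The certificate is pulled back to the events. Reading it off again from
    \<open>f\<close> and \<open>z\<close> yields \<open>A'\<close> and \<open>Z'\<close>, which
    agree with \<open>A\<close> and \<open>Z\<close> on the positions that exist.\<close>
  define f where "f e = A (last_pos M w e)" for e
  define b where "b e = A (first_pos M w' e - 1)" for e
  define z where "z e = Z (last_pos M w' e)" for e
  define A' where "A' = gap_at f ?q"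
  define Z' where "Z' = claim_at z ?p"
  have A': "A' i = A i" if "i \<le> length (word M ?q)" for i
  proof (cases "i = 0")
    case False
    then have "(?q, i) \<in> events M" using that by (simp add: events_iff)
    then show ?thesis using False last_pos_hd[of "(?q, i)" w] by (simp add: A'_def gap_at_def f_def)
  qed (simp add: A'_def gap_at_def A0)
  have Z': "Z' j = Z j" if "j \<le> length (word M ?p)" for j
  proof (cases "j = 0")
    case False
    then have "(?p, j) \<in> events M" using that by (simp add: events_iff)
    then show ?thesis using False last_pos_hd[of "(?p, j)" w'] w by (simp add: Z'_def claim_at_def z_def)
  qed (simp add: Z'_def claim_at_def Z0)
  have "certifies (a, w, w') f b z"
    unfolding certifies_def A'_def[symmetric] Z'_def[symmetric] prod.case
  proof (intro conjI ballI impI)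
    show "forward_ok w A' f"
      unfolding forward_ok_iff[OF w(1)] using A' last_pos_le by (simp add: f_def)
    show "forward_ok w' Z' z"
      unfolding forward_ok_iff[OF w(2)] using Z' last_pos_le[of _ w'] w by (simp add: z_def)
    show "backward_ok w' (\<lambda>i. A' (i - 1)) b"
      unfolding backward_ok_iff[OF w(2)]
    proof (intro ballI impI)
      fix e assume "e \<in> events M"
      then have "first_pos M w' e - 1 \<le> length (word M ?q)" using first_pos_le[of e w'] w by simp
      then show "b e = A' (first_pos M w' e - 1)" using A' by (simp add: b_def)
    qed
  next
    fix e assume e: "e \<in> events M" "fst e = ?q"
    then have i: "snd e \<in> {1..length (word M ?q)}" "e = (?q, snd e)"
      by (cases e; auto simp: events_iff)+
    then have *: "gap_step (?F (snd e)) (A (snd e - 1)) (A (snd e))"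
      "upper_check (?F (snd e)) (A (snd e - 1)) (Z (last_pos M w' (?q, snd e)))"
      using cert unfolding certificate_def by blast+
    have A1: "A' (snd e - 1) = A (snd e - 1)" using i(1) by (intro A') auto
    show "gap_step (letter M e = a) (A' (snd e - 1)) (f e)"
      using * i(2) A1 last_pos_hd[OF e] by (simp add: f_def)
    show "upper_check (letter M e = a) (A' (snd e - 1)) (z e)"
      using * i(2) A1 by (simp add: z_def)
  next
    fix e assume e: "e \<in> events M" "fst e = ?p"
    then have i: "snd e \<in> {1..length (word M ?p)}" "e = (?p, snd e)"
      by (cases e; auto simp: events_iff)+
    then have "gap_check (Z (snd e)) (A (last_pos M w (?p, snd e)))
        (A (first_pos M w' (?p, snd e) - 1))"
      using cert unfolding certificate_def by blast
    then show "gap_check (z e) (f e) (b e)"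
      using i(2) last_pos_hd[of e w'] e w by (simp add: z_def f_def b_def)
  qed
  then show ?thesis by blast
qed

end

section \<open>Labels in the strict future\<close>

text \<open>
  The flag \<open>True\<close> tells that a label occurs at two distinct points, one of which reaches the
  other; membership of the label with flag \<open>False\<close> at a point that carries this label detects
  the second occurrence.
\<close>

definition reach_labels :: "'e rel \<Rightarrow> ('e \<Rightarrow> 'l) \<Rightarrow> 'e \<Rightarrow> ('l \<times> bool) set" where
  "reach_labels r lab e = {(lab f, False) | f. (e, f) \<in> r\<^sup>+} \<union>
     {(lab f, True) | f f'. (e, f) \<in> r\<^sup>+ \<and> (f, f') \<in> r\<^sup>+ \<and> lab f' = lab f}"

definition add_label :: "'l \<Rightarrow> ('l \<times> bool) set \<Rightarrow> ('l \<times> bool) set" where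
  "add_label l S = insert (l, False) (if (l, False) \<in> S then insert (l, True) S else S)"

lemma reach_labels_unfold:
  "reach_labels r lab e = (\<Union>f\<in>r `` {e}. add_label (lab f) (reach_labels r lab f))"
proof (intro equalityI subsetI)
  fix y assume "y \<in> reach_labels r lab e"
  then obtain f where f: "(e, f) \<in> r\<^sup>+"
    "y = (lab f, False) \<or> y = (lab f, True) \<and> (\<exists>f'. (f, f') \<in> r\<^sup>+ \<and> lab f' = lab f)"
    unfolding reach_labels_def by blast
  from f(1) obtain g where g: "(e, g) \<in> r" "g = f \<or> (g, f) \<in> r\<^sup>+"
    using tranclD[OF f(1)] by (auto simp: rtrancl_eq_or_trancl)
  have "y \<in> add_label (lab g) (reach_labels r lab g)"
  proof (cases "g = f")
    case True
    have "(lab f, False) \<in> reach_labels r lab f" if "(f, f') \<in> r\<^sup>+" "lab f' = lab f" for f'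
      using that unfolding reach_labels_def by (intro UnI1 CollectI exI[of _ f']) simp
    then show ?thesis using f(2) True by (auto simp: add_label_def)
  next
    case False
    then have "y \<in> reach_labels r lab g" using f g unfolding reach_labels_def by blast
    then show ?thesis by (auto simp: add_label_def)
  qed
  then show "y \<in> (\<Union>f\<in>r `` {e}. add_label (lab f) (reach_labels r lab f))" using g by blast
next
  fix y assume "y \<in> (\<Union>f\<in>r `` {e}. add_label (lab f) (reach_labels r lab f))"
  then obtain f where f: "(e, f) \<in> r" "y \<in> add_label (lab f) (reach_labels r lab f)" by blast
  have "(lab f, False) \<in> reach_labels r lab e" using f(1) unfolding reach_labels_def by blast
  moreover have "(lab f, True) \<in> reach_labels r lab e"
    if "(lab f, False) \<in> reach_labels r lab f"
  proof -
    from that obtain f' where "(f, f') \<in> r\<^sup>+" "lab f' = lab f" unfolding reach_labels_def by auto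
    then show ?thesis using f(1) unfolding reach_labels_def by blast
  qed
  moreover have "reach_labels r lab f \<subseteq> reach_labels r lab e"
    using trancl_into_trancl2[OF f(1)] unfolding reach_labels_def by blast
  ultimately show "y \<in> reach_labels r lab e" using f(2) by (auto simp: add_label_def split: if_splits)
qed

text \<open>Well-foundedness excludes solutions that support themselves around a cycle, so a guessed
  annotation that satisfies the equation cannot invent labels.\<close>

lemma reach_labels_unique:
  assumes wf: "wf (r\<inverse>)" and r: "r \<subseteq> E \<times> E"
    and v: "\<And>e. e \<in> E \<Longrightarrow> v e = (\<Union>f\<in>r `` {e}. add_label (lab f) (v f))"
  shows "e \<in> E \<Longrightarrow> v e = reach_labels r lab e"
  using wf
proof (induction e rule: wf_induct_rule)
  case (less e)
  have "v e = (\<Union>f\<in>r `` {e}. add_label (lab f) (v f))" using v less.prems .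
  also have "\<dots> = (\<Union>f\<in>r `` {e}. add_label (lab f) (reach_labels r lab f))"
    using less.IH r by (intro SUP_cong) auto
  finally show ?case by (simp add: reach_labels_unfold[of r lab e])
qed

text \<open>If no direct successor carries \<open>l\<close>, every occurrence of \<open>l\<close> is
  far. If one does, \<open>unique\<close> makes it the only one, so a far occurrence is a second
  occurrence, and \<open>total\<close> makes the two comparable, as the flag \<open>True\<close>
  demands.\<close>

lemma labels_of_non_edges:
  assumes acyclic: "acyclic r"
    and unique: "\<And>f f'. (e, f) \<in> r \<Longrightarrow> (e, f') \<in> r \<Longrightarrow> lab f = lab f' \<Longrightarrow> f = f'"
    and total: "\<And>f f'. (e, f) \<in> r\<^sup>+ \<Longrightarrow> (e, f') \<in> r\<^sup>+ \<Longrightarrow> lab f = lab f' \<Longrightarrow> f \<noteq> f' \<Longrightarrow>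
      (f, f') \<in> r\<^sup>+ \<or> (f', f) \<in> r\<^sup>+"
  shows "{lab f | f. (e, f) \<in> r\<^sup>+ - r} =
    {l. (l, l \<in> lab ` (r `` {e})) \<in> reach_labels r lab e}"
proof (intro set_eqI iffI)
  fix l assume "l \<in> {lab f | f. (e, f) \<in> r\<^sup>+ - r}"
  then obtain f where f: "(e, f) \<in> r\<^sup>+" "(e, f) \<notin> r" "l = lab f" by blast
  show "l \<in> {l. (l, l \<in> lab ` (r `` {e})) \<in> reach_labels r lab e}"
  proof (cases "l \<in> lab ` (r `` {e})")
    case True
    then obtain g where g: "(e, g) \<in> r" "lab g = l" by auto
    have "f \<noteq> g" using f g by blast
    then have "(f, g) \<in> r\<^sup>+ \<or> (g, f) \<in> r\<^sup>+"
      using total[OF f(1) r_into_trancl[OF g(1)]] f(3) g(2) by simp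
    then have "(l, True) \<in> reach_labels r lab e"
    proof
      assume "(f, g) \<in> r\<^sup>+"
      then show ?thesis unfolding reach_labels_def using f(1,3) g(2)
        by (intro UnI2 CollectI exI[of _ f] exI[of _ g]) simp
    next
      assume "(g, f) \<in> r\<^sup>+"
      then show ?thesis unfolding reach_labels_def using f(3) g
        by (intro UnI2 CollectI exI[of _ g] exI[of _ f]) auto
    qed
    then show ?thesis using True by simp
  next
    case False
    have "(l, False) \<in> reach_labels r lab e"
      unfolding reach_labels_def using f(1,3) by (intro UnI1 CollectI exI[of _ f]) simp
    then show ?thesis using False by simp
  qed
next
  fix l assume l: "l \<in> {l. (l, l \<in> lab ` (r `` {e})) \<in> reach_labels r lab e}"
  have "\<exists>f. lab f = l \<and> (e, f) \<in> r\<^sup>+ \<and> (e, f) \<notin> r"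
  proof (cases "l \<in> lab ` (r `` {e})")
    case True
    then obtain f f' where f: "(e, f) \<in> r\<^sup>+" "(f, f') \<in> r\<^sup>+" "lab f = l" "lab f' = l"
      using l unfolding reach_labels_def by auto
    have "f \<noteq> f'" using acyclic f(2) unfolding acyclic_def by metis
    \<comment> \<open>Equally labelled direct successors coincide, so one of the two occurrences is
      far.\<close>
    then have "(e, f) \<notin> r \<or> (e, f') \<notin> r" using unique f(3,4) by metis
    moreover have "(e, f') \<in> r\<^sup>+" using f(1,2) by (rule trancl_trans)
    ultimately show ?thesis using f(1,3,4) by metis
  next
    case False
    then obtain f where "(e, f) \<in> r\<^sup>+" "lab f = l" using l unfolding reach_labels_def by auto
    moreover have "(e, f) \<notin> r" using False \<open>lab f = l\<close> by auto
    ultimately show ?thesis by metis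
  qed
  then show "l \<in> {lab f | f. (e, f) \<in> r\<^sup>+ - r}" by auto
qed

section \<open>Local annotations\<close>

text \<open>
  \<open>ok0\<close> compares an annotation with the one of the preceding event of the process, \<open>okR\<close> with the
  one of the sender, and \<open>okF\<close> sees the last annotation of every process.
\<close>

definition annotates ::
  "('x \<Rightarrow> 'b) \<Rightarrow> ('p \<Rightarrow> 'x option \<Rightarrow> 'x \<Rightarrow> bool) \<Rightarrow> ('p \<Rightarrow> 'x \<Rightarrow> bool) \<Rightarrow>
   ('p \<Rightarrow> 'p \<Rightarrow> 'x \<Rightarrow> bool) \<Rightarrow> ('p \<Rightarrow> 'p \<Rightarrow> 'x \<Rightarrow> 'x \<Rightarrow> bool) \<Rightarrow> (('p \<Rightarrow> 'x option) \<Rightarrow> bool) \<Rightarrow>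
   'x set \<Rightarrow> ('p, 'b) msc \<Rightarrow> ('p event \<Rightarrow> 'x) \<Rightarrow> bool" where
  "annotates lt ok0 okI okS okR okF X M x \<longleftrightarrow>
     (\<forall>e\<in>events M. x e \<in> X \<and> lt (x e) = letter M e \<and>
        ok0 (fst e) (if snd e = 1 then None else Some (x (fst e, snd e - 1))) (x e)) \<and>
     (\<forall>e\<in>events M - Field (msg M). okI (fst e) (x e)) \<and>
     (\<forall>(e, f)\<in>msg M. okS (fst e) (fst f) (x e) \<and> okR (fst e) (fst f) (x e) (x f)) \<and>
     okF (\<lambda>p. if word M p = [] then None else Some (x (p, length (word M p))))"

text \<open>
  The state of a process is the annotation of its last event, and a message carries the
  annotation of its sender.
\<close>

lemma local_cfm:
  fixes lt :: "'x \<Rightarrow> 'b" and P :: "'p set"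
  assumes P: "finite P" and X: "finite X" and lt: "\<And>x. x \<in> X \<Longrightarrow> lt x \<in> S"
  shows "\<exists>A :: ('p, 'b, nat, nat) cfm. is_cfm P S A \<and> (\<forall>p\<in>P. card (states A p) \<le> Suc (card X)) \<and>
    language P S A = {M \<in> MSC P S. \<exists>x. annotates lt ok0 okI okS okR okF X M x}"
proof -
  \<comment> \<open>\<open>None\<close> is the state before the first event and accounts for the
    \<open>Suc\<close> in the bound.\<close>
  define D where "D = insert None (Some ` X)"
  have D: "finite D" "card D = Suc (card X)" using X by (auto simp: D_def card_image)
  obtain enc :: "'x option \<Rightarrow> nat" where enc: "inj_on enc D"
    using finite_imp_inj_to_nat_seg[OF D(1)] by blast
  define dec where "dec = the_inv_into D enc"
  have dec: "s \<in> D \<Longrightarrow> dec (enc s) = s" for s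
    unfolding dec_def by (rule the_inv_into_f_f[OF enc])
  have enc_eq: "s \<in> D \<Longrightarrow> s' \<in> D \<Longrightarrow> enc s = enc s' \<longleftrightarrow> s = s'" for s s'
    using enc by (auto dest: inj_onD)
  have SomeD: "Some x \<in> D \<longleftrightarrow> x \<in> X" for x by (auto simp: D_def)
  have NoneD: "None \<in> D" by (simp add: D_def)
  define TI :: "'p \<Rightarrow> ('p, 'b, nat, nat) transition set" where
    "TI p = {(enc s, Internal (lt x), enc (Some x)) | s x.
       s \<in> D \<and> x \<in> X \<and> ok0 p s x \<and> okI p x}" for p
  define TS :: "'p \<Rightarrow> ('p, 'b, nat, nat) transition set" where
    "TS p = {(enc s, Send (lt x) (enc (Some x)) q, enc (Some x)) | s x q.
       s \<in> D \<and> x \<in> X \<and> ok0 p s x \<and> q \<in> P - {p} \<and> okS p q x}" for p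
  \<comment> \<open>The annotation \<open>m\<close> is arbitrary here; equality of message contents
    in a run identifies it with that of the sender.\<close>
  define TR :: "'p \<Rightarrow> ('p, 'b, nat, nat) transition set" where
    "TR p = {(enc s, Recv (lt x) (enc (Some m)) q, enc (Some x)) | s x m q.
       s \<in> D \<and> x \<in> X \<and> ok0 p s x \<and> m \<in> X \<and> q \<in> P - {p} \<and> okR q p m x}" for p
  \<comment> \<open>Acceptance looks at the global final state, so \<open>okF\<close> may relate the
    last annotations of different processes.\<close>
  define A :: "('p, 'b, nat, nat) cfm" where
    "A = \<lparr>states = \<lambda>_. enc ` D, init = \<lambda>_. enc None, trans_of = \<lambda>p. TI p \<union> TS p \<union> TR p,
       messages = (\<lambda>x. enc (Some x)) ` X,
       acc = {\<sigma> \<in> \<Pi>\<^sub>E p\<in>P. enc ` D. okF (\<lambda>p. if p \<in> P then dec (\<sigma> p) else None)}\<rparr>"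
  have accA: "acc A = {\<sigma> \<in> \<Pi>\<^sub>E p\<in>P. enc ` D. okF (\<lambda>p. if p \<in> P then dec (\<sigma> p) else None)}"
    by (simp add: A_def)
  have "is_cfm P S A"
    using D X lt by (auto simp: is_cfm_def A_def TI_def TS_def TR_def actions_def D_def)
  moreover have "card (states A p) \<le> Suc (card X)" for p
    using card_image_le[OF D(1), of enc] D by (simp add: A_def)
  moreover have "\<exists>x. annotates lt ok0 okI okS okR okF X M x"
    if M: "M \<in> MSC P S" and run: "is_run A M \<rho>" and acc: "final_state P A M \<rho> \<in> acc A" for M \<rho>
  proof -
    interpret chart P S M using P M by unfold_locales
    define x where "x e = the (dec (target (\<rho> e)))" for e
    define prev where "prev e = (if snd e = 1 then None else Some (x (fst e, snd e - 1)))"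
      for e :: "'p event"
    have trans: "\<rho> e \<in> TI (fst e) \<union> TS (fst e) \<union> TR (fst e)"
      and lets: "act_letter (act (\<rho> e)) = letter M e" if "e \<in> events M" for e
      using run that by (auto simp: is_run_def A_def)
    have tgt: "x e \<in> X \<and> target (\<rho> e) = enc (Some (x e))" if "e \<in> events M" for e
      using trans[OF that] by (auto simp: x_def TI_def TS_def TR_def target_def dec SomeD)
    have srce: "source (\<rho> e) = enc (prev e) \<and> prev e \<in> D" if e: "e \<in> events M" for e
    proof (cases "snd e = 1")
      case True
      then have "e = (fst e, 1)" by (simp add: prod_eq_iff)
      then have "source (\<rho> e) = init A (fst e)" using run e unfolding is_run_def by metis
      then show ?thesis using True by (simp add: A_def prev_def NoneD)
    next
      case False
      then have *: "((fst e, snd e - 1), e) \<in> proc_rel M" using e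
        by (cases e) (auto simp: proc_rel_iff events_iff)
      then have "target (\<rho> (fst e, snd e - 1)) = source (\<rho> e)"
        using run unfolding is_run_def by blast
      moreover have "(fst e, snd e - 1) \<in> events M" using * by (simp add: proc_rel_iff)
      ultimately show ?thesis using tgt[of "(fst e, snd e - 1)"] False by (simp add: prev_def SomeD)
    qed
    have TI: "lt (x e) = a \<and> ok0 (fst e) (prev e) (x e) \<and> okI (fst e) (x e)"
      if "e \<in> events M" "act (\<rho> e) = Internal a" for e a
      using trans[OF that(1)] that(2) tgt[OF that(1)] srce[OF that(1)]
      by (auto simp: TI_def TS_def TR_def act_def target_def source_def enc_eq SomeD)
    have TS: "lt (x e) = a \<and> ok0 (fst e) (prev e) (x e) \<and> okS (fst e) q (x e) \<and> m = enc (Some (x e))"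
      if "e \<in> events M" "act (\<rho> e) = Send a m q" for e a m q
      using trans[OF that(1)] that(2) tgt[OF that(1)] srce[OF that(1)]
      by (auto simp: TI_def TS_def TR_def act_def target_def source_def enc_eq SomeD)
    have TR: "lt (x e) = a \<and> ok0 (fst e) (prev e) (x e) \<and>
        (\<exists>y\<in>X. m = enc (Some y) \<and> okR q (fst e) y (x e))"
      if "e \<in> events M" "act (\<rho> e) = Recv a m q" for e a m q
      using trans[OF that(1)] that(2) tgt[OF that(1)] srce[OF that(1)]
      by (auto simp: TI_def TS_def TR_def act_def target_def source_def enc_eq SomeD)
    have "okF (\<lambda>p. if p \<in> P then dec (final_state P A M \<rho> p) else None)"
      using acc unfolding accA by blast
    also have "(\<lambda>p. if p \<in> P then dec (final_state P A M \<rho> p) else None) =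
        (\<lambda>p. if word M p = [] then None else Some (x (p, length (word M p))))"
    proof
      fix p
      show "(if p \<in> P then dec (final_state P A M \<rho> p) else None) =
        (if word M p = [] then None else Some (x (p, length (word M p))))"
      proof (cases "word M p = []")
        case True
        then show ?thesis by (simp add: final_state_def A_def dec NoneD)
      next
        case False
        then have ev: "(p, length (word M p)) \<in> events M" by (simp add: events_iff Suc_le_eq)
        then have "p \<in> P" using event_process by force
        then show ?thesis using False tgt[OF ev] by (simp add: final_state_def dec SomeD)
      qed
    qed
    finally have "okF (\<lambda>p. if word M p = [] then None else Some (x (p, length (word M p))))" .
    moreover have "x e \<in> X \<and> lt (x e) = letter M e \<and> ok0 (fst e) (prev e) (x e)"
      if e: "e \<in> events M" for e
      using TI[OF e] TS[OF e] TR[OF e] tgt[OF e] lets[OF e] by (cases "act (\<rho> e)") auto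
    moreover have "okI (fst e) (x e)" if "e \<in> events M - Field (msg M)" for e
      using run that TI[of e] unfolding is_run_def by blast
    moreover have "okS (fst e) (fst f) (x e) \<and> okR (fst e) (fst f) (x e) (x f)"
      if ef: "(e, f) \<in> msg M" for e f
    proof -
      obtain a b m where "act (\<rho> e) = Send a m (fst f)" "act (\<rho> f) = Recv b m (fst e)"
        using run ef unfolding is_run_def by blast
      then show ?thesis using TS[of e a m "fst f"] TR[of f b m "fst e"] msg_events[OF ef] tgt[of e]
        by (auto simp: enc_eq SomeD)
    qed
    ultimately have "annotates lt ok0 okI okS okR okF X M x"
      unfolding annotates_def prev_def by blast
    then show ?thesis by blast
  qed
  moreover have "\<exists>\<rho>. is_run A M \<rho> \<and> final_state P A M \<rho> \<in> acc A"
    if M: "M \<in> MSC P S" and x: "annotates lt ok0 okI okS okR okF X M x" for M x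
  proof -
    interpret chart P S M using P M by unfold_locales
    define prev where "prev e = (if snd e = 1 then None else Some (x (fst e, snd e - 1)))"
      for e :: "'p event"
    define action_of :: "'p event \<Rightarrow> ('p, 'b, nat) action" where
      "action_of e =
        (if \<exists>f. (e, f) \<in> msg M then Send (lt (x e)) (enc (Some (x e))) (fst (SOME f. (e, f) \<in> msg M))
         else if \<exists>s. (s, e) \<in> msg M then
           Recv (lt (x e)) (enc (Some (x (SOME s. (s, e) \<in> msg M)))) (fst (SOME s. (s, e) \<in> msg M))
         else Internal (lt (x e)))" for e
    define \<rho> where "\<rho> e = (enc (prev e), action_of e, enc (Some (x e)))" for e
    have xX: "x e \<in> X" "lt (x e) = letter M e" "ok0 (fst e) (prev e) (x e)" if "e \<in> events M" for e
      using x that by (auto simp: annotates_def prev_def)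
    have prevD: "prev e \<in> D" if "e \<in> events M" for e
    proof (cases "snd e = 1")
      case False
      then have "(fst e, snd e - 1) \<in> events M" using that by (cases e) (auto simp: events_iff)
      then show ?thesis using xX False by (simp add: prev_def SomeD)
    qed (simp add: prev_def NoneD)
    have send: "action_of e = Send (lt (x e)) (enc (Some (x e))) (fst f)" if "(e, f) \<in> msg M" for e f
    proof -
      have "(SOME f. (e, f) \<in> msg M) = f" using that msg_unique by (intro some_equality) blast+
      moreover have "\<exists>f. (e, f) \<in> msg M" using that by blast
      ultimately show ?thesis by (simp only: action_of_def if_True)
    qed
    have recv: "action_of f = Recv (lt (x f)) (enc (Some (x e))) (fst e)" if "(e, f) \<in> msg M" for e f
    proof -
      have "(SOME s. (s, f) \<in> msg M) = e" using that msg_unique by (intro some_equality) blast+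
      moreover have "\<not> (\<exists>g. (f, g) \<in> msg M)" using that msg_unique msg_events by metis
      moreover have "\<exists>s. (s, f) \<in> msg M" using that by blast
      ultimately show ?thesis by (simp only: action_of_def if_True if_False)
    qed
    have msg_ok: "okS (fst e) (fst f) (x e)" "okR (fst e) (fst f) (x e) (x f)"
      if "(e, f) \<in> msg M" for e f
      using x that unfolding annotates_def by blast+
    have internal: "action_of e = Internal (lt (x e)) \<and> okI (fst e) (x e)"
      if "e \<in> events M" "e \<notin> Field (msg M)" for e
      using x that by (auto simp: annotates_def action_of_def Field_def)
    have "\<rho> e \<in> trans_of A (fst e) \<and> act_letter (act (\<rho> e)) = letter M e" if e: "e \<in> events M" for e
    proof -
      consider f where "(e, f) \<in> msg M" | s where "(s, e) \<in> msg M" | "e \<notin> Field (msg M)"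
        unfolding Field_def by blast
      then show ?thesis
      proof cases
        case 1
        then have "\<rho> e \<in> TS (fst e)"
          using send[OF 1] e xX[OF e] prevD[OF e] msg_ok[OF 1] msg_events[OF 1] event_process[of f]
          unfolding \<rho>_def TS_def
          by (intro CollectI exI[of _ "prev e"] exI[of _ "x e"] exI[of _ "fst f"]) auto
        then show ?thesis using send[OF 1] xX[OF e] by (simp add: A_def \<rho>_def act_def)
      next
        case 2
        then have "\<rho> e \<in> TR (fst e)"
          using recv[OF 2] e xX[OF e] xX[of s] prevD[OF e] msg_ok[OF 2] msg_events[OF 2]
            event_process[of s]
          unfolding \<rho>_def TR_def
          by (intro CollectI exI[of _ "prev e"] exI[of _ "x e"] exI[of _ "x s"] exI[of _ "fst s"]) auto
        then show ?thesis using recv[OF 2] xX[OF e] by (simp add: A_def \<rho>_def act_def)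
      next
        case 3
        then have "\<rho> e \<in> TI (fst e)"
          using internal[OF e 3] xX[OF e] prevD[OF e] unfolding \<rho>_def TI_def
          by (intro CollectI exI[of _ "prev e"] exI[of _ "x e"]) simp
        then show ?thesis using internal[OF e 3] xX[OF e] by (simp add: A_def \<rho>_def act_def)
      qed
    qed
    moreover have "source (\<rho> (p, 1)) = init A p" for p
      by (simp add: \<rho>_def source_def prev_def A_def)
    moreover have "target (\<rho> e) = source (\<rho> f)" if "(e, f) \<in> proc_rel M" for e f
    proof -
      have "e = (fst f, snd f - 1)" "snd f \<noteq> 1" "snd f \<noteq> 0"
        using that by (auto simp: proc_rel_iff prod_eq_iff events_def)
      then show ?thesis by (simp add: \<rho>_def target_def source_def prev_def)
    qed
    moreover have "\<exists>a. act (\<rho> e) = Internal a" if "e \<in> events M - Field (msg M)" for e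
      using internal[of e] that by (simp add: \<rho>_def act_def)
    moreover have "\<exists>a b m. act (\<rho> e) = Send a m (fst f) \<and> act (\<rho> f) = Recv b m (fst e)"
      if "(e, f) \<in> msg M" for e f
      using send[OF that] recv[OF that] by (simp add: \<rho>_def act_def)
    ultimately have "is_run A M \<rho>" unfolding is_run_def by blast
    moreover have "final_state P A M \<rho> \<in> acc A"
    proof -
      have ev: "(p, length (word M p)) \<in> events M" if "word M p \<noteq> []" for p
        using that by (simp add: events_iff Suc_le_eq)
      have fin: "final_state P A M \<rho> \<in> (\<Pi>\<^sub>E p\<in>P. enc ` D)"
        using xX(1) ev
        by (auto simp: final_state_def A_def \<rho>_def target_def NoneD SomeD intro!: imageI)
      have "(\<lambda>p. if p \<in> P then dec (final_state P A M \<rho> p) else None) =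
        (\<lambda>p. if word M p = [] then None else Some (x (p, length (word M p))))"
      proof
        fix p
        show "(if p \<in> P then dec (final_state P A M \<rho> p) else None) =
          (if word M p = [] then None else Some (x (p, length (word M p))))"
          using xX(1)[OF ev, of p] event_process[OF ev, of p]
          by (auto simp: final_state_def A_def \<rho>_def target_def dec NoneD SomeD)
      qed
      then show ?thesis using fin x unfolding accA annotates_def by simp
    qed
    ultimately show ?thesis by blast
  qed
  ultimately show ?thesis
    by (intro exI[of _ A]) (auto simp: language_def)
qed

text \<open>
  The fields \<open>src\<close> and \<open>dst\<close> are the partners of a receive and a send event. The strict past and
  the strict future of an event are split according to the edge through which they are reached.
\<close>

record ('p, 'a) ann =
  symb :: "'a \<times> (rel_sym \<Rightarrow> ('p \<times> 'a) set)"
  src :: "'p option"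
  dst :: "'p option"
  past_proc :: "(('p \<times> 'a) \<times> bool) set"
  past_msg :: "(('p \<times> 'a) \<times> bool) set"
  fut_proc :: "(('p \<times> 'a) \<times> bool) set"
  fut_msg :: "(('p \<times> 'a) \<times> bool) set"
  fwd :: "('p, 'a) index \<Rightarrow> gap"
  bwd :: "('p, 'a) index \<Rightarrow> gap"
  claim :: "('p, 'a) index \<Rightarrow> bool option"

definition lab :: "'p \<Rightarrow> ('p, 'a) ann \<Rightarrow> 'p \<times> 'a" where
  "lab p x = (p, fst (symb x))"

definition etype :: "('p, 'a) ann \<Rightarrow> rel_sym \<Rightarrow> ('p \<times> 'a) set" where
  "etype x = snd (symb x)"

definition past :: "('p, 'a) ann \<Rightarrow> (('p \<times> 'a) \<times> bool) set" where
  "past x = past_proc x \<union> past_msg x"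

definition fut :: "('p, 'a) ann \<Rightarrow> (('p \<times> 'a) \<times> bool) set" where
  "fut x = fut_proc x \<union> fut_msg x"

text \<open>A backward equation relates an event to its successor, so it is checked one event late,
  on the previous annotation \<open>y'\<close>. On \<open>hd w\<close> the value of
  \<open>bwd\<close> is the gap \<open>g\<close> before the event, which realises the shift by one
  in \<open>certifies\<close>.\<close>

definition cert_ok ::
  "'p \<Rightarrow> ('p, 'a) ann option \<Rightarrow> ('p, 'a) ann \<Rightarrow> ('p, 'a) index \<Rightarrow> bool" where
  "cert_ok p y x k = (case k of (a, w, w') \<Rightarrow>
     let g = (case y of None \<Rightarrow> gap_init | Some y \<Rightarrow> fwd y k);
         c = (case y of None \<Rightarrow> Some False | Some y \<Rightarrow> claim y k)
     in
       (p = hd w \<longrightarrow> gap_step (fst (symb x) = a) g (fwd x k) \<and> bwd x k = g \<and>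
          upper_check (fst (symb x) = a) g (claim x k)) \<and>
       (p = last w \<longrightarrow> gap_check (claim x k) (fwd x k) (bwd x k)) \<and>
       (p \<in> set w \<longrightarrow> p \<noteq> hd w \<longrightarrow> (\<forall>s. src x = Some s \<longrightarrow> \<not> adj w s p) \<longrightarrow> fwd x k = g) \<and>
       (p \<in> set w' \<longrightarrow> p \<noteq> hd w' \<longrightarrow> (\<forall>s. src x = Some s \<longrightarrow> \<not> adj w' s p) \<longrightarrow> claim x k = c) \<and>
       (\<forall>y'. y = Some y' \<longrightarrow> p \<in> set w' \<longrightarrow> p \<noteq> last w' \<longrightarrow>
          (\<forall>s. dst y' = Some s \<longrightarrow> \<not> adj w' p s) \<longrightarrow> bwd y' k = bwd x k))"

definition cert_msg_ok ::
  "'p \<Rightarrow> 'p \<Rightarrow> ('p, 'a) ann \<Rightarrow> ('p, 'a) ann \<Rightarrow> ('p, 'a) index \<Rightarrow> bool" where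
  "cert_msg_ok q p m x k = (case k of (a, w, w') \<Rightarrow>
     (adj w q p \<longrightarrow> fwd x k = fwd m k) \<and>
     (adj w' q p \<longrightarrow> bwd m k = bwd x k \<and> claim x k = claim m k))"

text \<open>The last event of a process may need the end value of the backward transport, the final
  gap of \<open>last w'\<close>. Only the global final state can supply it.\<close>

definition cert_final_ok ::
  "('p \<Rightarrow> ('p, 'a) ann option) \<Rightarrow> ('p, 'a) index \<Rightarrow> bool" where
  "cert_final_ok st k = (case k of (a, w, w') \<Rightarrow>
     \<forall>p x. st p = Some x \<longrightarrow> p \<in> set w' \<longrightarrow> p \<noteq> last w' \<longrightarrow>
       (\<forall>s. dst x = Some s \<longrightarrow> \<not> adj w' p s) \<longrightarrow>
       bwd x k = (case st (last w') of None \<Rightarrow> gap_init | Some y \<Rightarrow> fwd y k))"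

text \<open>Data about the future are guessed and verified at the other end of the edge. Splitting
  past and future lets each half be checked where its edge is visible: the process half here, the
  message half in \<open>receive_ok\<close>.\<close>

definition prev_ok ::
  "'p set \<Rightarrow> 'a set \<Rightarrow> 'p \<Rightarrow> ('p, 'a) ann option \<Rightarrow> ('p, 'a) ann \<Rightarrow> bool" where
  "prev_ok P \<Sigma> p y x \<longleftrightarrow>
     etype x REq = {lab p x} \<and>
     etype x RProcInv = (case y of None \<Rightarrow> {} | Some y \<Rightarrow> {lab p y}) \<and>
     past_proc x = (case y of None \<Rightarrow> {} | Some y \<Rightarrow> add_label (lab p y) (past y)) \<and>
     (\<forall>y'. y = Some y' \<longrightarrow> etype y' RProc = {lab p x} \<and> fut_proc y' = add_label (lab p x) (fut x)) \<and>
     (src x = None \<longrightarrow> etype x RMsgInv = {} \<and> past_msg x = {}) \<and>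
     (dst x = None \<longrightarrow> etype x RMsg = {} \<and> fut_msg x = {}) \<and>
     etype x RFar = {l. (l, l \<in> etype x RProc \<union> etype x RMsg) \<in> fut x} \<and>
     etype x RFarInv = {l. (l, l \<in> etype x RProcInv \<union> etype x RMsgInv) \<in> past x} \<and>
     etype x RPar = {(q, a). q \<in> P \<and> q \<noteq> p \<and> a \<in> \<Sigma> \<and>
       (\<forall>w w'. (a, w, w') \<in> indices P \<Sigma> \<longrightarrow> hd w = q \<longrightarrow> last w = p \<longrightarrow>
          claim x (a, w, w') = None)} \<and>
     (\<forall>k\<in>indices P \<Sigma>. cert_ok p y x k)"

definition internal_ok :: "('p, 'a) ann \<Rightarrow> bool" where
  "internal_ok x \<longleftrightarrow> src x = None \<and> dst x = None"

definition send_ok :: "'p \<Rightarrow> ('p, 'a) ann \<Rightarrow> bool" where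
  "send_ok q x \<longleftrightarrow> src x = None \<and> dst x = Some q"

definition receive_ok ::
  "'p set \<Rightarrow> 'a set \<Rightarrow> 'p \<Rightarrow> 'p \<Rightarrow> ('p, 'a) ann \<Rightarrow> ('p, 'a) ann \<Rightarrow> bool" where
  "receive_ok P \<Sigma> q p m x \<longleftrightarrow>
     src x = Some q \<and> dst x = None \<and>
     etype m RMsg = {lab p x} \<and> etype x RMsgInv = {lab q m} \<and>
     fut_msg m = add_label (lab p x) (fut x) \<and> past_msg x = add_label (lab q m) (past m) \<and>
     (\<forall>k\<in>indices P \<Sigma>. cert_msg_ok q p m x k)"

definition final_ok ::
  "'p set \<Rightarrow> 'a set \<Rightarrow> ('p \<Rightarrow> ('p, 'a) ann option) \<Rightarrow> bool" where
  "final_ok P \<Sigma> st \<longleftrightarrow>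
     (\<forall>p x. st p = Some x \<longrightarrow> etype x RProc = {} \<and> fut_proc x = {}) \<and>
     (\<forall>k\<in>indices P \<Sigma>. cert_final_ok st k)"

context chart
begin

definition prev :: "('p event \<Rightarrow> 'x) \<Rightarrow> 'p event \<Rightarrow> 'x option" where
  "prev x e = (if snd e = 1 then None else Some (x (fst e, snd e - 1)))"

definition final :: "('p event \<Rightarrow> 'x) \<Rightarrow> 'p \<Rightarrow> 'x option" where
  "final x p = (if word M p = [] then None else Some (x (p, length (word M p))))"

lemma event_pair: "e \<in> events M \<Longrightarrow> fst e = p \<Longrightarrow> (p, snd e) = e"
  by (cases e) simp

lemma event_pos: "e \<in> events M \<Longrightarrow> 1 \<le> snd e \<and> snd e \<le> length (word M (fst e))"
  by (cases e) (simp add: events_iff)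

lemma gap_before:
  "(case prev x e of None \<Rightarrow> gap_init | Some y \<Rightarrow> fwd y k) =
    (if snd e = 1 then gap_init else fwd (x (fst e, snd e - 1)) k)"
  by (simp add: prev_def)

lemma claim_before:
  "(case prev x e of None \<Rightarrow> Some False | Some y \<Rightarrow> claim y k) =
    (if snd e = 1 then Some False else claim (x (fst e, snd e - 1)) k)"
  by (simp add: prev_def)

lemma prev_next:
  assumes "e \<in> events M" "snd e \<noteq> length (word M (fst e))"
  shows "(fst e, Suc (snd e)) \<in> events M" "prev x (fst e, Suc (snd e)) = Some (x e)"
  using assms by (cases e; auto simp: prev_def events_iff)+

lemma final_last:
  assumes "e \<in> events M" "snd e = length (word M (fst e))"
  shows "final x (fst e) = Some (x e)"
  using assms by (cases e) (auto simp: final_def events_iff)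

end

text \<open>The partner fields let an annotation decide whether its event has a message edge along a
  given path, which makes the side conditions of \<open>forward_ok\<close> and
  \<open>backward_ok\<close> local.\<close>

locale annotated_chart = chart P \<Sigma> M for P :: "'p set" and \<Sigma> :: "'a set" and M +
  fixes x :: "'p event \<Rightarrow> ('p, 'a) ann"
  assumes src: "\<And>e q. e \<in> events M \<Longrightarrow> src (x e) = Some q \<longleftrightarrow> (\<exists>s. (s, e) \<in> msg M \<and> fst s = q)"
    and dst: "\<And>e q. e \<in> events M \<Longrightarrow> dst (x e) = Some q \<longleftrightarrow> (\<exists>f. (e, f) \<in> msg M \<and> fst f = q)"
    and letters: "\<And>e. e \<in> events M \<Longrightarrow> fst (symb (x e)) = letter M e"
begin

abbreviation no_sender :: "'p list \<Rightarrow> 'p event \<Rightarrow> bool" where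
  "no_sender w e \<equiv> \<nexists>s. (s, e) \<in> msg M \<and> adj w (fst s) (fst e)"

abbreviation no_receiver :: "'p list \<Rightarrow> 'p event \<Rightarrow> bool" where
  "no_receiver w e \<equiv> \<nexists>f. (e, f) \<in> msg M \<and> adj w (fst e) (fst f)"

lemma no_sender: "e \<in> events M \<Longrightarrow>
    (\<forall>s. src (x e) = Some s \<longrightarrow> \<not> adj v s (fst e)) \<longleftrightarrow> no_sender v e"
  using src by metis

lemma no_receiver: "e \<in> events M \<Longrightarrow>
    (\<forall>s. dst (x e) = Some s \<longrightarrow> \<not> adj v (fst e) s) \<longleftrightarrow> no_receiver v e"
  using dst by metis

section \<open>Local checks equivalent to a certificate, for one index\<close>

context
  fixes a w w' k
  assumes k: "(a, w, w') \<in> indices P \<Sigma>" and k_eq: "k = (a, w, w')"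
begin

definition gap_prev :: "'p event \<Rightarrow> gap" where
  "gap_prev e = (if snd e = 1 then gap_init else fwd (x (fst e, snd e - 1)) k)"

definition claim_prev :: "'p event \<Rightarrow> bool option" where
  "claim_prev e = (if snd e = 1 then Some False else claim (x (fst e, snd e - 1)) k)"

lemma cert_ok_iff:
  assumes e: "e \<in> events M"
  shows "cert_ok (fst e) (prev x e) (x e) k \<longleftrightarrow>
    (fst e = hd w \<longrightarrow> gap_step (letter M e = a) (gap_prev e) (fwd (x e) k) \<and>
       bwd (x e) k = gap_prev e \<and> upper_check (letter M e = a) (gap_prev e) (claim (x e) k)) \<and>
    (fst e = last w \<longrightarrow> gap_check (claim (x e) k) (fwd (x e) k) (bwd (x e) k)) \<and>
    (fst e \<in> set w \<longrightarrow> fst e \<noteq> hd w \<longrightarrow> no_sender w e \<longrightarrow> fwd (x e) k = gap_prev e) \<and>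
    (fst e \<in> set w' \<longrightarrow> fst e \<noteq> hd w' \<longrightarrow> no_sender w' e \<longrightarrow> claim (x e) k = claim_prev e) \<and>
    (snd e \<noteq> 1 \<longrightarrow> fst e \<in> set w' \<longrightarrow> fst e \<noteq> last w' \<longrightarrow>
       no_receiver w' (fst e, snd e - 1) \<longrightarrow> bwd (x (fst e, snd e - 1)) k = bwd (x e) k)"
proof -
  have before: "(fst e, snd e - 1) \<in> events M" if "snd e \<noteq> 1"
    using that e by (cases e) (auto simp: events_iff)
  have receiver: "(\<forall>y'. prev x e = Some y' \<longrightarrow> fst e \<in> set w' \<longrightarrow> fst e \<noteq> last w' \<longrightarrow>
      (\<forall>s. dst y' = Some s \<longrightarrow> \<not> adj w' (fst e) s) \<longrightarrow> bwd y' k = bwd (x e) k) \<longleftrightarrow>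
    (snd e \<noteq> 1 \<longrightarrow> fst e \<in> set w' \<longrightarrow> fst e \<noteq> last w' \<longrightarrow>
       no_receiver w' (fst e, snd e - 1) \<longrightarrow> bwd (x (fst e, snd e - 1)) k = bwd (x e) k)"
  proof (cases "snd e = 1")
    case False
    then show ?thesis using no_receiver[OF before[OF False], of w'] by (simp add: prev_def)
  qed (simp add: prev_def)
  have g: "(case prev x e of None \<Rightarrow> gap_init | Some y \<Rightarrow> fwd y k) = gap_prev e"
    "(case prev x e of None \<Rightarrow> Some False | Some y \<Rightarrow> claim y k) = claim_prev e"
    by (simp_all add: gap_before claim_before gap_prev_def claim_prev_def)
  show ?thesis
    unfolding cert_ok_def k_eq prod.case Let_def
    unfolding k_eq[symmetric] g receiver no_sender[OF e] letters[OF e] ..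
qed

lemma gap_prev_hd: "e \<in> events M \<Longrightarrow> fst e = hd w \<Longrightarrow>
    gap_prev e = gap_at (\<lambda>e. fwd (x e) k) (hd w) (snd e - 1)"
  using event_pos[of e] by (auto simp: gap_prev_def gap_at_def)

lemma gap_final: "(case final x (last w') of None \<Rightarrow> gap_init | Some y \<Rightarrow> fwd y k) =
    gap_at (\<lambda>e. fwd (x e) k) (hd w) (length (word M (last w')))"
  using k by (auto simp: final_def gap_at_def indices_def)

lemma certifies_if_local:
  assumes loc: "\<And>e. e \<in> events M \<Longrightarrow> cert_ok (fst e) (prev x e) (x e) k"
    and msg: "\<And>e f. (e, f) \<in> msg M \<Longrightarrow> cert_msg_ok (fst e) (fst f) (x e) (x f) k"
    and fin: "cert_final_ok (final x) k"
  shows "certifies k (\<lambda>e. fwd (x e) k) (\<lambda>e. bwd (x e) k) (\<lambda>e. claim (x e) k)"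
proof -
  note loc = loc[THEN cert_ok_iff[THEN iffD1, rotated]]
  have w: "hd w' = last w" "last w' = hd w" using k by (auto simp: indices_def)
  have m: "adj w (fst e) (fst f) \<Longrightarrow> fwd (x f) k = fwd (x e) k"
    "adj w' (fst e) (fst f) \<Longrightarrow> bwd (x e) k = bwd (x f) k"
    "adj w' (fst e) (fst f) \<Longrightarrow> claim (x f) k = claim (x e) k" if "(e, f) \<in> msg M" for e f
    using msg[OF that] unfolding cert_msg_ok_def k_eq prod.case by blast+
  have "forward_ok w (gap_at (\<lambda>e. fwd (x e) k) (hd w)) (\<lambda>e. fwd (x e) k)"
    unfolding forward_ok_def
  proof (intro ballI impI conjI allI)
    fix e assume e: "e \<in> events M" "fst e \<in> set w"
    show "fwd (x e) k = gap_at (\<lambda>e. fwd (x e) k) (hd w) (snd e)" if "fst e = hd w"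
      using event_pos[OF e(1)] event_pair[OF e(1) that] by (simp add: gap_at_def)
    show "fwd (x e) k = fwd (x s) k" if "(s, e) \<in> msg M" "adj w (fst s) (fst e)" for s
      using m that by blast
    assume "fst e \<noteq> hd w" "no_sender w e"
    then have "fwd (x e) k = gap_prev e" using loc[OF e(1) e(1)] e(2) by blast
    then show "fwd (x e) k = (if snd e = 1 then gap_at (\<lambda>e. fwd (x e) k) (hd w) 0
        else fwd (x (fst e, snd e - 1)) k)"
      by (simp add: gap_prev_def gap_at_def)
  qed
  moreover have "forward_ok w' (claim_at (\<lambda>e. claim (x e) k) (last w)) (\<lambda>e. claim (x e) k)"
    unfolding forward_ok_def
  proof (intro ballI impI conjI allI)
    fix e assume e: "e \<in> events M" "fst e \<in> set w'"
    show "claim (x e) k = claim_at (\<lambda>e. claim (x e) k) (last w) (snd e)" if "fst e = hd w'"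
      using event_pos[OF e(1)] event_pair[OF e(1) that] w by (simp add: claim_at_def)
    show "claim (x e) k = claim (x s) k" if "(s, e) \<in> msg M" "adj w' (fst s) (fst e)" for s
      using m that by blast
    assume "fst e \<noteq> hd w'" "no_sender w' e"
    then have "claim (x e) k = claim_prev e" using loc[OF e(1) e(1)] e(2) by blast
    then show "claim (x e) k = (if snd e = 1 then claim_at (\<lambda>e. claim (x e) k) (last w) 0
        else claim (x (fst e, snd e - 1)) k)"
      by (simp add: claim_prev_def claim_at_def)
  qed
  moreover have "backward_ok w' (\<lambda>i. gap_at (\<lambda>e. fwd (x e) k) (hd w) (i - 1)) (\<lambda>e. bwd (x e) k)"
    unfolding backward_ok_def
  proof (intro ballI impI conjI allI)
    fix e assume e: "e \<in> events M" "fst e \<in> set w'"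
    show "bwd (x e) k = gap_at (\<lambda>e. fwd (x e) k) (hd w) (snd e - 1)" if "fst e = last w'"
      using loc[OF e(1) e(1)] gap_prev_hd[OF e(1)] w that by simp
    show "bwd (x e) k = bwd (x f) k" if "(e, f) \<in> msg M" "adj w' (fst e) (fst f)" for f
      using m that by blast
    assume no: "fst e \<noteq> last w'" "no_receiver w' e"
    \<comment> \<open>At the last event of a process the final condition gives the equation;
      elsewhere the next event has checked it.\<close>
    show "bwd (x e) k = (if snd e = length (word M (fst e))
        then gap_at (\<lambda>e. fwd (x e) k) (hd w) (Suc (length (word M (last w'))) - 1)
        else bwd (x (fst e, Suc (snd e))) k)"
    proof (cases "snd e = length (word M (fst e))")
      case True
      then show ?thesis
        using fin final_last[OF e(1) True, of x] no(1) e(2) no_receiver[OF e(1), of w'] no(2) gap_final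
        unfolding cert_final_ok_def k_eq prod.case
        unfolding k_eq[symmetric] by simp
    next
      case False
      then show ?thesis
        using loc[OF prev_next(1)[OF e(1) False] prev_next(1)[OF e(1) False]] no e(2) event_pos[OF e(1)] by simp
    qed
  qed
  moreover have "gap_step (letter M e = a) (gap_at (\<lambda>e. fwd (x e) k) (hd w) (snd e - 1)) (fwd (x e) k) \<and>
      upper_check (letter M e = a) (gap_at (\<lambda>e. fwd (x e) k) (hd w) (snd e - 1)) (claim (x e) k)"
    if "e \<in> events M" "fst e = hd w" for e
    using loc[OF that(1) that(1)] gap_prev_hd[OF that] that(2) by simp
  moreover have "gap_check (claim (x e) k) (fwd (x e) k) (bwd (x e) k)"
    if "e \<in> events M" "fst e = last w" for e
    using loc[OF that(1) that(1)] that(2) by blast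
  ultimately show ?thesis unfolding certifies_def k_eq prod.case by blast
qed

lemma local_if_certifies:
  assumes cert: "certifies k (\<lambda>e. fwd (x e) k) (\<lambda>e. bwd (x e) k) (\<lambda>e. claim (x e) k)"
  shows "e \<in> events M \<Longrightarrow> cert_ok (fst e) (prev x e) (x e) k"
    and "(e, f) \<in> msg M \<Longrightarrow> cert_msg_ok (fst e) (fst f) (x e) (x f) k"
    and "cert_final_ok (final x) k"
proof -
  have w: "hd w' = last w" "last w' = hd w" "hd w \<in> set w'" using k by (auto simp: indices_def)
  have fw: "forward_ok w (gap_at (\<lambda>e. fwd (x e) k) (hd w)) (\<lambda>e. fwd (x e) k)"
    and bw: "backward_ok w' (\<lambda>i. gap_at (\<lambda>e. fwd (x e) k) (hd w) (i - 1)) (\<lambda>e. bwd (x e) k)"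
    and cl: "forward_ok w' (claim_at (\<lambda>e. claim (x e) k) (last w)) (\<lambda>e. claim (x e) k)"
    and q: "\<And>e. e \<in> events M \<Longrightarrow> fst e = hd w \<Longrightarrow>
      gap_step (letter M e = a) (gap_at (\<lambda>e. fwd (x e) k) (hd w) (snd e - 1)) (fwd (x e) k) \<and>
      upper_check (letter M e = a) (gap_at (\<lambda>e. fwd (x e) k) (hd w) (snd e - 1)) (claim (x e) k)"
    and p: "\<And>e. e \<in> events M \<Longrightarrow> fst e = last w \<Longrightarrow>
      gap_check (claim (x e) k) (fwd (x e) k) (bwd (x e) k)"
    using cert unfolding certifies_def k_eq prod.case by blast+
  show "cert_msg_ok (fst e) (fst f) (x e) (x f) k" if ef: "(e, f) \<in> msg M" for e f
    unfolding cert_msg_ok_def k_eq prod.case unfolding k_eq[symmetric]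
  proof (intro conjI impI)
    show "fwd (x f) k = fwd (x e) k" if "adj w (fst e) (fst f)"
      using fw ef that msg_events[OF ef] adj_set[OF that] unfolding forward_ok_def by blast
    show "bwd (x e) k = bwd (x f) k" if "adj w' (fst e) (fst f)"
      using bw ef that msg_events[OF ef] adj_set[OF that] unfolding backward_ok_def by blast
    show "claim (x f) k = claim (x e) k" if "adj w' (fst e) (fst f)"
      using cl ef that msg_events[OF ef] adj_set[OF that] unfolding forward_ok_def by blast
  qed
  show "cert_ok (fst e) (prev x e) (x e) k" if e: "e \<in> events M" for e
    unfolding cert_ok_iff[OF e]
  proof (intro conjI impI)
    show "gap_step (letter M e = a) (gap_prev e) (fwd (x e) k)" if "fst e = hd w"
      using q[OF e that] gap_prev_hd[OF e that] by simp
    show "upper_check (letter M e = a) (gap_prev e) (claim (x e) k)" if "fst e = hd w"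
      using q[OF e that] gap_prev_hd[OF e that] by simp
    show "bwd (x e) k = gap_prev e" if "fst e = hd w"
      using bw e that w gap_prev_hd[OF e that] unfolding backward_ok_def by simp
    show "gap_check (claim (x e) k) (fwd (x e) k) (bwd (x e) k)" if "fst e = last w"
      using p[OF e that] .
    show "fwd (x e) k = gap_prev e" if "fst e \<in> set w" "fst e \<noteq> hd w" "no_sender w e"
    proof -
      have "fwd (x e) k = (if snd e = 1 then gap_at (\<lambda>e. fwd (x e) k) (hd w) 0
          else fwd (x (fst e, snd e - 1)) k)"
        using fw e that unfolding forward_ok_def by blast
      then show ?thesis by (simp add: gap_prev_def gap_at_def)
    qed
    show "claim (x e) k = claim_prev e" if "fst e \<in> set w'" "fst e \<noteq> hd w'" "no_sender w' e"
    proof -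
      have "claim (x e) k = (if snd e = 1 then claim_at (\<lambda>e. claim (x e) k) (last w) 0
          else claim (x (fst e, snd e - 1)) k)"
        using cl e that unfolding forward_ok_def by blast
      then show ?thesis by (simp add: claim_prev_def claim_at_def)
    qed
    show "bwd (x (fst e, snd e - 1)) k = bwd (x e) k"
      if *: "snd e \<noteq> 1" "fst e \<in> set w'" "fst e \<noteq> last w'" "no_receiver w' (fst e, snd e - 1)"
    proof -
      let ?d = "(fst e, snd e - 1)"
      have d: "?d \<in> events M" "snd ?d \<noteq> length (word M (fst ?d))" "Suc (snd ?d) = snd e"
        using *(1) e by (cases e; auto simp: events_iff)+
      have "bwd (x ?d) k = (if snd ?d = length (word M (fst ?d))
          then gap_at (\<lambda>e. fwd (x e) k) (hd w) (Suc (length (word M (last w'))) - 1)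
          else bwd (x (fst ?d, Suc (snd ?d))) k)"
        using bw d(1) *(2-) unfolding backward_ok_def by (metis (no_types, lifting) fst_conv)
      then show ?thesis using d(2,3) by (simp only: if_False fst_conv prod.collapse)
    qed
  qed
  show "cert_final_ok (final x) k"
    unfolding cert_final_ok_def k_eq prod.case unfolding k_eq[symmetric] gap_final
  proof (intro allI impI)
    fix p y assume y: "final x p = Some y" and p: "p \<in> set w'" "p \<noteq> last w'"
      and no: "\<forall>s. dst y = Some s \<longrightarrow> \<not> adj w' p s"
    let ?e = "(p, length (word M p))"
    have e: "?e \<in> events M" "y = x ?e"
      using y by (auto simp: final_def events_iff Suc_le_eq split: if_splits)
    then have "no_receiver w' ?e" using no no_receiver[OF e(1), of w'] by simp
    then have "bwd (x ?e) k = (if snd ?e = length (word M (fst ?e))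
          then gap_at (\<lambda>e. fwd (x e) k) (hd w) (Suc (length (word M (last w'))) - 1)
          else bwd (x (fst ?e, Suc (snd ?e))) k)"
      using bw e(1) p unfolding backward_ok_def by (metis (no_types, lifting) fst_conv)
    then show "bwd y k = gap_at (\<lambda>e. fwd (x e) k) (hd w) (length (word M (last w')))"
      using e(2) by simp
  qed
qed

end

end

section \<open>Types expressed by edge images and reachable labels\<close>

context chart
begin

lemma proc_image: "e \<in> events M \<Longrightarrow>
    proc_rel M `` {e} = (if snd e = length (word M (fst e)) then {} else {(fst e, Suc (snd e))})"
  by (cases e) (auto simp: proc_rel_iff events_iff)

lemma proc_converse_image: "e \<in> events M \<Longrightarrow>
    (proc_rel M)\<inverse> `` {e} = (if snd e = 1 then {} else {(fst e, snd e - 1)})"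
  by (cases e) (auto simp: proc_rel_iff events_iff)

lemma msg_image: "(e, f) \<in> msg M \<Longrightarrow> msg M `` {e} = {f}"
  using msg_unique by blast

lemma msg_converse_image: "(e, f) \<in> msg M \<Longrightarrow> (msg M)\<inverse> `` {f} = {e}"
  using msg_unique by blast

lemma edges_trancl_events: "(e, f) \<in> (edges M)\<^sup>+ \<Longrightarrow> e \<in> events M \<and> f \<in> events M"
  by (induction rule: trancl_induct) (auto dest: edges_events)

lemma rel_of_events: "(e, f) \<in> rel_of M r \<Longrightarrow> f \<in> events M"
  using edges_trancl_events[of e f] edges_trancl_events[of f e] msg_events[of e f] msg_events[of f e]
  by (cases r) (auto simp: proc_rel_iff parallel_def far_below_def)

lemma type_at_image: "type_at M e r = label M ` (rel_of M r `` {e})"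
  using rel_of_events unfolding type_at_def by blast

lemma edges_image: "edges M `` {e} = proc_rel M `` {e} \<union> msg M `` {e}"
  and edges_converse_image: "(edges M)\<inverse> `` {e} = (proc_rel M)\<inverse> `` {e} \<union> (msg M)\<inverse> `` {e}"
  by (auto simp: edges_def)

lemma same_process_trancl:
  assumes "e \<in> events M" "f \<in> events M" "fst e = fst f" "e \<noteq> f"
  shows "(e, f) \<in> (edges M)\<^sup>+ \<or> (f, e) \<in> (edges M)\<^sup>+"
proof -
  have "(e, f) \<in> (edges M)\<^sup>* \<or> (f, e) \<in> (edges M)\<^sup>*"
    using same_process_le[of e f] same_process_le[of f e] assms by auto
  then show ?thesis using assms(4) by (auto simp: rtrancl_eq_or_trancl)
qed

lemma type_far:
  "type_at M e RFar = {l. (l, l \<in> type_at M e RProc \<union> type_at M e RMsg) \<in>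
     reach_labels (edges M) (label M) e}"
proof -
  have "label M ` (edges M `` {e}) = type_at M e RProc \<union> type_at M e RMsg"
    by (simp add: type_at_image edges_image image_Un)
  moreover have "type_at M e RFar = {label M f | f. (e, f) \<in> (edges M)\<^sup>+ - edges M}"
    unfolding type_at_image by (auto simp: far_below_def)
  moreover have "\<dots> = {l. (l, l \<in> label M ` (edges M `` {e})) \<in> reach_labels (edges M) (label M) e}"
  proof (rule labels_of_non_edges[OF acyclic])
    \<comment> \<open>A label contains the process, and the process successor and the message
      partner of an event lie on different processes. For the same reason equally labelled events
      are comparable.\<close>
    show "f = f'" if "(e, f) \<in> edges M" "(e, f') \<in> edges M" "label M f = label M f'" for f f'
      using that msg_unique[of e f e f'] msg_events[of e f] msg_events[of e f']
      by (auto simp: edges_def proc_rel_iff label_def prod_eq_iff)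
    show "(f, f') \<in> (edges M)\<^sup>+ \<or> (f', f) \<in> (edges M)\<^sup>+"
      if "(e, f) \<in> (edges M)\<^sup>+" "(e, f') \<in> (edges M)\<^sup>+" "label M f = label M f'" "f \<noteq> f'" for f f'
      using that edges_trancl_events[of e f] edges_trancl_events[of e f']
      by (intro same_process_trancl) (auto simp: label_def)
  qed
  ultimately show ?thesis by simp
qed

lemma type_far_inv:
  "type_at M e RFarInv = {l. (l, l \<in> type_at M e RProcInv \<union> type_at M e RMsgInv) \<in>
     reach_labels ((edges M)\<inverse>) (label M) e}"
proof -
  have "label M ` ((edges M)\<inverse> `` {e}) = type_at M e RProcInv \<union> type_at M e RMsgInv"
    by (simp add: type_at_image edges_converse_image image_Un)
  moreover have "type_at M e RFarInv = {label M f | f. (e, f) \<in> ((edges M)\<inverse>)\<^sup>+ - (edges M)\<inverse>}"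
    unfolding type_at_image by (auto simp: far_below_def trancl_converse)
  moreover have "\<dots> = {l. (l, l \<in> label M ` ((edges M)\<inverse> `` {e})) \<in>
      reach_labels ((edges M)\<inverse>) (label M) e}"
  proof (rule labels_of_non_edges)
    show "acyclic ((edges M)\<inverse>)" using acyclic by simp
    show "f = f'" if "(e, f) \<in> (edges M)\<inverse>" "(e, f') \<in> (edges M)\<inverse>" "label M f = label M f'" for f f'
      using that msg_unique[of f e f' e] msg_events[of f e] msg_events[of f' e]
      by (auto simp: edges_def proc_rel_iff label_def prod_eq_iff)
    show "(f, f') \<in> ((edges M)\<inverse>)\<^sup>+ \<or> (f', f) \<in> ((edges M)\<inverse>)\<^sup>+"
      if "(e, f) \<in> ((edges M)\<inverse>)\<^sup>+" "(e, f') \<in> ((edges M)\<inverse>)\<^sup>+" "label M f = label M f'" "f \<noteq> f'"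
      for f f'
      using that edges_trancl_events[of f e] edges_trancl_events[of f' e] same_process_trancl[of f f']
      by (auto simp: label_def trancl_converse)
  qed
  ultimately show ?thesis by simp
qed

lemma type_par:
  assumes e: "e \<in> events M"
  shows "type_at M e RPar = {(q, a). q \<in> P \<and> q \<noteq> fst e \<and> a \<in> \<Sigma> \<and>
    (\<forall>w w'. (a, w, w') \<in> indices P \<Sigma> \<longrightarrow> hd w = q \<longrightarrow> last w = fst e \<longrightarrow>
       (\<exists>i. last_pos M w e < i \<and> i \<le> first_pos M w' e - 1 \<and> letter M (q, i) = a))}"
proof -
  have mem_iff: "(q, a) \<in> type_at M e RPar \<longleftrightarrow> q \<in> P \<and> q \<noteq> fst e \<and> a \<in> \<Sigma> \<and>
      (\<exists>f\<in>events M. label M f = (q, a) \<and> (e, f) \<in> parallel M)" for q a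
  proof
    assume "(q, a) \<in> type_at M e RPar"
    then obtain f where f: "f \<in> events M" "label M f = (q, a)" "(e, f) \<in> parallel M"
      by (auto simp: type_at_def)
    then have "fst f = q" "letter M f = a" by (auto simp: label_def)
    moreover have "fst f \<noteq> fst e"
    proof
      assume "fst f = fst e"
      then have "(e, f) \<in> (edges M)\<^sup>* \<or> (f, e) \<in> (edges M)\<^sup>*"
        using same_process_le[of e f] same_process_le[of f e] e f by auto
      then show False using f(3) by (auto simp: parallel_def)
    qed
    ultimately show "q \<in> P \<and> q \<noteq> fst e \<and> a \<in> \<Sigma> \<and>
        (\<exists>f\<in>events M. label M f = (q, a) \<and> (e, f) \<in> parallel M)"
      using event_process[OF f(1)] letter_in[OF f(1)] f by blast
  next
    assume *: "q \<in> P \<and> q \<noteq> fst e \<and> a \<in> \<Sigma> \<and>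
      (\<exists>f\<in>events M. label M f = (q, a) \<and> (e, f) \<in> parallel M)"
    then obtain f where "f \<in> events M" "label M f = (q, a)" "(e, f) \<in> parallel M" by blast
    then show "(q, a) \<in> type_at M e RPar"
      unfolding type_at_def by (intro CollectI exI[of _ f]) simp
  qed
  have "(q, a) \<in> type_at M e RPar \<longleftrightarrow> q \<in> P \<and> q \<noteq> fst e \<and> a \<in> \<Sigma> \<and>
      (\<forall>w w'. (a, w, w') \<in> indices P \<Sigma> \<longrightarrow> hd w = q \<longrightarrow> last w = fst e \<longrightarrow>
         (\<exists>i. last_pos M w e < i \<and> i \<le> first_pos M w' e - 1 \<and> letter M (q, i) = a))" for q a
    unfolding mem_iff by (intro conj_cong refl parallel_iff[OF e])
  then show ?thesis by (intro set_eqI) (simp only: split_paired_all mem_Collect_eq prod.case)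
qed

lemma type_par_claims:
  assumes e: "e \<in> events M"
    and c: "\<And>a w w'. (a, w, w') \<in> indices P \<Sigma> \<Longrightarrow> last w = fst e \<Longrightarrow> c (a, w, w') = None \<longleftrightarrow>
      (\<exists>i. last_pos M w e < i \<and> i \<le> first_pos M w' e - 1 \<and> letter M (hd w, i) = a)"
  shows "type_at M e RPar = {(q, a). q \<in> P \<and> q \<noteq> fst e \<and> a \<in> \<Sigma> \<and>
    (\<forall>w w'. (a, w, w') \<in> indices P \<Sigma> \<longrightarrow> hd w = q \<longrightarrow> last w = fst e \<longrightarrow> c (a, w, w') = None)}"
proof -
  have "(\<forall>w w'. (a, w, w') \<in> indices P \<Sigma> \<longrightarrow> hd w = q \<longrightarrow> last w = fst e \<longrightarrow>
      (\<exists>i. last_pos M w e < i \<and> i \<le> first_pos M w' e - 1 \<and> letter M (q, i) = a)) \<longleftrightarrow>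
    (\<forall>w w'. (a, w, w') \<in> indices P \<Sigma> \<longrightarrow> hd w = q \<longrightarrow> last w = fst e \<longrightarrow> c (a, w, w') = None)"
    for q a
    by (intro all_cong1 imp_cong refl) (simp only: c)
  then show ?thesis unfolding type_par[OF e] by (simp only:)
qed

lemma past_unique:
  assumes "\<And>e. e \<in> events M \<Longrightarrow> v e = (\<Union>f\<in>(proc_rel M)\<inverse> `` {e}. add_label (label M f) (v f)) \<union>
      (\<Union>f\<in>(msg M)\<inverse> `` {e}. add_label (label M f) (v f))"
    and e: "e \<in> events M"
  shows "v e = reach_labels ((edges M)\<inverse>) (label M) e"
proof (rule reach_labels_unique[OF _ _ _ e])
  show "wf (((edges M)\<inverse>)\<inverse>)" using wf_edges by simp
  show "(edges M)\<inverse> \<subseteq> events M \<times> events M" by (auto dest: edges_events)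
  show "v e = (\<Union>f\<in>(edges M)\<inverse> `` {e}. add_label (label M f) (v f))" if "e \<in> events M" for e
    unfolding edges_converse_image UN_Un by (rule assms(1)[OF that])
qed

lemma fut_unique:
  assumes "\<And>e. e \<in> events M \<Longrightarrow> v e = (\<Union>f\<in>proc_rel M `` {e}. add_label (label M f) (v f)) \<union>
      (\<Union>f\<in>msg M `` {e}. add_label (label M f) (v f))"
    and e: "e \<in> events M"
  shows "v e = reach_labels (edges M) (label M) e"
proof (rule reach_labels_unique[OF _ _ _ e])
  show "wf ((edges M)\<inverse>)" using wf_edges_converse .
  show "edges M \<subseteq> events M \<times> events M" by (auto dest: edges_events)
  show "v e = (\<Union>f\<in>edges M `` {e}. add_label (label M f) (v f))" if "e \<in> events M" for e
    unfolding edges_image UN_Un by (rule assms(1)[OF that])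
qed

end

section \<open>Local annotations determine the types\<close>

lemma prev_ok_cert: "prev_ok P \<Sigma> p y x \<Longrightarrow> k \<in> indices P \<Sigma> \<Longrightarrow> cert_ok p y x k"
  unfolding prev_ok_def by (elim conjE) (rule bspec)

lemma receive_ok_cert: "receive_ok P \<Sigma> q p m x \<Longrightarrow> k \<in> indices P \<Sigma> \<Longrightarrow> cert_msg_ok q p m x k"
  unfolding receive_ok_def by (elim conjE) (rule bspec)

lemma final_ok_cert: "final_ok P \<Sigma> st \<Longrightarrow> k \<in> indices P \<Sigma> \<Longrightarrow> cert_final_ok st k"
  unfolding final_ok_def by (elim conjE) (rule bspec)

context annotated_chart
begin

lemma lab_label: "e \<in> events M \<Longrightarrow> lab (fst e) (x e) = label M e"
  by (simp add: lab_def label_def letters)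

lemma src_None: "e \<in> events M \<Longrightarrow> src (x e) = None \<longleftrightarrow> (msg M)\<inverse> `` {e} = {}"
  using src[of e] by (cases "src (x e)") auto

lemma dst_None: "e \<in> events M \<Longrightarrow> dst (x e) = None \<longleftrightarrow> msg M `` {e} = {}"
  using dst[of e] by (cases "dst (x e)") auto

text \<open>The edge-related part of the local conditions in global form. It turns
  \<open>past\<close> and \<open>fut\<close> into solutions of the equation of
  \<open>reach_labels\<close>, and both soundness and completeness pass through it.\<close>

definition images_ok :: bool where
  "images_ok \<longleftrightarrow> (\<forall>e\<in>events M.
     etype (x e) RProcInv = label M ` ((proc_rel M)\<inverse> `` {e}) \<and>
     etype (x e) RMsgInv = label M ` ((msg M)\<inverse> `` {e}) \<and>
     etype (x e) RProc = label M ` (proc_rel M `` {e}) \<and>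
     etype (x e) RMsg = label M ` (msg M `` {e}) \<and>
     past_proc (x e) = (\<Union>f\<in>(proc_rel M)\<inverse> `` {e}. add_label (label M f) (past (x f))) \<and>
     past_msg (x e) = (\<Union>f\<in>(msg M)\<inverse> `` {e}. add_label (label M f) (past (x f))) \<and>
     fut_proc (x e) = (\<Union>f\<in>proc_rel M `` {e}. add_label (label M f) (fut (x f))) \<and>
     fut_msg (x e) = (\<Union>f\<in>msg M `` {e}. add_label (label M f) (fut (x f))))"

lemma past_reach:
  assumes ok: images_ok and e: "e \<in> events M"
  shows "past (x e) = reach_labels ((edges M)\<inverse>) (label M) e"
proof (rule past_unique[OF _ e])
  fix e assume e: "e \<in> events M"
  note ok = bspec[OF ok[unfolded images_ok_def] e]
  show "past (x e) = (\<Union>f\<in>(proc_rel M)\<inverse> `` {e}. add_label (label M f) (past (x f))) \<union>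
      (\<Union>f\<in>(msg M)\<inverse> `` {e}. add_label (label M f) (past (x f)))"
    unfolding past_def[of "x e"] by (rule arg_cong2; simp only: ok)
qed

lemma fut_reach:
  assumes ok: images_ok and e: "e \<in> events M"
  shows "fut (x e) = reach_labels (edges M) (label M) e"
proof (rule fut_unique[OF _ e])
  fix e assume e: "e \<in> events M"
  note ok = bspec[OF ok[unfolded images_ok_def] e]
  show "fut (x e) = (\<Union>f\<in>proc_rel M `` {e}. add_label (label M f) (fut (x f))) \<union>
      (\<Union>f\<in>msg M `` {e}. add_label (label M f) (fut (x f)))"
    unfolding fut_def[of "x e"] by (rule arg_cong2; simp only: ok)
qed

text \<open>The past and future fields are forced by unique solvability. Certificates need not be
  unique, but whether a claim is \<open>None\<close> is determined by
  \<open>certifies_sound\<close>, and this is all that the parallel type uses.\<close>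

lemma local_sound:
  assumes prev: "\<And>e. e \<in> events M \<Longrightarrow> prev_ok P \<Sigma> (fst e) (prev x e) (x e)"
    and rcv: "\<And>e f. (e, f) \<in> msg M \<Longrightarrow> receive_ok P \<Sigma> (fst e) (fst f) (x e) (x f)"
    and fin: "final_ok P \<Sigma> (final x)"
    and e: "e \<in> events M"
  shows "etype (x e) = type_at M e"
proof -
  have images: images_ok
    unfolding images_ok_def
  proof
    fix e assume e: "e \<in> events M"
    have before: "(fst e, snd e - 1) \<in> events M" if "snd e \<noteq> 1"
      using that e by (cases e) (auto simp: events_iff)
    have lab_before: "lab (fst e) (x (fst e, snd e - 1)) = label M (fst e, snd e - 1)"
      if "snd e \<noteq> 1" using lab_label[OF before[OF that]] by simp
    have i1: "etype (x e) RProcInv = label M ` ((proc_rel M)\<inverse> `` {e})"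
      and i2: "past_proc (x e) = (\<Union>f\<in>(proc_rel M)\<inverse> `` {e}. add_label (label M f) (past (x f)))"
      using prev[OF e] lab_before unfolding proc_converse_image[OF e] prev_ok_def prev_def
      by (cases "snd e = 1"; simp)+
    have i3: "etype (x e) RProc = label M ` (proc_rel M `` {e}) \<and>
        fut_proc (x e) = (\<Union>f\<in>proc_rel M `` {e}. add_label (label M f) (fut (x f)))"
    proof (cases "snd e = length (word M (fst e))")
      case True
      then show ?thesis using fin final_last[OF e True, of x]
        unfolding proc_image[OF e] final_ok_def by simp
    next
      case False
      note n = prev_next[OF e False]
      show ?thesis using prev[OF n(1)] lab_label[OF n(1)] False
        unfolding proc_image[OF e] prev_ok_def n(2) by simp
    qed
    have i4: "etype (x e) RMsgInv = label M ` ((msg M)\<inverse> `` {e}) \<and>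
        past_msg (x e) = (\<Union>f\<in>(msg M)\<inverse> `` {e}. add_label (label M f) (past (x f)))"
    proof (cases "(msg M)\<inverse> `` {e} = {}")
      case True
      then show ?thesis using prev[OF e] src_None[OF e] by (simp add: prev_ok_def)
    next
      case False
      then obtain s where s: "(s, e) \<in> msg M" by blast
      show ?thesis using rcv[OF s] lab_label[of s] msg_events[OF s]
        unfolding msg_converse_image[OF s] receive_ok_def by simp
    qed
    have i5: "etype (x e) RMsg = label M ` (msg M `` {e}) \<and>
        fut_msg (x e) = (\<Union>f\<in>msg M `` {e}. add_label (label M f) (fut (x f)))"
    proof (cases "msg M `` {e} = {}")
      case True
      then show ?thesis using prev[OF e] dst_None[OF e] by (simp add: prev_ok_def)
    next
      case False
      then obtain f where f: "(e, f) \<in> msg M" by blast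
      show ?thesis using rcv[OF f] lab_label[of f] msg_events[OF f]
        unfolding msg_image[OF f] receive_ok_def by simp
    qed
    show "etype (x e) RProcInv = label M ` ((proc_rel M)\<inverse> `` {e}) \<and>
     etype (x e) RMsgInv = label M ` ((msg M)\<inverse> `` {e}) \<and>
     etype (x e) RProc = label M ` (proc_rel M `` {e}) \<and>
     etype (x e) RMsg = label M ` (msg M `` {e}) \<and>
     past_proc (x e) = (\<Union>f\<in>(proc_rel M)\<inverse> `` {e}. add_label (label M f) (past (x f))) \<and>
     past_msg (x e) = (\<Union>f\<in>(msg M)\<inverse> `` {e}. add_label (label M f) (past (x f))) \<and>
     fut_proc (x e) = (\<Union>f\<in>proc_rel M `` {e}. add_label (label M f) (fut (x f))) \<and>
     fut_msg (x e) = (\<Union>f\<in>msg M `` {e}. add_label (label M f) (fut (x f)))"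
      by (intro conjI i1 i2 i3[THEN conjunct1] i3[THEN conjunct2] i4[THEN conjunct1]
          i4[THEN conjunct2] i5[THEN conjunct1] i5[THEN conjunct2])
  qed
  note past = past_reach[OF images e] and fut = fut_reach[OF images e]
  have simple: "etype (x e) r = type_at M e r" if "r \<in> {RProc, RProcInv, RMsg, RMsgInv}" for r
    using that bspec[OF images[unfolded images_ok_def] e]
    by (elim insertE emptyE) (simp_all only: type_at_image rel_of.simps)
  have far: "etype (x e) RFar = {l. (l, l \<in> etype (x e) RProc \<union> etype (x e) RMsg) \<in> fut (x e)}"
    and far_inv: "etype (x e) RFarInv =
      {l. (l, l \<in> etype (x e) RProcInv \<union> etype (x e) RMsgInv) \<in> past (x e)}"
    and eq: "etype (x e) REq = {lab (fst e) (x e)}"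
    and par: "etype (x e) RPar = {(q, a). q \<in> P \<and> q \<noteq> fst e \<and> a \<in> \<Sigma> \<and>
      (\<forall>w w'. (a, w, w') \<in> indices P \<Sigma> \<longrightarrow> hd w = q \<longrightarrow> last w = fst e \<longrightarrow>
         claim (x e) (a, w, w') = None)}"
    using prev[OF e, unfolded prev_ok_def] by - (elim conjE, assumption)+
  show ?thesis
  proof
    fix r
    show "etype (x e) r = type_at M e r"
    proof (cases r)
      case REq
      then show ?thesis using eq e by (auto simp: type_at_image lab_label)
    next
      case RFar
      show ?thesis unfolding RFar far type_far fut by (simp add: simple)
    next
      case RFarInv
      show ?thesis unfolding RFarInv far_inv type_far_inv past by (simp add: simple)
    next
      case RPar
      have "claim (x e) (a, w, w') = None \<longleftrightarrow>
          (\<exists>i. last_pos M w e < i \<and> i \<le> first_pos M w' e - 1 \<and> letter M (hd w, i) = a)"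
        if k: "(a, w, w') \<in> indices P \<Sigma>" "last w = fst e" for a w w'
      proof -
        have "certifies (a, w, w') (\<lambda>e. fwd (x e) (a, w, w')) (\<lambda>e. bwd (x e) (a, w, w'))
            (\<lambda>e. claim (x e) (a, w, w'))"
          by (rule certifies_if_local[OF k(1) refl prev_ok_cert[OF prev k(1)]
              receive_ok_cert[OF rcv k(1)] final_ok_cert[OF fin k(1)]])
        from certifies_sound[OF k(1) this e] k(2) show ?thesis by simp
      qed
      then show ?thesis unfolding RPar par by (rule type_par_claims[OF e, symmetric])
    qed (use simple in simp_all)
  qed
qed

lemma local_complete:
  assumes types: "\<And>e. e \<in> events M \<Longrightarrow> etype (x e) = type_at M e"
    and images: images_ok
    and cert: "\<And>k. k \<in> indices P \<Sigma> \<Longrightarrow>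
      certifies k (\<lambda>e. fwd (x e) k) (\<lambda>e. bwd (x e) k) (\<lambda>e. claim (x e) k)"
  shows "e \<in> events M \<Longrightarrow> prev_ok P \<Sigma> (fst e) (prev x e) (x e)"
    and "(e, f) \<in> msg M \<Longrightarrow> receive_ok P \<Sigma> (fst e) (fst f) (x e) (x f)"
    and "final_ok P \<Sigma> (final x)"
proof -
  have cert_local: "e \<in> events M \<Longrightarrow> cert_ok (fst e) (prev x e) (x e) k"
    "(e, f) \<in> msg M \<Longrightarrow> cert_msg_ok (fst e) (fst f) (x e) (x f) k"
    "cert_final_ok (final x) k" if "k \<in> indices P \<Sigma>" for k e f
    using that local_if_certifies[OF _ refl, of "fst k" "fst (snd k)" "snd (snd k)"] cert[OF that]
    by simp_all
  note past = past_reach[OF images] and fut = fut_reach[OF images]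
  note im = images[unfolded images_ok_def, rule_format]
  show "prev_ok P \<Sigma> (fst e) (prev x e) (x e)" if e: "e \<in> events M" for e
  proof -
    have before: "(fst e, snd e - 1) \<in> events M" if "snd e \<noteq> 1"
      using that e by (cases e) (auto simp: events_iff)
    have lab_before: "lab (fst e) (x (fst e, snd e - 1)) = label M (fst e, snd e - 1)"
      if "snd e \<noteq> 1" using lab_label[OF before[OF that]] by simp
    have c1: "etype (x e) REq = {lab (fst e) (x e)}"
      using e types[OF e] by (auto simp: type_at_image lab_label)
    have c2: "etype (x e) RProcInv = (case prev x e of None \<Rightarrow> {} | Some y \<Rightarrow> {lab (fst e) y})"
      and c3: "past_proc (x e) =
        (case prev x e of None \<Rightarrow> {} | Some y \<Rightarrow> add_label (lab (fst e) y) (past y))"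
      using im[OF e] lab_before unfolding proc_converse_image[OF e] prev_def
      by (cases "snd e = 1"; simp)+
    have c4: "etype y RProc = {lab (fst e) (x e)} \<and> fut_proc y = add_label (lab (fst e) (x e)) (fut (x e))"
      if y: "prev x e = Some y" for y
    proof -
      have s: "snd e \<noteq> 1" "y = x (fst e, snd e - 1)" using y by (auto simp: prev_def split: if_splits)
      have "proc_rel M `` {(fst e, snd e - 1)} = {e}"
        unfolding proc_image[OF before[OF s(1)]] using e s(1) by (cases e) (auto simp: events_iff)
      then show ?thesis using im[OF before[OF s(1)]] s(2) lab_label[OF e] by simp
    qed
    have c5: "src (x e) = None \<longrightarrow> etype (x e) RMsgInv = {} \<and> past_msg (x e) = {}"
      using im[OF e] src_None[OF e] by simp
    have c6: "dst (x e) = None \<longrightarrow> etype (x e) RMsg = {} \<and> fut_msg (x e) = {}"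
      using im[OF e] dst_None[OF e] by simp
    have c7: "etype (x e) RFar = {l. (l, l \<in> etype (x e) RProc \<union> etype (x e) RMsg) \<in> fut (x e)}"
      "etype (x e) RFarInv = {l. (l, l \<in> etype (x e) RProcInv \<union> etype (x e) RMsgInv) \<in> past (x e)}"
      unfolding types[OF e] past[OF e] fut[OF e] by (rule type_far type_far_inv)+
    have c8: "etype (x e) RPar = {(q, a). q \<in> P \<and> q \<noteq> fst e \<and> a \<in> \<Sigma> \<and>
       (\<forall>w w'. (a, w, w') \<in> indices P \<Sigma> \<longrightarrow> hd w = q \<longrightarrow> last w = fst e \<longrightarrow>
          claim (x e) (a, w, w') = None)}"
    proof -
      have "claim (x e) (a, w, w') = None \<longleftrightarrow>
          (\<exists>i. last_pos M w e < i \<and> i \<le> first_pos M w' e - 1 \<and> letter M (hd w, i) = a)"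
        if k: "(a, w, w') \<in> indices P \<Sigma>" "last w = fst e" for a w w'
        using certifies_sound[OF k(1) cert[OF k(1)] e] k(2) by simp
      then show ?thesis unfolding types[OF e] by (rule type_par_claims[OF e])
    qed
    show ?thesis
      unfolding prev_ok_def
    proof (intro conjI c1 c2 c3 c5 c6 c7 c8 allI impI ballI)
      fix y assume "prev x e = Some y"
      from c4[OF this] show "etype y RProc = {lab (fst e) (x e)}"
        "fut_proc y = add_label (lab (fst e) (x e)) (fut (x e))" by simp_all
    qed (rule cert_local(1)[OF _ e])
  qed
  show "receive_ok P \<Sigma> (fst e) (fst f) (x e) (x f)" if ef: "(e, f) \<in> msg M" for e f
  proof -
    have ev: "e \<in> events M" "f \<in> events M" using msg_events[OF ef] by auto
    have "src (x f) = Some (fst e)" using src[OF ev(2)] ef by blast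
    moreover have "msg M `` {f} = {}" using msg_unique[OF ef] msg_events by blast
    then have "dst (x f) = None" using dst_None[OF ev(2)] by simp
    ultimately show ?thesis
      using im[OF ev(1)] im[OF ev(2)] cert_local(2)[OF _ ef] lab_label[OF ev(1)] lab_label[OF ev(2)]
      unfolding receive_ok_def msg_image[OF ef] msg_converse_image[OF ef] by simp
  qed
  show "final_ok P \<Sigma> (final x)"
    unfolding final_ok_def
  proof (intro conjI allI impI ballI)
    fix p y assume y: "final x p = Some y"
    let ?e = "(p, length (word M p))"
    have e: "?e \<in> events M" "y = x ?e"
      using y by (auto simp: final_def events_iff Suc_le_eq split: if_splits)
    have "proc_rel M `` {?e} = {}" unfolding proc_image[OF e(1)] by simp
    then show "etype y RProc = {}" "fut_proc y = {}" using im[OF e(1)] e(2) by simp_all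
  qed (rule cert_local(3))
qed

end

section \<open>Charts with types and the size of the automaton\<close>

lemma length_attach [simp]: "length (word (attach M \<gamma>) p) = length (word M p)"
  by (simp add: attach_def del: upt_Suc)

lemma events_attach [simp]: "events (attach M \<gamma>) = events M"
  by (simp add: events_def)

lemma word_attach_Nil [simp]: "word (attach M \<gamma>) p = [] \<longleftrightarrow> word M p = []"
  by (metis length_attach length_0_conv)

lemma msg_attach [simp]: "msg (attach M \<gamma>) = msg M"
  by (simp add: attach_def)

lemma proc_rel_attach [simp]: "proc_rel (attach M \<gamma>) = proc_rel M"
  by (simp add: proc_rel_def)

lemma edges_attach [simp]: "edges (attach M \<gamma>) = edges M"
  by (simp add: edges_def)

lemma letter_attach:
  assumes "e \<in> events M" shows "letter (attach M \<gamma>) e = (letter M e, \<gamma> e)"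
  using assms by (cases e) (auto simp: events_def letter_def attach_def simp del: upt_Suc)

lemma attach_cong:
  assumes "\<And>e. e \<in> events M \<Longrightarrow> \<gamma> e = \<delta> e" shows "attach M \<gamma> = attach M \<delta>"
  using assms by (auto simp: attach_def events_def simp del: upt_Suc)

lemma word_eq_map_letter: "word M p = map (\<lambda>i. letter M (p, i)) [1..<length (word M p) + 1]"
  by (rule nth_equalityI) (auto simp: letter_def simp del: upt_Suc)

lemma word_in_lists: "word M p \<in> lists S \<longleftrightarrow> (\<forall>i. (p, i) \<in> events M \<longrightarrow> letter M (p, i) \<in> S)"
proof -
  have "word M p \<in> lists S \<longleftrightarrow> (\<forall>i\<in>set [1..<length (word M p) + 1]. letter M (p, i) \<in> S)"
    by (subst word_eq_map_letter) (simp add: in_lists_conv_set del: upt_Suc)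
  then show ?thesis by (auto simp: events_def simp del: upt_Suc)
qed

lemma MSC_attach_iff:
  "attach M \<gamma> \<in> MSC P (\<Sigma> \<times> \<Gamma>) \<longleftrightarrow> M \<in> MSC P \<Sigma> \<and> (\<forall>e\<in>events M. fst e \<in> P \<longrightarrow> \<gamma> e \<in> \<Gamma>)"
proof -
  have "(\<forall>p\<in>P. word (attach M \<gamma>) p \<in> lists (\<Sigma> \<times> \<Gamma>)) \<longleftrightarrow>
      (\<forall>p\<in>P. word M p \<in> lists \<Sigma>) \<and> (\<forall>e\<in>events M. fst e \<in> P \<longrightarrow> \<gamma> e \<in> \<Gamma>)"
    unfolding word_in_lists by (auto simp: letter_attach)
  then show ?thesis unfolding MSC_def by auto
qed

lemma attach_surj: "\<exists>N. M = attach N (\<lambda>e. snd (letter M e))"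
proof
  define N where "N = \<lparr>word = \<lambda>p. map fst (word M p), msg = msg M\<rparr>"
  have ev: "events N = events M" by (simp add: N_def events_def)
  have "letter N e = fst (letter M e)" if "e \<in> events M" for e
    using that by (cases e) (auto simp: N_def letter_def events_def)
  then have "word (attach N (\<lambda>e. snd (letter M e))) p = word M p" for p
    by (subst (2) word_eq_map_letter) (auto simp: attach_def N_def events_def simp del: upt_Suc)
  then show "M = attach N (\<lambda>e. snd (letter M e))"
    by (intro msc.equality ext) (simp_all add: N_def)
qed

text \<open>Extensional function spaces pin the values outside \<open>indices P \<Sigma>\<close>,
  which keeps the set finite over arbitrary types.\<close>

definition ann_set :: "'p set \<Rightarrow> 'a set \<Rightarrow> ('p, 'a) ann set" where
  "ann_set P \<Sigma> = {x. symb x \<in> \<Sigma> \<times> Types P \<Sigma> \<and>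
     src x \<in> insert None (Some ` P) \<and> dst x \<in> insert None (Some ` P) \<and>
     past_proc x \<subseteq> (P \<times> \<Sigma>) \<times> UNIV \<and> past_msg x \<subseteq> (P \<times> \<Sigma>) \<times> UNIV \<and>
     fut_proc x \<subseteq> (P \<times> \<Sigma>) \<times> UNIV \<and> fut_msg x \<subseteq> (P \<times> \<Sigma>) \<times> UNIV \<and>
     fwd x \<in> indices P \<Sigma> \<rightarrow>\<^sub>E UNIV \<and> bwd x \<in> indices P \<Sigma> \<rightarrow>\<^sub>E UNIV \<and>
     claim x \<in> indices P \<Sigma> \<rightarrow>\<^sub>E UNIV}"

abbreviation annotates_types ::
  "'p set \<Rightarrow> 'a set \<Rightarrow> ('p, 'a \<times> (rel_sym \<Rightarrow> ('p \<times> 'a) set)) msc \<Rightarrow>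
   ('p event \<Rightarrow> ('p, 'a) ann) \<Rightarrow> bool" where
  "annotates_types P \<Sigma> \<equiv> annotates symb (prev_ok P \<Sigma>) (\<lambda>p. internal_ok) (\<lambda>p. send_ok)
     (receive_ok P \<Sigma>) (final_ok P \<Sigma>) (ann_set P \<Sigma>)"

context chart
begin

lemma annotates_attach:
  "annotates symb ok0 okI okS okR okF X (attach M \<gamma>) x \<longleftrightarrow>
     (\<forall>e\<in>events M. x e \<in> X \<and> symb (x e) = (letter M e, \<gamma> e) \<and> ok0 (fst e) (prev x e) (x e)) \<and>
     (\<forall>e\<in>events M - Field (msg M). okI (fst e) (x e)) \<and>
     (\<forall>(e, f)\<in>msg M. okS (fst e) (fst f) (x e) \<and> okR (fst e) (fst f) (x e) (x f)) \<and>
     okF (final x)"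
proof -
  have "(\<lambda>p. if word (attach M \<gamma>) p = [] then None
      else Some (x (p, length (word (attach M \<gamma>) p)))) = final x"
    by (simp add: final_def fun_eq_iff)
  then show ?thesis by (simp add: annotates_def prev_def letter_attach cong: ball_cong)
qed

lemma type_at_Types: "type_at M e \<in> Types P \<Sigma>"
  using event_process letter_in by (fastforce simp: Types_def type_at_def label_def)

lemma annotation_sound:
  assumes x: "annotates_types P \<Sigma> (attach M \<gamma>) x" and e: "e \<in> events M"
  shows "\<gamma> e = type_at M e"
proof -
  note x = x[unfolded annotates_attach]
  have ev: "x e \<in> ann_set P \<Sigma>" "symb (x e) = (letter M e, \<gamma> e)"
    "prev_ok P \<Sigma> (fst e) (prev x e) (x e)" if "e \<in> events M" for e
    using x that by blast+
  have internal: "internal_ok (x e)" if "e \<in> events M" "e \<notin> Field (msg M)" for e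
    using x that by blast
  have msg: "send_ok (fst f) (x e)" "receive_ok P \<Sigma> (fst e) (fst f) (x e) (x f)"
    if "(e, f) \<in> msg M" for e f
    using x that by blast+
  \<comment> \<open>The three kinds of transitions exclude each other, and only sends set
    \<open>dst\<close> and only receives set \<open>src\<close>.\<close>
  interpret annotated_chart P \<Sigma> M x
  proof
    fix e q assume e: "e \<in> events M"
    show "src (x e) = Some q \<longleftrightarrow> (\<exists>s. (s, e) \<in> msg M \<and> fst s = q)"
    proof
      assume q: "src (x e) = Some q"
      then have "e \<in> Field (msg M)" using internal[OF e] by (auto simp: internal_ok_def)
      moreover have "(e, f) \<notin> msg M" for f using msg(1)[of e f] q by (auto simp: send_ok_def)
      ultimately obtain s where s: "(s, e) \<in> msg M" unfolding Field_def by blast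
      then have "fst s = q" using msg(2)[OF s] q by (simp add: receive_ok_def)
      then show "\<exists>s. (s, e) \<in> msg M \<and> fst s = q" using s by blast
    next
      assume "\<exists>s. (s, e) \<in> msg M \<and> fst s = q"
      then obtain s where s: "(s, e) \<in> msg M" "fst s = q" by blast
      then show "src (x e) = Some q" using msg(2)[OF s(1)] by (simp add: receive_ok_def)
    qed
    show "dst (x e) = Some q \<longleftrightarrow> (\<exists>f. (e, f) \<in> msg M \<and> fst f = q)"
    proof
      assume q: "dst (x e) = Some q"
      then have "e \<in> Field (msg M)" using internal[OF e] by (auto simp: internal_ok_def)
      moreover have "(s, e) \<notin> msg M" for s using msg(2)[of s e] q by (auto simp: receive_ok_def)
      ultimately obtain f where f: "(e, f) \<in> msg M" unfolding Field_def by blast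
      then have "fst f = q" using msg(1)[OF f] q by (simp add: send_ok_def)
      then show "\<exists>f. (e, f) \<in> msg M \<and> fst f = q" using f by blast
    next
      assume "\<exists>f. (e, f) \<in> msg M \<and> fst f = q"
      then obtain f where f: "(e, f) \<in> msg M" "fst f = q" by blast
      then show "dst (x e) = Some q" using msg(1)[OF f(1)] by (simp add: send_ok_def)
    qed
    show "fst (symb (x e)) = letter M e" using ev(2)[OF e] by simp
  qed
  have "etype (x e) = type_at M e"
    by (rule local_sound[OF ev(3) msg(2) x[THEN conjunct2, THEN conjunct2, THEN conjunct2] e])
  then show ?thesis using ev(2)[OF e] by (simp add: etype_def)
qed


lemma annotation_exists: "\<exists>x. annotates_types P \<Sigma> (attach M (type_at M)) x"
proof -
  have "\<forall>k\<in>indices P \<Sigma>. \<exists>fbz. certifies k (fst fbz) (fst (snd fbz)) (snd (snd fbz))"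
    using certifies_exists by force
  then obtain c where c: "\<And>k. k \<in> indices P \<Sigma> \<Longrightarrow>
      certifies k (fst (c k)) (fst (snd (c k))) (snd (snd (c k)))"
    by metis
  let ?past = "\<lambda>f. add_label (label M f) (reach_labels ((edges M)\<inverse>) (label M) f)"
  let ?fut = "\<lambda>f. add_label (label M f) (reach_labels (edges M) (label M) f)"
  define x where "x e = \<lparr>symb = (letter M e, type_at M e),
    src = (if \<exists>s. (s, e) \<in> msg M then Some (fst (THE s. (s, e) \<in> msg M)) else None),
    dst = (if \<exists>f. (e, f) \<in> msg M then Some (fst (THE f. (e, f) \<in> msg M)) else None),
    past_proc = (\<Union>f\<in>(proc_rel M)\<inverse> `` {e}. ?past f),
    past_msg = (\<Union>f\<in>(msg M)\<inverse> `` {e}. ?past f),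
    fut_proc = (\<Union>f\<in>proc_rel M `` {e}. ?fut f),
    fut_msg = (\<Union>f\<in>msg M `` {e}. ?fut f),
    fwd = (\<lambda>k\<in>indices P \<Sigma>. fst (c k) e),
    bwd = (\<lambda>k\<in>indices P \<Sigma>. fst (snd (c k)) e),
    claim = (\<lambda>k\<in>indices P \<Sigma>. snd (snd (c k)) e)\<rparr>" for e
  have src_eq: "src (x e) = Some (fst s)" if "(s, e) \<in> msg M" for s e
  proof -
    have "(THE s. (s, e) \<in> msg M) = s" using that msg_unique by (intro the_equality) blast+
    moreover have "\<exists>s. (s, e) \<in> msg M" using that by blast
    ultimately show ?thesis by (simp only: x_def ann.simps if_True)
  qed
  have dst_eq: "dst (x e) = Some (fst f)" if "(e, f) \<in> msg M" for e f
  proof -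
    have "(THE f. (e, f) \<in> msg M) = f" using that msg_unique by (intro the_equality) blast+
    moreover have "\<exists>f. (e, f) \<in> msg M" using that by blast
    ultimately show ?thesis by (simp only: x_def ann.simps if_True)
  qed
  have no_src: "src (x e) = None" if "\<not> (\<exists>s. (s, e) \<in> msg M)" for e
    using that by (simp only: x_def ann.simps if_False)
  have no_dst: "dst (x e) = None" if "\<not> (\<exists>f. (e, f) \<in> msg M)" for e
    using that by (simp only: x_def ann.simps if_False)
  interpret annotated_chart P \<Sigma> M x
  proof
    fix e q
    show "src (x e) = Some q \<longleftrightarrow> (\<exists>s. (s, e) \<in> msg M \<and> fst s = q)"
      using src_eq[of _ e] no_src[of e] by (cases "\<exists>s. (s, e) \<in> msg M") (auto dest: src_eq)
    show "dst (x e) = Some q \<longleftrightarrow> (\<exists>f. (e, f) \<in> msg M \<and> fst f = q)"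
      using dst_eq[of e] no_dst[of e] by (cases "\<exists>f. (e, f) \<in> msg M") (auto dest: dst_eq)
    show "fst (symb (x e)) = letter M e" by (simp add: x_def)
  qed
  have past: "past (x e) = reach_labels ((edges M)\<inverse>) (label M) e" for e
    by (subst reach_labels_unfold) (simp add: past_def x_def edges_converse_image UN_Un)
  have fut: "fut (x e) = reach_labels (edges M) (label M) e" for e
    by (subst reach_labels_unfold) (simp add: fut_def x_def edges_image UN_Un)
  have types: "etype (x e) = type_at M e" for e by (simp add: etype_def x_def)
  have images: images_ok
    unfolding images_ok_def past fut types type_at_image by (simp add: x_def)
  have cert: "certifies k (\<lambda>e. fwd (x e) k) (\<lambda>e. bwd (x e) k) (\<lambda>e. claim (x e) k)"
    if "k \<in> indices P \<Sigma>" for k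
    using c[OF that] that by (simp add: x_def)
  note loc = local_complete[OF types images cert]
  have labels: "label M f \<in> P \<times> \<Sigma>" if "f \<in> events M" for f
    using that event_process letter_in by (simp add: label_def)
  have reach_sub: "?past f \<subseteq> (P \<times> \<Sigma>) \<times> UNIV" "?fut f \<subseteq> (P \<times> \<Sigma>) \<times> UNIV" if "f \<in> events M" for f
  proof -
    have "reach_labels r (label M) f \<subseteq> (P \<times> \<Sigma>) \<times> UNIV" if "r \<subseteq> events M \<times> events M" for r
    proof -
      have "g \<in> events M" if "(f, g) \<in> r\<^sup>+" for g
        using that \<open>r \<subseteq> events M \<times> events M\<close> by (auto elim: tranclE)
      then show ?thesis using labels unfolding reach_labels_def by fastforce
    qed
    moreover have "edges M \<subseteq> events M \<times> events M" "(edges M)\<inverse> \<subseteq> events M \<times> events M"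
      by (auto dest: edges_events)
    ultimately show "?past f \<subseteq> (P \<times> \<Sigma>) \<times> UNIV" "?fut f \<subseteq> (P \<times> \<Sigma>) \<times> UNIV"
      using labels[OF that] by (auto simp: add_label_def)
  qed
  have "x e \<in> ann_set P \<Sigma>" if e: "e \<in> events M" for e
  proof -
    have nb: "f \<in> events M" if "f \<in> (proc_rel M)\<inverse> `` {e} \<or> f \<in> (msg M)\<inverse> `` {e} \<or>
        f \<in> proc_rel M `` {e} \<or> f \<in> msg M `` {e}" for f
      using that msg_events[of e f] msg_events[of f e] by (auto simp: proc_rel_iff)
    have "src (x e) \<in> insert None (Some ` P)"
    proof (cases "\<exists>s. (s, e) \<in> msg M")
      case True
      then obtain s where s: "(s, e) \<in> msg M" by blast
      then have "fst s \<in> P" using msg_events event_process by metis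
      then show ?thesis using src_eq[OF s] by simp
    qed (simp add: no_src)
    moreover have "dst (x e) \<in> insert None (Some ` P)"
    proof (cases "\<exists>f. (e, f) \<in> msg M")
      case True
      then obtain f where f: "(e, f) \<in> msg M" by blast
      then have "fst f \<in> P" using msg_events event_process by metis
      then show ?thesis using dst_eq[OF f] by simp
    qed (simp add: no_dst)
    moreover have "past_proc (x e) \<subseteq> (P \<times> \<Sigma>) \<times> UNIV" "past_msg (x e) \<subseteq> (P \<times> \<Sigma>) \<times> UNIV"
      "fut_proc (x e) \<subseteq> (P \<times> \<Sigma>) \<times> UNIV" "fut_msg (x e) \<subseteq> (P \<times> \<Sigma>) \<times> UNIV"
      unfolding x_def ann.simps by (intro UN_least reach_sub nb; blast)+
    moreover have "symb (x e) \<in> \<Sigma> \<times> Types P \<Sigma>"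
      using letter_in[OF e] type_at_Types by (simp add: x_def)
    moreover have "fwd (x e) \<in> indices P \<Sigma> \<rightarrow>\<^sub>E UNIV" "bwd (x e) \<in> indices P \<Sigma> \<rightarrow>\<^sub>E UNIV"
      "claim (x e) \<in> indices P \<Sigma> \<rightarrow>\<^sub>E UNIV"
      by (simp_all add: x_def)
    ultimately show ?thesis by (simp add: ann_set_def)
  qed
  moreover have "symb (x e) = (letter M e, type_at M e)" for e by (simp add: x_def)
  moreover have "internal_ok (x e)" if "e \<in> events M - Field (msg M)" for e
    using that no_src[of e] no_dst[of e] by (auto simp: internal_ok_def Field_def)
  moreover have "send_ok (fst f) (x e)" if "(e, f) \<in> msg M" for e f
  proof -
    have "\<not> (\<exists>s. (s, e) \<in> msg M)" using that msg_unique msg_events by metis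
    then show ?thesis using dst_eq[OF that] no_src[of e] by (simp add: send_ok_def)
  qed
  ultimately have "annotates_types P \<Sigma> (attach M (type_at M)) x"
    unfolding annotates_attach using loc by blast
  then show ?thesis by blast
qed

end

section \<open>Counting annotations\<close>

lemma card_distinct_lists:
  assumes "finite P"
  shows "finite {w. distinct w \<and> set w \<subseteq> P}"
    and "card {w. distinct w \<and> set w \<subseteq> P} \<le> (card P + 1) ^ card P"
proof -
  let ?n = "card P"
  have sub: "{w. distinct w \<and> set w \<subseteq> P} \<subseteq> {w. set w \<subseteq> P \<and> length w \<le> ?n}"
    using assms by (auto simp: distinct_card[symmetric] intro: card_mono)
  have fin: "finite {w. set w \<subseteq> P \<and> length w \<le> ?n}"
    using assms by (rule finite_lists_length_le)
  show "finite {w. distinct w \<and> set w \<subseteq> P}" using sub fin by (rule finite_subset)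
  have "card {w. distinct w \<and> set w \<subseteq> P} \<le> card {w. set w \<subseteq> P \<and> length w \<le> ?n}"
    using fin sub by (rule card_mono)
  also have "\<dots> = (\<Sum>i\<le>?n. ?n ^ i)" using assms by (rule card_lists_length_le)
  \<comment> \<open>Inserting binomial coefficients, each at least 1, completes the sum to a
    binomial expansion.\<close>
  also have "\<dots> \<le> (\<Sum>i\<le>?n. (?n choose i) * ?n ^ i)"
  proof (rule sum_mono)
    fix i assume "i \<in> {..?n}"
    then have "1 \<le> ?n choose i" by (simp add: Suc_leI)
    then show "?n ^ i \<le> (?n choose i) * ?n ^ i" by simp
  qed
  also have "\<dots> = (?n + 1) ^ ?n" using binomial[of ?n 1 ?n] by simp
  finally show "card {w. distinct w \<and> set w \<subseteq> P} \<le> (?n + 1) ^ ?n" .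
qed

lemma card_indices:
  assumes "finite P" "finite \<Sigma>"
  shows "finite (indices P \<Sigma>)"
    and "card (indices P \<Sigma>) \<le> card \<Sigma> * (card P + 1) ^ (2 * card P)"
proof -
  let ?W = "{w. distinct w \<and> set w \<subseteq> P}"
  have sub: "indices P \<Sigma> \<subseteq> \<Sigma> \<times> ?W \<times> ?W" by (auto simp: indices_def)
  have fin: "finite (\<Sigma> \<times> ?W \<times> ?W)" using assms card_distinct_lists(1)[OF assms(1)] by simp
  show "finite (indices P \<Sigma>)" using sub fin by (rule finite_subset)
  have "card (indices P \<Sigma>) \<le> card (\<Sigma> \<times> ?W \<times> ?W)" using fin sub by (rule card_mono)
  also have "\<dots> = card \<Sigma> * (card ?W * card ?W)" by (simp add: card_cartesian_product)
  also have "\<dots> \<le> card \<Sigma> * ((card P + 1) ^ card P * (card P + 1) ^ card P)"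
    by (intro mult_le_mono order_refl card_distinct_lists(2)[OF assms(1)])
  also have "\<dots> = card \<Sigma> * (card P + 1) ^ (2 * card P)"
    by (simp add: power_add[symmetric] mult_2)
  finally show "card (indices P \<Sigma>) \<le> card \<Sigma> * (card P + 1) ^ (2 * card P)" .
qed

lemma UNIV_rel_sym: "(UNIV :: rel_sym set) = {REq, RProc, RMsg, RPar, RProcInv, RMsgInv, RFar, RFarInv}"
  using rel_sym.exhaust by blast

lemma card_Types:
  assumes "finite P" "finite \<Sigma>"
  shows "finite (Types P \<Sigma>)" and "card (Types P \<Sigma>) = 2 ^ (8 * (card P * card \<Sigma>))"
proof -
  have eq: "Types P \<Sigma> = (UNIV \<rightarrow>\<^sub>E Pow (P \<times> \<Sigma>))" by (auto simp: Types_def)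
  have fin: "finite (UNIV :: rel_sym set)" by (simp add: UNIV_rel_sym)
  show "finite (Types P \<Sigma>)" unfolding eq using fin assms by (intro finite_PiE) auto
  have "card (Types P \<Sigma>) = card (Pow (P \<times> \<Sigma>)) ^ card (UNIV :: rel_sym set)"
    unfolding eq using fin by (simp add: card_PiE)
  also have "\<dots> = 2 ^ (8 * (card P * card \<Sigma>))"
  proof -
    have "card (UNIV :: rel_sym set) = 8" by (simp add: UNIV_rel_sym)
    moreover have "card (Pow (P \<times> \<Sigma>)) = 2 ^ (card P * card \<Sigma>)"
      using assms by (simp add: card_Pow card_cartesian_product)
    ultimately show ?thesis by (simp only: power_mult[symmetric] mult.commute)
  qed
  finally show "card (Types P \<Sigma>) = 2 ^ (8 * (card P * card \<Sigma>))" .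
qed

lemma card_ann_set:
  fixes P :: "'p set" and \<Sigma> :: "'a set"
  assumes P: "finite P" and S: "finite \<Sigma>"
  shows "finite (ann_set P \<Sigma>)"
    and "card (ann_set P \<Sigma>) \<le>
      2 ^ (card \<Sigma> + 16 * (card P * card \<Sigma>) + 2 * card P + 10 * card (indices P \<Sigma>))"
proof -
  let ?n = "card P" and ?s = "card \<Sigma>" and ?k = "card (indices P \<Sigma>)"
  let ?L = "Pow ((P \<times> \<Sigma>) \<times> (UNIV :: bool set))"
  let ?G = "indices P \<Sigma> \<rightarrow>\<^sub>E (UNIV :: gap set)"
  let ?C = "indices P \<Sigma> \<rightarrow>\<^sub>E (UNIV :: bool option set)"
  let ?Q = "insert None (Some ` P)"
  let ?B = "(\<Sigma> \<times> Types P \<Sigma>) \<times> ?Q \<times> ?Q \<times> ?L \<times> ?L \<times> ?L \<times> ?L \<times> ?G \<times> ?G \<times> ?C"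
  define tup where "tup x = (symb x, src x, dst x, past_proc x, past_msg x, fut_proc x, fut_msg x,
    fwd x, bwd x, claim x)" for x :: "('p, 'a) ann"
  have inj: "inj_on tup (ann_set P \<Sigma>)"
    by (rule inj_onI) (auto simp: tup_def intro: ann.equality)
  have sub: "tup ` ann_set P \<Sigma> \<subseteq> ?B" by (auto simp: tup_def ann_set_def)
  note fin_k = card_indices(1)[OF P S]
  have fin: "finite ?B"
    using P S card_Types(1)[OF P S] fin_k by (intro finite_cartesian_product finite_PiE) auto
  show "finite (ann_set P \<Sigma>)"
    using inj finite_subset[OF sub fin] by (rule finite_imageD[rotated])
  have Q: "card ?Q = ?n + 1" using P by (simp add: card_image)
  have L: "card ?L = 2 ^ (2 * (?n * ?s))"
    using P S by (simp add: card_Pow card_cartesian_product mult.commute)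
  have G: "card ?G = 12 ^ ?k" and C: "card ?C = 3 ^ ?k"
    using fin_k by (simp_all add: card_PiE)
  have "card (ann_set P \<Sigma>) \<le> card ?B" by (rule card_inj_on_le[OF inj sub fin])
  also have "\<dots> = ?s * 2 ^ (8 * (?n * ?s)) * ((?n + 1) * ((?n + 1) * (2 ^ (2 * (?n * ?s)) *
      (2 ^ (2 * (?n * ?s)) * (2 ^ (2 * (?n * ?s)) * (2 ^ (2 * (?n * ?s)) *
      (12 ^ ?k * (12 ^ ?k * 3 ^ ?k))))))))"
    unfolding card_cartesian_product Q L G C card_Types(2)[OF P S] ..
  \<comment> \<open>The 16 comes from 8 relation symbols and 4 label sets with 2 flag values. The 10
    is 4 + 4 + 2: \<open>fwd\<close> and \<open>bwd\<close> have 12 \<le> 2^4 values per index,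
    \<open>claim\<close> has 3 \<le> 2^2.\<close>
  also have "\<dots> \<le> 2 ^ ?s * 2 ^ (8 * (?n * ?s)) * (2 ^ ?n * (2 ^ ?n * (2 ^ (2 * (?n * ?s)) *
      (2 ^ (2 * (?n * ?s)) * (2 ^ (2 * (?n * ?s)) * (2 ^ (2 * (?n * ?s)) *
      ((2 ^ 4) ^ ?k * ((2 ^ 4) ^ ?k * (2 ^ 2) ^ ?k))))))))"
    by (intro mult_le_mono order_refl power_mono less_imp_le[OF less_exp]) (simp_all add: Suc_leI)
  also have "\<dots> = 2 ^ (?s + 16 * (?n * ?s) + 2 * ?n + 10 * ?k)"
    by (simp only: power_mult[symmetric] power_add[symmetric]) (simp add: algebra_simps)
  finally show "card (ann_set P \<Sigma>) \<le> 2 ^ (?s + 16 * (?n * ?s) + 2 * ?n + 10 * ?k)" .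
qed

text \<open>Every summand of the exponent is a multiple of something below \<open>?s * ?Y\<close>.
  The coefficients 1, 16, 2, 10 and the 1 for \<open>Suc\<close> add up to 30, rounded to 32. The
  extra factor in \<open>?Y\<close> makes \<open>card P + 1 \<le> ?Y\<close> immediate.\<close>

lemma ann_set_bound:
  assumes P: "finite P" and S: "finite \<Sigma>"
  shows "Suc (card (ann_set P \<Sigma>)) \<le> 2 ^ (card \<Sigma> * (32 * (card P + 1) ^ (2 * card P + 1)))"
proof (cases "\<Sigma> = {}")
  case True
  \<comment> \<open>Without letters there are no annotations, and both sides are 1.\<close>
  then show ?thesis by (simp add: ann_set_def)
next
  case False
  let ?n = "card P" and ?s = "card \<Sigma>" and ?k = "card (indices P \<Sigma>)"
  let ?Y = "(?n + 1) ^ (2 * ?n + 1)"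
  have s: "1 \<le> ?s" using False S by (simp add: Suc_leI card_gt_0_iff)
  have n: "?n + 1 \<le> ?Y" by (rule self_le_power) auto
  have "?k \<le> ?s * (?n + 1) ^ (2 * ?n)" by (rule card_indices(2)[OF P S])
  also have "\<dots> \<le> ?s * ?Y" by (intro mult_le_mono power_increasing) auto
  finally have k: "?k \<le> ?s * ?Y" .
  have nY: "?n \<le> ?s * ?Y"
  proof -
    have "1 * ?n \<le> ?s * ?Y" using s n by (intro mult_le_mono) linarith+
    then show ?thesis by simp
  qed
  have nsY: "?n * ?s \<le> ?s * ?Y" using n by (subst mult.commute) (intro mult_le_mono, linarith+)
  have sY: "?s \<le> ?s * ?Y" using n by simp
  have "Suc (card (ann_set P \<Sigma>)) \<le> 2 ^ (?s + 16 * (?n * ?s) + 2 * ?n + 10 * ?k) + 1"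
    using card_ann_set(2)[OF P S] by simp
  also have "\<dots> \<le> 2 ^ (?s + 16 * (?n * ?s) + 2 * ?n + 10 * ?k + 1)"
  proof -
    have "(1::nat) \<le> 2 ^ (?s + 16 * (?n * ?s) + 2 * ?n + 10 * ?k)" by simp
    then show ?thesis unfolding power_add[of 2 _ 1] power_one_right by linarith
  qed
  also have "\<dots> \<le> 2 ^ (?s * (32 * ?Y))"
  proof (rule power_increasing)
    have "1 \<le> ?s * ?Y" using s sY by linarith
    then have "?s + 16 * (?n * ?s) + 2 * ?n + 10 * ?k + 1 \<le> 32 * (?s * ?Y)"
      using k nY nsY sY by linarith
    then show "?s + 16 * (?n * ?s) + 2 * ?n + 10 * ?k + 1 \<le> ?s * (32 * ?Y)" by (simp add: mult.left_commute)
  qed simp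
  finally show ?thesis .
qed

theorem theorem13:
  shows "\<exists>g :: nat \<Rightarrow> real. g \<in> O(\<lambda>n. real n * ln (real n)) \<and>
    (\<forall>(P :: 'p set) (\<Sigma> :: 'a set). finite P \<longrightarrow> finite \<Sigma> \<longrightarrow>
      (\<exists>A :: ('p, 'a \<times> (rel_sym \<Rightarrow> ('p \<times> 'a) set), nat, nat) cfm.
        is_cfm P (\<Sigma> \<times> Types P \<Sigma>) A \<and>
        (\<forall>p\<in>P. real (card (states A p)) \<le> 2 powr (real (card \<Sigma>) * 2 powr g (card P))) \<and>
        language P (\<Sigma> \<times> Types P \<Sigma>) A = {attach M (type_at M) | M. M \<in> MSC P \<Sigma>}))"
proof -
  \<comment> \<open>The base 2 logarithm of \<open>32 * (n + 1) ^ (2 * n + 1)\<close>, with 5 for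
    the factor 32; it is fixed before \<open>P\<close> and \<open>\<Sigma>\<close> and hence uniform
    in both.\<close>
  define g :: "nat \<Rightarrow> real" where "g n = 5 + real (2 * n + 1) * log 2 (real (n + 1))" for n
  have "(\<lambda>n. 5 + real (2 * n + 1) * log 2 (real (n + 1))) \<in> O(\<lambda>n. real n * ln (real n))"
    unfolding log_def by real_asymp
  then have g: "g \<in> O(\<lambda>n. real n * ln (real n))" by (simp add: g_def[abs_def])
  have powr_g: "2 powr g n = real (32 * (n + 1) ^ (2 * n + 1))" for n
  proof -
    have "2 powr (real (2 * n + 1) * log 2 (real (n + 1))) = real (n + 1) powr real (2 * n + 1)"
      by (subst mult.commute, subst powr_powr[symmetric]) simp
    also have "\<dots> = real (n + 1) ^ (2 * n + 1)" by (rule powr_realpow) simp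
    finally have "2 powr g n = 2 powr 5 * real (n + 1) ^ (2 * n + 1)"
      unfolding g_def powr_add by simp
    moreover have "(2::real) powr 5 = 32" by simp
    ultimately show ?thesis by (simp only: of_nat_mult of_nat_power of_nat_numeral)
  qed
  show ?thesis
  proof (intro exI[of _ g] conjI g allI impI)
    fix P :: "'p set" and \<Sigma> :: "'a set"
    assume P: "finite P" and S: "finite \<Sigma>"
    obtain A :: "('p, 'a \<times> (rel_sym \<Rightarrow> ('p \<times> 'a) set), nat, nat) cfm"
      where A: "is_cfm P (\<Sigma> \<times> Types P \<Sigma>) A"
        "\<And>p. p \<in> P \<Longrightarrow> card (states A p) \<le> Suc (card (ann_set P \<Sigma>))"
        "language P (\<Sigma> \<times> Types P \<Sigma>) A =
          {M \<in> MSC P (\<Sigma> \<times> Types P \<Sigma>). \<exists>x. annotates_types P \<Sigma> M x}"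
      using local_cfm[OF P card_ann_set(1)[OF P S], of symb "\<Sigma> \<times> Types P \<Sigma>" "prev_ok P \<Sigma>"
          "\<lambda>p. internal_ok" "\<lambda>p. send_ok" "receive_ok P \<Sigma>" "final_ok P \<Sigma>"]
      by (auto simp: ann_set_def)
    have bound: "real (card (states A p)) \<le> 2 powr (real (card \<Sigma>) * 2 powr g (card P))" if "p \<in> P" for p
    proof -
      have "card (states A p) \<le> 2 ^ (card \<Sigma> * (32 * (card P + 1) ^ (2 * card P + 1)))"
        using A(2)[OF that] ann_set_bound[OF P S] by (rule order.trans)
      then have "real (card (states A p)) \<le> real (2 ^ (card \<Sigma> * (32 * (card P + 1) ^ (2 * card P + 1))))"
        by (rule of_nat_mono)
      also have "\<dots> = 2 powr real (card \<Sigma> * (32 * (card P + 1) ^ (2 * card P + 1)))"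
        by (simp only: powr_realpow zero_less_numeral of_nat_power of_nat_numeral)
      also have "\<dots> = 2 powr (real (card \<Sigma>) * 2 powr g (card P))"
        by (simp only: powr_g of_nat_mult)
      finally show ?thesis .
    qed
    have lang: "language P (\<Sigma> \<times> Types P \<Sigma>) A = {attach M (type_at M) | M. M \<in> MSC P \<Sigma>}"
    proof (intro set_eqI iffI)
      fix N assume "N \<in> language P (\<Sigma> \<times> Types P \<Sigma>) A"
      then obtain x where N: "N \<in> MSC P (\<Sigma> \<times> Types P \<Sigma>)" and x: "annotates_types P \<Sigma> N x"
        unfolding A(3) by blast
      obtain M \<gamma> where M: "N = attach M \<gamma>" using attach_surj by blast
      then have "M \<in> MSC P \<Sigma>" using N by (simp add: MSC_attach_iff)
      then interpret chart P \<Sigma> M using P by unfold_locales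
      have "attach M \<gamma> = attach M (type_at M)"
        by (rule attach_cong[OF annotation_sound[OF x[unfolded M]]])
      then have "N = attach M (type_at M)" using M by simp
      then show "N \<in> {attach M (type_at M) | M. M \<in> MSC P \<Sigma>}" using MSC by blast
    next
      fix N assume "N \<in> {attach M (type_at M) | M. M \<in> MSC P \<Sigma>}"
      then obtain M where M: "N = attach M (type_at M)" "M \<in> MSC P \<Sigma>" by blast
      then interpret chart P \<Sigma> M using P by unfold_locales
      have "N \<in> MSC P (\<Sigma> \<times> Types P \<Sigma>)" using M type_at_Types by (simp add: MSC_attach_iff)
      then show "N \<in> language P (\<Sigma> \<times> Types P \<Sigma>) A" unfolding A(3) M using annotation_exists by blast
    qed
    show "\<exists>A :: ('p, 'a \<times> (rel_sym \<Rightarrow> ('p \<times> 'a) set), nat, nat) cfm.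
        is_cfm P (\<Sigma> \<times> Types P \<Sigma>) A \<and>
        (\<forall>p\<in>P. real (card (states A p)) \<le> 2 powr (real (card \<Sigma>) * 2 powr g (card P))) \<and>
        language P (\<Sigma> \<times> Types P \<Sigma>) A = {attach M (type_at M) | M. M \<in> MSC P \<Sigma>}"
      using A(1) bound lang by blast
  qed
qed

end
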